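(* Let $g>0$ be a constant and let $F:\mathbb{R}\to\mathbb{R}$ be a continuously differentiable function with $F(0)=F(a)=F(1)=0$ for some $a\in\,]0,1[$, such that $F(s)>0$ for $s\in(-\infty,0[\,\cup\,]a,1[$ and $F(s)<0$ for $s\in\,]0,a[\,\cup\,]1,+\infty)$. Assume that \[F'(a)>0.\] Let $\beta>0$. Then, for every integer $N\ge 1$, there exists a value $\mu=\mu_N>0$ such that for each $\mu_2\ge\mu_1>\mu$ there is a value $\varepsilon=\varepsilon_{N,\mu_1,\mu_2}>0$ such that the following holds: for every $\beta$-periodic, locally integrable function $n:\mathbb{R}\to\mathbb{R}^+$ which can be written as $n(x)=\bar n+\tilde n(x)$ with $\bar n$ a constant and $\tilde n$ a $\beta$-periodic function satisfying \[\bar n\in[\mu_1,\mu_2]\quad\text{and}\quad |\tilde n|_1<\varepsilon,\] the equation \[v''-g\,v+n(x)F(v)=0\] has at least $2N$ solutions which are $\beta$-periodic and take values in $\,]0,1[$.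
   Context: $|\tilde n|_1$ denotes the $L^1$-norm of $\tilde n$ on an interval of length $\beta$, i.e. $\int_0^\beta|\tilde n(x)|\,dx$. Solutions are understood in the Carathéodory sense (absolutely continuous with absolutely continuous derivative, satisfying the equation almost everywhere). *)

theory Defs
  imports "HOL-Analysis.Analysis"
begin

definition abs_cont_on :: "(real \<Rightarrow> real) \<Rightarrow> real \<Rightarrow> real \<Rightarrow> bool" where
  "abs_cont_on f a b \<longleftrightarrow>
     (\<forall>e>0. \<exists>d>0. \<forall>(m::nat) (s::nat \<Rightarrow> real) t.
        (\<forall>i<m. a \<le> s i \<and> s i \<le> t i \<and> t i \<le> b) \<and>
        (\<forall>i<m. \<forall>j<m. i \<noteq> j \<longrightarrow> t i \<le> s j \<or> t j \<le> s i) \<and>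
        (\<Sum>i<m. t i - s i) < d
        \<longrightarrow> (\<Sum>i<m. \<bar>f (t i) - f (s i)\<bar>) < e)"

definition loc_abs_cont :: "(real \<Rightarrow> real) \<Rightarrow> bool" where
  "loc_abs_cont f \<longleftrightarrow> (\<forall>a b. a \<le> b \<longrightarrow> abs_cont_on f a b)"

definition carath_solution ::
  "real \<Rightarrow> (real \<Rightarrow> real) \<Rightarrow> (real \<Rightarrow> real) \<Rightarrow> (real \<Rightarrow> real) \<Rightarrow> bool" where
  "carath_solution g n F v \<longleftrightarrow>
     loc_abs_cont v \<and>
     (\<exists>v'. (\<forall>x. (v has_real_derivative v' x) (at x)) \<and> loc_abs_cont v' \<and>
        (AE x in lborel. \<exists>v''. (v' has_real_derivative v'') (at x) \<and>
                                v'' - g * v x + n x * F (v x) = 0))"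

end

theory Submission
  imports Defs
begin

text \<open>
  For large constant \<open>n = c\<close> the phase plane has a centre close to \<open>(a, 0)\<close> whose closed orbits, labelled
  by the velocity \<open>p\<close> with which they cross \<open>v = a\<close> upwards, have a continuous period \<open>T p\<close>. It is
  below \<open>\<beta> / (2 * N)\<close> for small \<open>p\<close> and exceeds \<open>\<beta>\<close> near the limiting homoclinic orbit, so each of the
  winding numbers \<open>j = 1, ..., 2 * N\<close> is resonant. It suffices to find one periodic solution for each \<open>j\<close>.

  For \<open>n\<close> close to \<open>c\<close> in \<open>L\<^sup>1\<close>, start at time \<open>t\<close> in \<open>(a, p)\<close>, let \<open>t\<^sub>j\<close> be the \<open>j\<close>-th return time to
  \<open>v = a\<close> with velocity \<open>w\<^sub>j\<close>, and put \<open>e\<^sub>j = w\<^sub>j\<^sup>2 / 2\<close>. As \<open>F a = 0\<close>, everything depends Lipschitz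
  continuously on \<open>(t, p)\<close> although \<open>n\<close> is merely integrable. If \<open>A\<close> is the action between \<open>t\<close> and \<open>t\<^sub>j\<close>,
  then \<open>G = A + e\<^sub>j * (t\<^sub>j - t - \<beta>)\<close> is \<open>\<beta>\<close>-periodic in \<open>t\<close> and satisfies
  \<open>dG = (t\<^sub>j - t - \<beta>) de\<^sub>j - (e\<^sub>j - p\<^sup>2 / 2) dt\<close>. A minimum of \<open>G\<close> over a strip \<open>p1 \<le> p \<le> p2\<close> is interior
  by the twist of \<open>T\<close>, and there \<open>t\<^sub>j = t + \<beta>\<close> and \<open>w\<^sub>j = p\<close>: the solution is \<open>\<beta>\<close>-periodic. Solutions for
  different \<open>j\<close> differ because the energy determines \<open>p\<close>, hence \<open>T p\<close>, up to a small error.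
\<close>

section \<open>Primitives of locally integrable functions\<close>

text \<open>For a merely integrable \<open>n\<close> the return map has no derivative: moving the
  start time of an orbit changes its velocity by an integral of \<open>n\<close> times the force
  factor, for which no linear bound exists in general. The section \<open>v = a\<close> is chosen to
  repair this. There the factor of \<open>n\<close> vanishes, so near a crossing it is of the order
  of the elapsed time, and the velocity becomes Lipschitz in time as seen from the crossing.
  Derivatives of \<open>G\<close> are then replaced by expansions with quadratic remainder, which
  suffice at a minimum. The minimum uses the sign of \<open>tj - t - \<beta>\<close> only on the two
  edges of the strip, so the period may oscillate in between. It gives one fixed point per winding
  number, where the Poincare-Birkhoff theorem gives two; hence \<open>2 * N\<close> winding numbers
  instead of \<open>N\<close>. Smallness of the perturbation is first obtained for each constant
  \<open>c\<close> separately; compactness of the interval of admissible means makes it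
  uniform.\<close>

definition loc_integrable :: "(real \<Rightarrow> real) \<Rightarrow> bool" where
  "loc_integrable \<phi> \<longleftrightarrow> (\<forall>s t. \<phi> absolutely_integrable_on {s..t})"

text \<open>The equation \<open>x' = \<phi>\<close> in integrated form, which handles absolutely
  continuous functions without differentiating them. Only \<open>s \<le> t\<close> is asked because
  \<open>integral {s..t}\<close> is 0 for \<open>t < s\<close>, not the oriented integral.\<close>

definition primitive_of :: "(real \<Rightarrow> real) \<Rightarrow> (real \<Rightarrow> real) \<Rightarrow> bool" where
  "primitive_of x \<phi> \<longleftrightarrow> loc_integrable \<phi> \<and> (\<forall>s t. s \<le> t \<longrightarrow> x t - x s = integral {s..t} \<phi>)"

lemma loc_integrableD: "loc_integrable \<phi> \<Longrightarrow> \<phi> absolutely_integrable_on {s..t}"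
  by (simp add: loc_integrable_def)

lemma loc_integrable_imp_integrable: "loc_integrable \<phi> \<Longrightarrow> \<phi> integrable_on {s..t}"
  using loc_integrableD set_lebesgue_integral_eq_integral(1) by blast

lemma loc_integrable_continuous: "continuous_on UNIV \<phi> \<Longrightarrow> loc_integrable \<phi>"
  unfolding loc_integrable_def
  by (meson absolutely_integrable_continuous_real continuous_on_subset subset_UNIV)

lemma loc_integrable_const [simp]: "loc_integrable (\<lambda>t. c)"
  by (rule loc_integrable_continuous) auto

lemma loc_integrable_add: "loc_integrable \<phi> \<Longrightarrow> loc_integrable \<psi> \<Longrightarrow> loc_integrable (\<lambda>t. \<phi> t + \<psi> t)"
  unfolding loc_integrable_def by (simp add: set_integral_add(1))

lemma loc_integrable_diff: "loc_integrable \<phi> \<Longrightarrow> loc_integrable \<psi> \<Longrightarrow> loc_integrable (\<lambda>t. \<phi> t - \<psi> t)"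
  unfolding loc_integrable_def by (simp add: set_integral_diff(1))

lemma loc_integrable_mult_continuous:
  assumes "loc_integrable \<phi>" "continuous_on UNIV x"
  shows "loc_integrable (\<lambda>t. x t * \<phi> t)"
  unfolding loc_integrable_def
proof (intro allI)
  fix s t :: real
  have c: "continuous_on {s..t} x"
    using assms(2) continuous_on_subset by blast
  show "(\<lambda>t. x t * \<phi> t) absolutely_integrable_on {s..t}"
  proof (rule absolutely_integrable_bounded_measurable_product_real)
    show "x \<in> borel_measurable (lebesgue_on {s..t})"
      using c by (simp add: continuous_imp_measurable_on_sets_lebesgue)
    show "bounded (x ` {s..t})"
      by (simp add: c compact_continuous_image compact_imp_bounded)
    show "\<phi> absolutely_integrable_on {s..t}" by (rule loc_integrableD[OF assms(1)])
  qed simp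
qed

lemma loc_integrable_mult_continuous':
  "loc_integrable \<phi> \<Longrightarrow> continuous_on UNIV x \<Longrightarrow> loc_integrable (\<lambda>t. \<phi> t * x t)"
  using loc_integrable_mult_continuous[of \<phi> x] by (simp add: mult.commute)

lemma loc_integrable_abs: "loc_integrable \<phi> \<Longrightarrow> loc_integrable (\<lambda>t. \<bar>\<phi> t\<bar>)"
  unfolding loc_integrable_def using absolutely_integrable_norm[where 'a=real and 'b=real]
  by (simp add: o_def)

lemma loc_integrable_uminus: "loc_integrable \<phi> \<Longrightarrow> loc_integrable (\<lambda>t. - \<phi> t)"
  using loc_integrable_diff[of "\<lambda>t. 0" \<phi>] by simp

lemma loc_integrable_reflect: "loc_integrable \<phi> \<Longrightarrow> loc_integrable (\<lambda>t. \<phi> (- t))"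
  unfolding loc_integrable_def
proof (intro allI)
  fix s t assume "\<forall>s t. \<phi> absolutely_integrable_on {s..t}"
  then have "\<phi> absolutely_integrable_on {-t..-s}" by blast
  then show "(\<lambda>t. \<phi> (- t)) absolutely_integrable_on {s..t}"
    using absolutely_integrable_reflect_real[where f=\<phi> and a="-t" and b="-s"] by simp
qed

lemma loc_integrable_shift:
  assumes "loc_integrable \<phi>" shows "loc_integrable (\<lambda>t. \<phi> (t + d))"
  unfolding loc_integrable_def
proof (intro allI)
  fix s t
  have 1: "\<phi> integrable_on {s+d..t+d}" "(\<lambda>x. \<bar>\<phi> x\<bar>) integrable_on {s+d..t+d}"
    using assms loc_integrable_abs loc_integrable_imp_integrable by blast+
  have 2: "(\<phi> \<circ> (+) d) integrable_on {s..t}" "((\<lambda>x. \<bar>\<phi> x\<bar>) \<circ> (+) d) integrable_on {s..t}"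
    using 1 by (auto simp: integrable_on_def has_integral_shift_Icc_real)
  show "(\<lambda>t. \<phi> (t + d)) absolutely_integrable_on {s..t}"
    unfolding absolutely_integrable_on_def using 2 by (simp add: o_def add.commute)
qed

lemma integral_shift: "integral {s+d..t+d} \<phi> = integral {s..t} (\<lambda>x. \<phi> (x + d))" for s t d :: real
  using integral_shift_Icc_real[of s t \<phi> d] by (simp add: o_def add.commute)

lemma primitive_ofI:
  "loc_integrable \<phi> \<Longrightarrow> (\<And>s t. s \<le> t \<Longrightarrow> x t - x s = integral {s..t} \<phi>) \<Longrightarrow> primitive_of x \<phi>"
  by (simp add: primitive_of_def)

lemma primitive_of_loc: "primitive_of x \<phi> \<Longrightarrow> loc_integrable \<phi>"
  by (simp add: primitive_of_def)

lemma primitive_ofD: "primitive_of x \<phi> \<Longrightarrow> s \<le> t \<Longrightarrow> x t - x s = integral {s..t} \<phi>"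
  by (simp add: primitive_of_def)

lemma primitive_of_exists:
  assumes "loc_integrable \<phi>"
  shows "\<exists>x. primitive_of x \<phi> \<and> x t0 = x0"
proof -
  \<comment> \<open>At most one of the two intervals is nondegenerate, so the difference is the
    oriented integral from \<open>t0\<close> to \<open>t\<close>.\<close>
  define x where "x t = x0 + (integral {t0..t} \<phi> - integral {t..t0} \<phi>)" for t
  have int: "\<phi> integrable_on {s..t}" for s t
    using assms loc_integrable_imp_integrable by blast
  have z: "integral {s..t} \<phi> = 0" if "t \<le> s" for s t
    using that by (cases "s = t") auto
  have "x t - x s = integral {s..t} \<phi>" if "s \<le> t" for s t
  proof -
    consider "t0 \<le> s" | "s \<le> t0" "t0 \<le> t" | "t \<le> t0" by linarith
    then show ?thesis
    proof cases
      case 1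
      then show ?thesis
        using Henstock_Kurzweil_Integration.integral_combine[OF 1 that int] z that
        by (simp add: x_def)
    next
      case 2
      then show ?thesis
        using Henstock_Kurzweil_Integration.integral_combine[OF 2 int] z[of t0 t] z[of s t0] z that
        by (simp add: x_def)
    next
      case 3
      then show ?thesis
        using Henstock_Kurzweil_Integration.integral_combine[OF that 3 int] z that
        by (simp add: x_def)
    qed
  qed
  then have "primitive_of x \<phi>"
    using assms by (simp add: primitive_of_def)
  moreover have "x t0 = x0" by (simp add: x_def)
  ultimately show ?thesis by blast
qed

lemma primitive_of_cong_density:
  "primitive_of x \<phi> \<Longrightarrow> (\<And>t. \<phi> t = \<psi> t) \<Longrightarrow> primitive_of x \<psi>"
  using ext[of \<phi> \<psi>] by simp

lemma primitive_of_add: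
  assumes "primitive_of x \<phi>" "primitive_of y \<psi>"
  shows "primitive_of (\<lambda>t. x t + y t) (\<lambda>t. \<phi> t + \<psi> t)"
proof (rule primitive_ofI)
  fix s t :: real assume "s \<le> t"
  have "integral {s..t} (\<lambda>t. \<phi> t + \<psi> t) = integral {s..t} \<phi> + integral {s..t} \<psi>"
    using assms by (intro integral_add loc_integrable_imp_integrable primitive_of_loc)
  then show "x t + y t - (x s + y s) = integral {s..t} (\<lambda>t. \<phi> t + \<psi> t)"
    using primitive_ofD[OF assms(1) \<open>s \<le> t\<close>] primitive_ofD[OF assms(2) \<open>s \<le> t\<close>] by simp
qed (use assms loc_integrable_add primitive_of_loc in blast)

lemma primitive_of_cmult:
  assumes "primitive_of x \<phi>"
  shows "primitive_of (\<lambda>t. c * x t) (\<lambda>t. c * \<phi> t)"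
proof (rule primitive_ofI)
  show "loc_integrable (\<lambda>t. c * \<phi> t)"
    using assms by (intro loc_integrable_mult_continuous primitive_of_loc) auto
  fix s t :: real assume "s \<le> t"
  then have "c * (x t - x s) = c * integral {s..t} \<phi>"
    using primitive_ofD[OF assms] by simp
  then show "c * x t - c * x s = integral {s..t} (\<lambda>t. c * \<phi> t)"
    by (simp add: right_diff_distrib)
qed

lemma primitive_of_diff:
  assumes "primitive_of x \<phi>" "primitive_of y \<psi>"
  shows "primitive_of (\<lambda>t. x t - y t) (\<lambda>t. \<phi> t - \<psi> t)"
  using primitive_of_add[OF assms(1) primitive_of_cmult[OF assms(2), of "-1"]] by simp

lemma primitive_of_shift:
  assumes "primitive_of x \<phi>"
  shows "primitive_of (\<lambda>t. x (t + d)) (\<lambda>t. \<phi> (t + d))"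
  using assms by (auto simp: primitive_of_def loc_integrable_shift integral_shift[symmetric])

lemma primitive_of_reflect:
  assumes "primitive_of x \<phi>"
  shows "primitive_of (\<lambda>t. x (- t)) (\<lambda>t. - \<phi> (- t))"
proof (rule primitive_ofI)
  show "loc_integrable (\<lambda>t. - \<phi> (- t))"
    using assms loc_integrable_reflect loc_integrable_uminus primitive_of_loc by blast
  fix s t :: real assume "s \<le> t"
  have "integral {s..t} (\<lambda>t. \<phi> (- t)) = integral {-t..-s} \<phi>"
    using Henstock_Kurzweil_Integration.integral_reflect_real[of "-s" "-t" \<phi>] by simp
  then show "x (- t) - x (- s) = integral {s..t} (\<lambda>t. - \<phi> (- t))"
    using primitive_ofD[OF assms, of "-t" "-s"] \<open>s \<le> t\<close> by simp
qed

lemma primitive_of_add_const: "primitive_of x \<phi> \<Longrightarrow> primitive_of (\<lambda>t. x t + c) \<phi>"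
  by (simp add: primitive_of_def)

lemma primitive_of_mono:
  assumes "primitive_of x \<phi>" "primitive_of y \<psi>" "s \<le> t"
    and "\<And>r. s \<le> r \<Longrightarrow> r \<le> t \<Longrightarrow> \<phi> r \<le> \<psi> r"
  shows "x t - x s \<le> y t - y s"
  unfolding primitive_ofD[OF assms(1,3)] primitive_ofD[OF assms(2,3)]
  by (intro integral_le loc_integrable_imp_integrable primitive_of_loc[OF assms(1)]
      primitive_of_loc[OF assms(2)]) (simp add: assms(4))

lemma primitive_of_abs_le:
  assumes "primitive_of x \<phi>" "primitive_of y \<psi>" "s \<le> t"
    and "\<And>r. s \<le> r \<Longrightarrow> r \<le> t \<Longrightarrow> \<bar>\<phi> r\<bar> \<le> \<psi> r"
  shows "\<bar>x t - x s\<bar> \<le> y t - y s"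
proof -
  have "x t - x s \<le> y t - y s"
    by (rule primitive_of_mono[OF assms(1-3)]) (use assms(4) in force)
  moreover have "- x t - - x s \<le> y t - y s"
    using primitive_of_mono[OF primitive_of_cmult[OF assms(1), of "-1"] assms(2,3)] assms(4) by force
  ultimately show ?thesis by linarith
qed

lemma primitive_of_ident: "primitive_of (\<lambda>t. t) (\<lambda>t. 1)"
  unfolding primitive_of_def by simp

lemma primitive_of_abs_le_const:
  assumes "primitive_of x \<phi>" and "\<And>r. min s t \<le> r \<Longrightarrow> r \<le> max s t \<Longrightarrow> \<bar>\<phi> r\<bar> \<le> C"
  shows "\<bar>x t - x s\<bar> \<le> C * \<bar>t - s\<bar>"
proof -
  have C: "primitive_of (\<lambda>t. C * t) (\<lambda>t. C)"
    using primitive_of_cmult[OF primitive_of_ident, where c=C] by simp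
  show ?thesis
  proof (cases "s \<le> t")
    case True
    have "\<bar>x t - x s\<bar> \<le> C * t - C * s"
      by (rule primitive_of_abs_le[OF assms(1) C True]) (use True in \<open>auto intro: assms(2)\<close>)
    then show ?thesis using True by (simp add: right_diff_distrib)
  next
    case False
    then have ts: "t \<le> s" by simp
    have "\<bar>x s - x t\<bar> \<le> C * s - C * t"
      by (rule primitive_of_abs_le[OF assms(1) C ts]) (use ts in \<open>auto intro: assms(2)\<close>)
    then show ?thesis using ts by (simp add: right_diff_distrib abs_minus_commute[of "x t"])
  qed
qed

lemma primitive_of_continuous:
  assumes "primitive_of x \<phi>" shows "continuous_on UNIV x"
proof (rule continuous_at_imp_continuous_on, rule ballI)
  fix t :: real
  have "continuous_on {t-1..t+1} (\<lambda>r. x (t-1) + integral {t-1..r} \<phi>)"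
    using assms by (intro continuous_intros indefinite_integral_continuous_1
        loc_integrable_imp_integrable primitive_of_loc)
  then have "continuous_on {t-1..t+1} x"
    by (rule continuous_on_eq) (use primitive_ofD[OF assms] in force)
  then show "isCont x t"
    using continuous_on_interior[of "{t-1..t+1}" x t] by simp
qed

lemma primitive_of_has_derivative:
  assumes "primitive_of x \<phi>" "continuous_on UNIV \<phi>"
  shows "(x has_real_derivative \<phi> t) (at t)"
proof -
  have "((\<lambda>r. integral {t-1..r} \<phi>) has_vector_derivative \<phi> t) (at t within {t-1..t+1})"
    by (rule integral_has_vector_derivative) (use assms(2) continuous_on_subset in auto)
  then have "((\<lambda>r. x (t-1) + integral {t-1..r} \<phi>) has_real_derivative \<phi> t) (at t within {t-1..t+1})"
    unfolding has_real_derivative_iff_has_vector_derivative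
    by (auto intro!: derivative_eq_intros)
  then have "(x has_real_derivative \<phi> t) (at t within {t-1..t+1})"
    by (rule has_field_derivative_transform_within[where d=1])
       (use primitive_ofD[OF assms(1)] in \<open>force+\<close>)
  then show ?thesis
    using at_within_interior[of t "{t-1..t+1}"] by simp
qed

lemma primitive_of_derivative:
  assumes "\<And>t. (x has_real_derivative \<phi> t) (at t)" "continuous_on UNIV \<phi>"
  shows "primitive_of x \<phi>"
proof (rule primitive_ofI)
  show "loc_integrable \<phi>" by (rule loc_integrable_continuous[OF assms(2)])
  fix s t :: real assume "s \<le> t"
  then have "(\<phi> has_integral (x t - x s)) {s..t}"
    by (intro fundamental_theorem_of_calculus)
      (auto intro: has_field_derivative_at_within assms(1)
        simp flip: has_real_derivative_iff_has_vector_derivative)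
  then show "x t - x s = integral {s..t} \<phi>"
    by (simp add: integral_unique)
qed

text \<open>This takes the place of differentiation almost everywhere in the product and chain rules.\<close>

lemma additive_eq_if_locally_small:
  fixes D \<mu> :: "real \<Rightarrow> real"
  assumes "s \<le> t"
    and small: "\<And>\<eta>. \<eta> > 0 \<Longrightarrow> \<exists>\<delta>>0. \<forall>x y. s \<le> x \<and> x \<le> y \<and> y \<le> t \<and> y - x < \<delta> \<longrightarrow>
                  \<bar>D y - D x\<bar> \<le> \<eta> * (\<mu> y - \<mu> x)"
  shows "D t = D s"
proof -
  have key: "\<bar>D t - D s\<bar> \<le> \<eta> * (\<mu> t - \<mu> s)" if \<eta>: "\<eta> > 0" for \<eta>
  proof -
    obtain \<delta> where "\<delta> > 0" and \<delta>: "\<And>x y. s \<le> x \<Longrightarrow> x \<le> y \<Longrightarrow> y \<le> t \<Longrightarrow> y - x < \<delta> \<Longrightarrow>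
        \<bar>D y - D x\<bar> \<le> \<eta> * (\<mu> y - \<mu> x)"
      using small[OF \<eta>] by meson
    obtain n :: nat where n: "(t - s) / \<delta> < real n" using reals_Archimedean2 by blast
    have "0 \<le> (t - s) / \<delta>" using \<open>s \<le> t\<close> \<open>\<delta> > 0\<close> by simp
    with n have "n > 0" by (metis of_nat_0_less_iff order_le_less_trans)
    \<comment> \<open>Equal pieces shorter than \<open>\<delta>\<close>; both sides of the local
      bound telescope.\<close>
    define x where "x i = s + real i * ((t - s) / n)" for i
    have x0: "x 0 = s" and xn: "x n = t" using \<open>n > 0\<close> by (auto simp: x_def)
    have xd: "x (Suc i) - x i = (t - s) / n" for i
      by (simp add: x_def distrib_right add_divide_distrib)
    have step: "(t - s) / n < \<delta>" using n \<open>\<delta> > 0\<close> \<open>n > 0\<close> by (simp add: field_simps)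
    have xle: "s \<le> x i" for i using \<open>s \<le> t\<close> by (simp add: x_def)
    have xge: "x i \<le> t" if "i \<le> n" for i
    proof -
      have "real i * ((t - s) / n) \<le> real n * ((t - s) / n)"
        using that \<open>s \<le> t\<close> by (intro mult_right_mono) auto
      then show ?thesis using \<open>n > 0\<close> by (simp add: x_def)
    qed
    have "D t - D s = (\<Sum>i<n. D (x (Suc i)) - D (x i))"
      using sum_lessThan_telescope[of "\<lambda>i. D (x i)" n] x0 xn by simp
    also have "\<bar>\<dots>\<bar> \<le> (\<Sum>i<n. \<bar>D (x (Suc i)) - D (x i)\<bar>)" by (rule sum_abs)
    also have "\<dots> \<le> (\<Sum>i<n. \<eta> * (\<mu> (x (Suc i)) - \<mu> (x i)))"
    proof (rule sum_mono)
      fix i assume "i \<in> {..<n}"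
      moreover have "0 \<le> (t - s) / n" using \<open>s \<le> t\<close> by simp
      ultimately show "\<bar>D (x (Suc i)) - D (x i)\<bar> \<le> \<eta> * (\<mu> (x (Suc i)) - \<mu> (x i))"
        using xd[of i] step xle[of i] xge[of "Suc i"] by (intro \<delta>) auto
    qed
    also have "\<dots> = \<eta> * (\<mu> t - \<mu> s)"
      using sum_lessThan_telescope[of "\<lambda>i. \<mu> (x i)" n] x0 xn by (simp add: sum_distrib_left[symmetric])
    finally show ?thesis .
  qed
  show ?thesis
  proof (rule ccontr)
    assume "D t \<noteq> D s"
    then have pos: "\<bar>D t - D s\<bar> > 0" by simp
    \<comment> \<open>Chosen so that \<open>key\<close> bounds \<open>\<bar>D t - D s\<bar>\<close>
      by half of itself; the added 1 covers \<open>\<mu> t = \<mu> s\<close>.\<close>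
    define \<eta> where "\<eta> = \<bar>D t - D s\<bar> / (2 * (\<bar>\<mu> t - \<mu> s\<bar> + 1))"
    have "\<eta> > 0" unfolding \<eta>_def by (intro divide_pos_pos pos mult_pos_pos add_nonneg_pos) auto
    have "\<eta> * (\<mu> t - \<mu> s) \<le> \<eta> * (\<bar>\<mu> t - \<mu> s\<bar> + 1)"
      using \<open>\<eta> > 0\<close> by (intro mult_left_mono) auto
    also have "\<dots> = \<bar>D t - D s\<bar> / 2"
    proof -
      have "\<bar>\<mu> t - \<mu> s\<bar> + 1 \<noteq> 0" by linarith
      then show ?thesis unfolding \<eta>_def by (simp add: divide_simps)
    qed
    finally have "\<bar>D t - D s\<bar> \<le> \<bar>D t - D s\<bar> / 2" using key[OF \<open>\<eta> > 0\<close>] by (rule order_trans[rotated])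
    then show False using pos by simp
  qed
qed

lemma primitive_of_mult:
  assumes x: "primitive_of x \<phi>" and y: "primitive_of y \<psi>"
  shows "primitive_of (\<lambda>t. x t * y t) (\<lambda>t. \<phi> t * y t + x t * \<psi> t)"
proof -
  have cx: "continuous_on UNIV x" and cy: "continuous_on UNIV y"
    using assms primitive_of_continuous by auto
  have loc: "loc_integrable (\<lambda>t. \<phi> t * y t + x t * \<psi> t)"
    using assms cx cy by (intro loc_integrable_add loc_integrable_mult_continuous
        loc_integrable_mult_continuous' primitive_of_loc)
  then obtain z where z: "primitive_of z (\<lambda>t. \<phi> t * y t + x t * \<psi> t)"
    using primitive_of_exists by blast
  obtain m where m: "primitive_of m (\<lambda>t. \<bar>\<phi> t\<bar> + \<bar>\<psi> t\<bar>)"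
    using primitive_of_exists[OF loc_integrable_add[OF loc_integrable_abs[OF primitive_of_loc[OF x]]
        loc_integrable_abs[OF primitive_of_loc[OF y]]]] by blast
  show ?thesis
  proof (rule primitive_ofI[OF loc])
    fix s t :: real assume "s \<le> t"
    have "x t * y t - z t = x s * y s - z s"
    proof (rule additive_eq_if_locally_small[OF \<open>s \<le> t\<close>, where \<mu>=m])
      fix \<eta> :: real assume "\<eta> > 0"
      have "uniformly_continuous_on {s..t} x" "uniformly_continuous_on {s..t} y"
        using cx cy by (auto intro!: compact_uniformly_continuous intro: continuous_on_subset)
      then obtain d1 d2 where d: "d1 > 0" "d2 > 0"
        and d1: "\<And>p q. p \<in> {s..t} \<Longrightarrow> q \<in> {s..t} \<Longrightarrow> dist q p < d1 \<Longrightarrow> dist (x q) (x p) < \<eta>"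
        and d2: "\<And>p q. p \<in> {s..t} \<Longrightarrow> q \<in> {s..t} \<Longrightarrow> dist q p < d2 \<Longrightarrow> dist (y q) (y p) < \<eta>"
        using \<open>\<eta> > 0\<close> unfolding uniformly_continuous_on_def by metis
      show "\<exists>\<delta>>0. \<forall>p q. s \<le> p \<and> p \<le> q \<and> q \<le> t \<and> q - p < \<delta> \<longrightarrow>
          \<bar>x q * y q - z q - (x p * y p - z p)\<bar> \<le> \<eta> * (m q - m p)"
      proof (intro exI[of _ "min d1 d2"] conjI allI impI)
        fix p q assume pq: "s \<le> p \<and> p \<le> q \<and> q \<le> t \<and> q - p < min d1 d2"
        \<comment> \<open>With one factor frozen at each end, \<open>u\<close> is linear in
          \<open>x\<close> and \<open>y\<close>, yet its increment over \<open>{p..q}\<close> is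
          exactly that of \<open>x * y - z\<close>.\<close>
        define u where "u r = x r * y q + x p * y r - z r" for r
        have u: "primitive_of u (\<lambda>r. y q * \<phi> r + x p * \<psi> r - (\<phi> r * y r + x r * \<psi> r))"
          unfolding u_def
          using primitive_of_diff[OF primitive_of_add[OF primitive_of_cmult[OF x, of "y q"]
                primitive_of_cmult[OF y, of "x p"]] z] by (simp add: mult.commute)
        have "\<bar>u q - u p\<bar> \<le> \<eta> * m q - \<eta> * m p"
        proof (rule primitive_of_abs_le[OF u primitive_of_cmult[OF m]])
          show "p \<le> q" using pq by simp
          fix r assume r: "p \<le> r" "r \<le> q"
          have 1: "\<bar>y q - y r\<bar> \<le> \<eta>" using d2[of r q] r pq by (auto simp: dist_real_def)
          have 2: "\<bar>x p - x r\<bar> \<le> \<eta>" using d1[of r p] r pq by (auto simp: dist_real_def)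
          have "y q * \<phi> r + x p * \<psi> r - (\<phi> r * y r + x r * \<psi> r) = (y q - y r) * \<phi> r + (x p - x r) * \<psi> r"
            by (simp add: algebra_simps)
          also have "\<bar>\<dots>\<bar> \<le> \<bar>y q - y r\<bar> * \<bar>\<phi> r\<bar> + \<bar>x p - x r\<bar> * \<bar>\<psi> r\<bar>"
            by (metis abs_mult abs_triangle_ineq)
          also have "\<dots> \<le> \<eta> * \<bar>\<phi> r\<bar> + \<eta> * \<bar>\<psi> r\<bar>"
            using 1 2 by (intro add_mono mult_right_mono) auto
          finally show "\<bar>y q * \<phi> r + x p * \<psi> r - (\<phi> r * y r + x r * \<psi> r)\<bar> \<le> \<eta> * (\<bar>\<phi> r\<bar> + \<bar>\<psi> r\<bar>)"
            by (simp add: distrib_left)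
        qed
        moreover have "u q - u p = x q * y q - z q - (x p * y p - z p)"
          by (simp add: u_def algebra_simps)
        ultimately show "\<bar>x q * y q - z q - (x p * y p - z p)\<bar> \<le> \<eta> * (m q - m p)"
          by (simp add: right_diff_distrib)
      qed (use d in auto)
    qed
    then show "x t * y t - x s * y s = integral {s..t} (\<lambda>t. \<phi> t * y t + x t * \<psi> t)"
      using primitive_ofD[OF z \<open>s \<le> t\<close>] by simp
  qed
qed

lemma primitive_of_compose:
  assumes x: "primitive_of x \<phi>" and h: "\<And>r. (h has_real_derivative h' r) (at r)"
    and ch': "continuous_on UNIV h'"
  shows "primitive_of (\<lambda>t. h (x t)) (\<lambda>t. h' (x t) * \<phi> t)"
proof -
  have cx: "continuous_on UNIV x" using assms primitive_of_continuous by auto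
  have ch: "continuous_on UNIV (\<lambda>t. h' (x t))"
    by (rule continuous_on_compose2[OF ch' cx]) auto
  have loc: "loc_integrable (\<lambda>t. h' (x t) * \<phi> t)"
    using x ch loc_integrable_mult_continuous primitive_of_loc by blast
  then obtain z where z: "primitive_of z (\<lambda>t. h' (x t) * \<phi> t)"
    using primitive_of_exists by blast
  obtain m where m: "primitive_of m (\<lambda>t. \<bar>\<phi> t\<bar>)"
    using primitive_of_exists[OF loc_integrable_abs[OF primitive_of_loc[OF x]]] by blast
  show ?thesis
  proof (rule primitive_ofI[OF loc])
    fix s t :: real assume "s \<le> t"
    have "h (x t) - z t = h (x s) - z s"
    proof (rule additive_eq_if_locally_small[OF \<open>s \<le> t\<close>, where \<mu>=m])
      fix \<eta> :: real assume "\<eta> > 0"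
      have cxst: "continuous_on {s..t} x" using cx continuous_on_subset by blast
      obtain lo hi where im: "x ` {s..t} = {lo..hi}"
        using continuous_image_closed_interval[OF \<open>s \<le> t\<close> cxst] by blast
      have "uniformly_continuous_on {lo..hi} h'"
        by (rule compact_uniformly_continuous) (use ch' continuous_on_subset in auto)
      then obtain e where "e > 0"
        and e: "\<And>p q. p \<in> {lo..hi} \<Longrightarrow> q \<in> {lo..hi} \<Longrightarrow> dist q p < e \<Longrightarrow> dist (h' q) (h' p) < \<eta>"
        using \<open>\<eta> > 0\<close> unfolding uniformly_continuous_on_def by metis
      have "uniformly_continuous_on {s..t} x"
        using cxst by (auto intro!: compact_uniformly_continuous)
      then obtain d where "d > 0"
        and d: "\<And>p q. p \<in> {s..t} \<Longrightarrow> q \<in> {s..t} \<Longrightarrow> dist q p < d \<Longrightarrow> dist (x q) (x p) < e / 2"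
        using \<open>e > 0\<close> unfolding uniformly_continuous_on_def by (metis half_gt_zero)
      show "\<exists>\<delta>>0. \<forall>p q. s \<le> p \<and> p \<le> q \<and> q \<le> t \<and> q - p < \<delta> \<longrightarrow>
          \<bar>h (x q) - z q - (h (x p) - z p)\<bar> \<le> \<eta> * (m q - m p)"
      proof (intro exI[of _ d] conjI allI impI)
        fix p q assume pq: "s \<le> p \<and> p \<le> q \<and> q \<le> t \<and> q - p < d"
        obtain \<xi> where \<xi>: "h (x q) - h (x p) = (x q - x p) * h' \<xi>" "min (x p) (x q) \<le> \<xi>" "\<xi> \<le> max (x p) (x q)"
        proof -
          consider "x p < x q" | "x q < x p" | "x p = x q" by linarith
          then show ?thesis
          proof cases
            case 1 then show ?thesis using MVT2[OF 1 h] that by (metis less_eq_real_def max_def min_def)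
          next
            case 2
            then obtain \<xi> where "\<xi> > x q" "\<xi> < x p" "h (x p) - h (x q) = (x p - x q) * h' \<xi>"
              using MVT2[OF 2 h] by blast
            then show ?thesis using that[of \<xi>] by (auto simp: algebra_simps)
          next
            case 3 then show ?thesis using that[of "x p"] by simp
          qed
        qed
        \<comment> \<open>The slope is frozen at the mean value point, so the increment of
          \<open>u\<close> is exactly that of \<open>h (x t) - z t\<close>, while its density
          carries the small factor \<open>h' \<xi> - h' (x r)\<close>.\<close>
        define u where "u r = h' \<xi> * x r - z r" for r
        have u: "primitive_of u (\<lambda>r. h' \<xi> * \<phi> r - h' (x r) * \<phi> r)"
          unfolding u_def by (intro primitive_of_diff primitive_of_cmult x z)
        have "\<bar>u q - u p\<bar> \<le> \<eta> * m q - \<eta> * m p"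
        proof (rule primitive_of_abs_le[OF u primitive_of_cmult[OF m]])
          show "p \<le> q" using pq by simp
          fix r assume r: "p \<le> r" "r \<le> q"
          have "dist (x r) (x p) < e / 2" "dist (x q) (x p) < e / 2"
            using d[of p r] d[of p q] r pq by (auto simp: dist_real_def)
          then have "dist \<xi> (x r) < e" using \<xi>(2,3) unfolding dist_real_def by linarith
          moreover have "x p \<in> {lo..hi}" "x q \<in> {lo..hi}" "x r \<in> {lo..hi}"
            using im r pq by (metis atLeastAtMost_iff image_eqI order_trans)+
          moreover from this have "\<xi> \<in> {lo..hi}" using \<xi>(2,3) by (auto simp: min_def max_def split: if_splits)
          ultimately have "\<bar>h' \<xi> - h' (x r)\<bar> \<le> \<eta>" using e[of "x r" \<xi>] by (auto simp: dist_real_def)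
          then have "\<bar>h' \<xi> - h' (x r)\<bar> * \<bar>\<phi> r\<bar> \<le> \<eta> * \<bar>\<phi> r\<bar>" by (rule mult_right_mono) auto
          then show "\<bar>h' \<xi> * \<phi> r - h' (x r) * \<phi> r\<bar> \<le> \<eta> * \<bar>\<phi> r\<bar>"
            by (simp add: left_diff_distrib[symmetric] abs_mult)
        qed
        moreover have "u q - u p = h (x q) - z q - (h (x p) - z p)"
          using \<xi>(1) by (simp add: u_def algebra_simps)
        ultimately show "\<bar>h (x q) - z q - (h (x p) - z p)\<bar> \<le> \<eta> * (m q - m p)"
          by (simp add: right_diff_distrib)
      qed (use \<open>d > 0\<close> in auto)
    qed
    then show "h (x t) - h (x s) = integral {s..t} (\<lambda>t. h' (x t) * \<phi> t)"
      using primitive_ofD[OF z \<open>s \<le> t\<close>] by simp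
  qed
qed

lemma periodic_value_in_interval:
  fixes f :: "real \<Rightarrow> 'a"
  assumes "0 < \<beta>" "\<And>t. f (t + \<beta>) = f t"
  shows "\<exists>t'\<in>{t0..t0 + \<beta>}. f t' = f t"
proof -
  have shift: "f (s + real n * \<beta>) = f s" for s n
  proof (induction n)
    case (Suc n)
    have "s + real (Suc n) * \<beta> = (s + real n * \<beta>) + \<beta>" by (simp add: algebra_simps)
    then show ?case by (simp only: assms(2) Suc)
  qed simp
  define k where "k = \<lfloor>(t - t0) / \<beta>\<rfloor>"
  define t' where "t' = t - of_int k * \<beta>"
  have "of_int k \<le> (t - t0) / \<beta>" "(t - t0) / \<beta> < of_int k + 1" unfolding k_def by linarith+
  then have "of_int k * \<beta> \<le> t - t0" "t - t0 < (of_int k + 1) * \<beta>"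
    using assms(1) by (simp_all add: pos_le_divide_eq pos_divide_less_eq)
  then have t': "t' \<in> {t0..t0 + \<beta>}" by (simp add: t'_def algebra_simps)
  have "f t' = f t"
  proof (cases "0 \<le> k")
    case True
    then have "t = t' + real (nat k) * \<beta>" by (simp add: t'_def)
    then show ?thesis using shift[of t' "nat k"] by simp
  next
    case False
    then have "t' = t + real (nat (- k)) * \<beta>" by (simp add: t'_def)
    then show ?thesis using shift[of t "nat (- k)"] by simp
  qed
  then show ?thesis using t' by blast
qed

section \<open>Gronwall inequality and solutions of the Cauchy problem\<close>

text \<open>With \<open>Y t = A + W t - W t0\<close>, the product of \<open>Y\<close> and the
  integrating factor \<open>exp (- K t)\<close> is nonincreasing. The product rule for primitives
  allows \<open>\<kappa>\<close> to be merely integrable.\<close>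

lemma gronwall_forward:
  fixes z \<kappa> K W :: "real \<Rightarrow> real"
  assumes W: "primitive_of W (\<lambda>t. \<kappa> t * z t)" and K: "primitive_of K \<kappa>"
    and \<kappa>: "\<And>t. 0 \<le> \<kappa> t"
    and z: "\<And>t. t0 \<le> t \<Longrightarrow> t \<le> t1 \<Longrightarrow> z t \<le> A + (W t - W t0)"
    and t: "t0 \<le> t1"
  shows "z t1 \<le> A * exp (K t1 - K t0)"
proof -
  define E where "E t = exp (- K t)" for t
  have E: "primitive_of E (\<lambda>t. - E t * \<kappa> t)"
    unfolding E_def
    by (rule primitive_of_compose[OF K, where h="\<lambda>r. exp (- r)" and h'="\<lambda>r. - exp (- r)"])
      (auto intro!: derivative_eq_intros continuous_intros)
  define Y where "Y t = W t + (A - W t0)" for t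
  have Y: "primitive_of Y (\<lambda>t. \<kappa> t * z t)"
    unfolding Y_def by (rule primitive_of_add_const[OF W])
  have "Y t1 * E t1 - Y t0 * E t0 \<le> 0 * t1 - 0 * t0"
  proof (rule primitive_of_mono[OF primitive_of_mult[OF Y E] primitive_of_cmult[OF primitive_of_ident] t])
    fix r assume r: "t0 \<le> r" "r \<le> t1"
    have "\<kappa> r * E r * (z r - Y r) \<le> 0"
      by (rule mult_nonneg_nonpos) (use \<kappa> z[OF r] in \<open>auto simp: Y_def E_def\<close>)
    then show "\<kappa> r * z r * E r + Y r * (- E r * \<kappa> r) \<le> 0 * 1"
      by (simp add: algebra_simps)
  qed
  then have "Y t1 * E t1 \<le> A * E t0" by (simp add: Y_def)
  then have "Y t1 \<le> A * E t0 / E t1" by (simp add: E_def pos_le_divide_eq)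
  also have "\<dots> = A * exp (K t1 - K t0)"
    by (simp add: E_def exp_minus exp_diff divide_simps)
  finally show ?thesis using z[of t1] t by (simp add: Y_def)
qed

lemma primitive_of_nonneg_mono:
  assumes "primitive_of x \<phi>" "\<And>t. 0 \<le> \<phi> t" "s \<le> t"
  shows "x s \<le> x t"
  using primitive_of_mono[OF primitive_of_cmult[OF primitive_of_ident, of 0] assms(1,3)] assms(2) by simp

text \<open>For \<open>t1 < t0\<close> the forward inequality is applied after reversing time;
  reversal changes the sign of a primitive, hence \<open>- W (- t)\<close> and
  \<open>- K (- t)\<close>.\<close>

lemma gronwall:
  fixes z \<kappa> K W :: "real \<Rightarrow> real"
  assumes W: "primitive_of W (\<lambda>t. \<kappa> t * z t)" and K: "primitive_of K \<kappa>"
    and \<kappa>: "\<And>t. 0 \<le> \<kappa> t" and z0: "\<And>t. 0 \<le> z t"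
    and z: "\<And>t. min t0 t1 \<le> t \<Longrightarrow> t \<le> max t0 t1 \<Longrightarrow> z t \<le> A + \<bar>W t - W t0\<bar>"
  shows "z t1 \<le> A * exp \<bar>K t1 - K t0\<bar>"
proof (cases "t0 \<le> t1")
  case True
  have "z t1 \<le> A * exp (K t1 - K t0)"
  proof (rule gronwall_forward[OF W K \<kappa> _ True])
    fix t assume "t0 \<le> t" "t \<le> t1"
    moreover have "W t0 \<le> W t"
      by (rule primitive_of_nonneg_mono[OF W]) (use \<kappa> z0 \<open>t0 \<le> t\<close> in auto)
    ultimately show "z t \<le> A + (W t - W t0)" using z[of t] True by simp
  qed
  moreover have "K t0 \<le> K t1" by (rule primitive_of_nonneg_mono[OF K \<kappa> True])
  ultimately show ?thesis by simp
next
  case False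
  then have le: "- t0 \<le> - t1" by simp
  have W': "primitive_of (\<lambda>t. - W (- t)) (\<lambda>t. \<kappa> (- t) * z (- t))"
    using primitive_of_cmult[OF primitive_of_reflect[OF W], of "-1"] by simp
  have K': "primitive_of (\<lambda>t. - K (- t)) (\<lambda>t. \<kappa> (- t))"
    using primitive_of_cmult[OF primitive_of_reflect[OF K], of "-1"] by simp
  have "z (- (- t1)) \<le> A * exp (- K (- (- t1)) - - K (- (- t0)))"
  proof (rule gronwall_forward[where z="\<lambda>t. z (- t)", OF W' K' _ _ le])
    show "0 \<le> \<kappa> (- t)" for t by (rule \<kappa>)
    fix t assume t: "- t0 \<le> t" "t \<le> - t1"
    have "W (- t) \<le> W t0"
      by (rule primitive_of_nonneg_mono[OF W]) (use \<kappa> z0 t in auto)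
    then show "z (- t) \<le> A + (- W (- t) - - W (- (- t0)))" using z[of "-t"] t False by simp
  qed
  moreover have "K t1 \<le> K t0" by (rule primitive_of_nonneg_mono[OF K \<kappa>]) (use False in simp)
  moreover from this have "\<bar>K t1 - K t0\<bar> = - K t1 - - K t0" by simp
  ultimately show ?thesis by simp
qed

text \<open>The force is split so that \<open>f1\<close> alone carries the merely integrable
  coefficient \<open>m\<close>. In the application \<open>f0 v = g * v\<close> and
  \<open>f1 v = - F v\<close> on \<open>[0,1]\<close>, so \<open>f1\<close> vanishes on the section
  \<open>v = a\<close>.\<close>

definition solution ::
  "(real \<Rightarrow> real) \<Rightarrow> (real \<Rightarrow> real) \<Rightarrow> (real \<Rightarrow> real) \<Rightarrow> (real \<Rightarrow> real) \<Rightarrow> (real \<Rightarrow> real) \<Rightarrow> bool" where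
  "solution f0 f1 m v w \<longleftrightarrow>
     primitive_of v w \<and> primitive_of w (\<lambda>t. f0 (v t) + m t * f1 (v t))"

locale bounded_lipschitz =
  fixes f0 f1 :: "real \<Rightarrow> real" and B L :: real
  assumes f0_bound: "\<bar>f0 x\<bar> \<le> B" and f1_bound: "\<bar>f1 x\<bar> \<le> B"
    and f0_lip: "\<bar>f0 x - f0 y\<bar> \<le> L * \<bar>x - y\<bar>" and f1_lip: "\<bar>f1 x - f1 y\<bar> \<le> L * \<bar>x - y\<bar>"
    and L_nonneg: "0 \<le> L"
begin

lemma B_nonneg: "0 \<le> B"
  using f0_bound[of 0] by linarith

lemma f_continuous: "continuous_on UNIV f0" "continuous_on UNIV f1"
proof -
  have "L-lipschitz_on UNIV f0" "L-lipschitz_on UNIV f1"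
    by (auto simp: lipschitz_on_def dist_real_def f0_lip f1_lip L_nonneg)
  then show "continuous_on UNIV f0" "continuous_on UNIV f1"
    using lipschitz_on_continuous_on by auto
qed

lemma loc_integrable_rhs:
  assumes "loc_integrable m" "continuous_on UNIV v"
  shows "loc_integrable (\<lambda>t. f0 (v t) + m t * f1 (v t))"
  by (intro loc_integrable_add loc_integrable_mult_continuous' assms(1) loc_integrable_continuous
      continuous_on_compose2[OF f_continuous(1) assms(2)] continuous_on_compose2[OF f_continuous(2) assms(2)])
    auto

lemma rhs_bound: "\<bar>f0 x + m * f1 x\<bar> \<le> B * (1 + \<bar>m\<bar>)"
proof -
  have "\<bar>f0 x + m * f1 x\<bar> \<le> \<bar>f0 x\<bar> + \<bar>m\<bar> * \<bar>f1 x\<bar>"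
    by (metis abs_mult abs_triangle_ineq)
  also have "\<dots> \<le> B + \<bar>m\<bar> * B"
    using f0_bound[of x] f1_bound[of x] by (intro add_mono mult_left_mono) auto
  finally show ?thesis by (simp add: algebra_simps)
qed

lemma rhs_lip: "\<bar>(f0 x + m * f1 x) - (f0 y + m' * f1 y)\<bar> \<le> L * (1 + \<bar>m\<bar>) * \<bar>x - y\<bar> + B * \<bar>m - m'\<bar>"
proof -
  have "(f0 x + m * f1 x) - (f0 y + m' * f1 y) = (f0 x - f0 y) + m * (f1 x - f1 y) + (m - m') * f1 y"
    by (simp add: algebra_simps)
  also have "\<bar>\<dots>\<bar> \<le> \<bar>f0 x - f0 y\<bar> + \<bar>m\<bar> * \<bar>f1 x - f1 y\<bar> + \<bar>m - m'\<bar> * \<bar>f1 y\<bar>"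
    unfolding abs_mult[symmetric] by linarith
  also have "\<dots> \<le> L * \<bar>x - y\<bar> + \<bar>m\<bar> * (L * \<bar>x - y\<bar>) + \<bar>m - m'\<bar> * B"
    by (intro add_mono mult_left_mono f0_lip f1_lip f1_bound) auto
  finally show ?thesis by (simp add: algebra_simps)
qed

text \<open>Existence by Banach's fixed point theorem in a weighted sup norm on all of the real line;
  the weight grows so fast that each integration gains a factor one half.\<close>

lemma solution_exists:
  assumes m: "loc_integrable m"
  shows "\<exists>v w. solution f0 f1 m v w \<and> v t0 = x0 \<and> w t0 = p"
proof -
  \<comment> \<open>Dominates \<open>1\<close>, \<open>1 + \<bar>m t\<bar>\<close> and
    \<open>L * (1 + \<bar>m t\<bar>)\<close>, so that one weight serves velocity and
    position.\<close>
  define \<kappa> where "\<kappa> t = (1 + L) * (1 + \<bar>m t\<bar>)" for t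
  have \<kappa>1: "1 \<le> \<kappa> t" for t
    unfolding \<kappa>_def using L_nonneg mult_mono[of 1 "1 + L" 1 "1 + \<bar>m t\<bar>"] by simp
  have \<kappa>m: "1 + \<bar>m t\<bar> \<le> \<kappa> t" and \<kappa>L: "L * (1 + \<bar>m t\<bar>) \<le> \<kappa> t" for t
    unfolding \<kappa>_def using L_nonneg by (auto simp: algebra_simps)
  have "loc_integrable \<kappa>"
    unfolding \<kappa>_def by (intro loc_integrable_mult_continuous loc_integrable_add loc_integrable_abs m) auto
  then obtain K where K: "primitive_of K \<kappa>" and K0: "K t0 = 0"
    using primitive_of_exists by blast
  have cK: "continuous_on UNIV K" by (rule primitive_of_continuous[OF K])
  define e where "e t = exp (2 * \<bar>K t\<bar>)" for t
  have e1: "1 \<le> e t" and epos: "0 < e t" for t by (auto simp: e_def)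
  have ce: "continuous_on UNIV e"
    unfolding e_def by (intro continuous_intros cK)
  \<comment> \<open>Up to sign, \<open>\<kappa> * e\<close> is half the derivative of
    \<open>e\<close>; integrating from \<open>t0\<close> therefore keeps the weight and gains the
    factor 1/2.\<close>
  have weight: "\<bar>X t\<bar> \<le> C / 2 * e t"
    if X: "primitive_of X \<psi>" and X0: "X t0 = 0" and \<psi>: "\<And>t. \<bar>\<psi> t\<bar> \<le> C * (\<kappa> t * e t)" and C: "0 \<le> C"
    for X \<psi> C t
  proof (cases "t0 \<le> t")
    case True
    have P: "primitive_of (\<lambda>t. exp (2 * K t)) (\<lambda>t. 2 * exp (2 * K t) * \<kappa> t)"
      by (rule primitive_of_compose[OF K, where h="\<lambda>r. exp (2 * r)" and h'="\<lambda>r. 2 * exp (2 * r)"])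
        (auto intro!: derivative_eq_intros continuous_intros)
    have Kpos: "0 \<le> K r" if "t0 \<le> r" for r
      using primitive_of_nonneg_mono[OF K _ that] \<kappa>1 K0 by (metis dual_order.trans zero_le_one)
    have "\<bar>X t - X t0\<bar> \<le> C / 2 * exp (2 * K t) - C / 2 * exp (2 * K t0)"
    proof (rule primitive_of_abs_le[OF X primitive_of_cmult[OF P] True])
      fix r assume "t0 \<le> r" "r \<le> t"
      then show "\<bar>\<psi> r\<bar> \<le> C / 2 * (2 * exp (2 * K r) * \<kappa> r)"
        using \<psi>[of r] Kpos[of r] by (simp add: e_def mult_ac)
    qed
    then show ?thesis using X0 K0 Kpos[OF True] C by (simp add: e_def)
  next
    case False
    then have le: "t \<le> t0" by simp
    have P: "primitive_of (\<lambda>t. - exp (- 2 * K t)) (\<lambda>t. 2 * exp (- 2 * K t) * \<kappa> t)"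
      by (rule primitive_of_compose[OF K, where h="\<lambda>r. - exp (- 2 * r)" and h'="\<lambda>r. 2 * exp (- 2 * r)"])
        (auto intro!: derivative_eq_intros continuous_intros)
    have Kneg: "K r \<le> 0" if "r \<le> t0" for r
      using primitive_of_nonneg_mono[OF K _ that] \<kappa>1 K0 by (metis dual_order.trans zero_le_one)
    have "\<bar>X t0 - X t\<bar> \<le> C / 2 * (- exp (- 2 * K t0)) - C / 2 * (- exp (- 2 * K t))"
    proof (rule primitive_of_abs_le[OF X primitive_of_cmult[OF P] le])
      fix r assume "t \<le> r" "r \<le> t0"
      then show "\<bar>\<psi> r\<bar> \<le> C / 2 * (2 * exp (- 2 * K r) * \<kappa> r)"
        using \<psi>[of r] Kneg[of r] by (simp add: e_def mult_ac)
    qed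
    then show ?thesis using X0 K0 Kneg[OF le] C by (simp add: e_def)
  qed
  \<comment> \<open>The variable \<open>y\<close> is the deviation from uniform motion divided by
    the weight; the fixed point equation is \<open>y = V y / e\<close>.\<close>
  define vy where "vy y t = x0 + p * (t - t0) + e t * apply_bcontfun y t" for y :: "real \<Rightarrow>\<^sub>C real" and t
  define \<psi> where "\<psi> y t = f0 (vy y t) + m t * f1 (vy y t)" for y t
  have "continuous_on UNIV (vy y)" for y
    unfolding vy_def by (intro continuous_intros ce continuous_on_apply_bcontfun)
  then have \<psi>loc: "loc_integrable (\<psi> y)" for y
    unfolding \<psi>_def by (intro loc_integrable_rhs m)
  obtain X where X: "\<And>y. primitive_of (X y) (\<psi> y)" and X0: "\<And>y. X y t0 = 0"
    using choice[of "\<lambda>y x. primitive_of x (\<psi> y) \<and> x t0 = 0"] primitive_of_exists[OF \<psi>loc] by blast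
  have cX: "continuous_on UNIV (X y)" for y by (rule primitive_of_continuous[OF X])
  obtain V where V: "\<And>y. primitive_of (V y) (X y)" and V0: "\<And>y. V y t0 = 0"
    using choice[of "\<lambda>y x. primitive_of x (X y) \<and> x t0 = 0"]
      primitive_of_exists[OF loc_integrable_continuous[OF cX]] by blast
  have cV: "continuous_on UNIV (V y)" for y by (rule primitive_of_continuous[OF V])
  have ke: "C * e t \<le> C * (\<kappa> t * e t)" if "0 \<le> C" for C t
    using that \<kappa>1[of t] epos[of t] by (intro mult_left_mono) auto
  have Vbound: "\<bar>V y t\<bar> \<le> B / 4 * e t" for y t
  proof -
    have "\<bar>\<psi> y t\<bar> \<le> B * (\<kappa> t * e t)" for t
    proof -
      have "\<bar>\<psi> y t\<bar> \<le> B * (1 + \<bar>m t\<bar>)" unfolding \<psi>_def by (rule rhs_bound)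
      also have "\<dots> \<le> B * (\<kappa> t * e t)"
        using \<kappa>m[of t] e1[of t] \<kappa>1[of t] B_nonneg mult_mono[of "1 + \<bar>m t\<bar>" "\<kappa> t" 1 "e t"]
        by (intro mult_left_mono) auto
      finally show ?thesis .
    qed
    then have "\<bar>X y t\<bar> \<le> B / 2 * e t" for t
      by (rule weight[OF X X0 _ B_nonneg])
    then have "\<bar>X y t\<bar> \<le> B / 2 * (\<kappa> t * e t)" for t
      using ke[of "B/2" t] B_nonneg by (meson divide_nonneg_pos order_trans zero_less_numeral)
    then have "\<bar>V y t\<bar> \<le> B / 2 / 2 * e t"
      by (rule weight[OF V V0]) (use B_nonneg in auto)
    then show ?thesis by simp
  qed
  have Vlip: "\<bar>V y t - V y' t\<bar> \<le> dist y y' / 4 * e t" for y y' t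
  proof -
    have "\<bar>\<psi> y t - \<psi> y' t\<bar> \<le> dist y y' * (\<kappa> t * e t)" for t
    proof -
      have d: "\<bar>apply_bcontfun y t - apply_bcontfun y' t\<bar> \<le> dist y y'"
        using dist_bounded[of y t y'] by (simp add: dist_real_def)
      have "\<bar>\<psi> y t - \<psi> y' t\<bar> \<le> L * (1 + \<bar>m t\<bar>) * \<bar>vy y t - vy y' t\<bar>"
        unfolding \<psi>_def using rhs_lip[of "vy y t" "m t" "vy y' t" "m t"] by simp
      also have "\<bar>vy y t - vy y' t\<bar> = e t * \<bar>apply_bcontfun y t - apply_bcontfun y' t\<bar>"
        unfolding vy_def using epos[of t] by (simp add: abs_mult right_diff_distrib[symmetric])
      also have "L * (1 + \<bar>m t\<bar>) * (e t * \<bar>apply_bcontfun y t - apply_bcontfun y' t\<bar>) \<le> \<kappa> t * (e t * dist y y')"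
        using d \<kappa>L[of t] epos[of t] \<kappa>1[of t] by (intro mult_mono mult_nonneg_nonneg) auto
      finally show ?thesis by (simp add: mult_ac)
    qed
    then have "\<bar>X y t - X y' t\<bar> \<le> dist y y' / 2 * e t" for t
      using weight[OF primitive_of_diff[OF X[of y] X[of y']], of "dist y y'"] X0 by simp
    then have "\<bar>X y t - X y' t\<bar> \<le> dist y y' / 2 * (\<kappa> t * e t)" for t
      using ke[of "dist y y' / 2" t] by (meson order_trans zero_le_dist divide_nonneg_pos zero_less_numeral)
    then show ?thesis
      using weight[OF primitive_of_diff[OF V[of y] V[of y']], of "dist y y' / 2"] V0 by simp
  qed
  have bc: "(\<lambda>t. V y t / e t) \<in> bcontfun" for y
  proof (rule bcontfun_normI[where b="B/4"])
    show "continuous_on UNIV (\<lambda>t. V y t / e t)"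
      using epos by (intro continuous_intros cV ce) (metis less_irrefl)
    show "norm (V y t / e t) \<le> B / 4" for t
      using Vbound[of y t] epos[of t] by (simp add: abs_divide pos_divide_le_eq)
  qed
  define T where "T y = Bcontfun (\<lambda>t. V y t / e t)" for y
  have T: "apply_bcontfun (T y) t = V y t / e t" for y t
    unfolding T_def using bc by (simp add: Bcontfun_inverse)
  \<comment> \<open>Two integrations, from force to velocity and from velocity to position, give 1/2
    times 1/2.\<close>
  have "\<forall>y y'. dist (T y) (T y') \<le> 1/4 * dist y y'"
  proof (intro allI dist_bound)
    fix y y' t
    have "dist (V y t / e t) (V y' t / e t) = \<bar>V y t - V y' t\<bar> / e t"
      using epos[of t] by (simp add: dist_real_def diff_divide_distrib[symmetric] abs_divide)
    also have "\<dots> \<le> dist y y' / 4"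
      using Vlip[of y t y'] epos[of t] by (simp add: pos_divide_le_eq)
    finally show "dist (apply_bcontfun (T y) t) (apply_bcontfun (T y') t) \<le> 1/4 * dist y y'"
      by (simp add: T)
  qed
  then obtain y where y: "T y = y"
    using banach_fix_type[of "1/4" T] by auto
  have "e t * apply_bcontfun y t = V y t" for t
    using T[of y t] y epos[of t] by (simp add: field_simps)
  then have vy: "vy y t = x0 + p * (t - t0) + V y t" for t by (simp add: vy_def)
  define w where "w t = X y t + p" for t
  have "primitive_of (\<lambda>t. p * t + V y t + (x0 - p * t0)) (\<lambda>t. p * 1 + X y t)"
    by (intro primitive_of_add_const primitive_of_add primitive_of_cmult primitive_of_ident V)
  moreover have "vy y = (\<lambda>t. p * t + V y t + (x0 - p * t0))" "w = (\<lambda>t. p * 1 + X y t)"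
    by (auto simp: vy w_def algebra_simps)
  ultimately have "primitive_of (vy y) w" by simp
  moreover have "primitive_of w (\<lambda>t. f0 (vy y t) + m t * f1 (vy y t))"
    using primitive_of_add_const[OF X[of y]] unfolding w_def \<psi>_def .
  ultimately have "solution f0 f1 m (vy y) w" by (simp add: solution_def)
  moreover have "vy y t0 = x0" "w t0 = p" by (auto simp: vy V0 w_def X0)
  ultimately show ?thesis by blast
qed

text \<open>Gronwall for \<open>\<bar>v - v'\<bar> + \<bar>w - w'\<bar>\<close>. The difference of
  the coefficients enters only through its L^1 size \<open>D\<close>, and the growth rate only
  through \<open>m\<close>, so the better controlled equation is to be listed first.\<close>

lemma solution_compare:
  assumes s: "solution f0 f1 m v w" and s': "solution f0 f1 m' v' w'"
    and K: "primitive_of K (\<lambda>t. (1 + L) * (1 + \<bar>m t\<bar>))"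
    and D: "primitive_of D (\<lambda>t. \<bar>m t - m' t\<bar>)"
  shows "\<bar>v t - v' t\<bar> + \<bar>w t - w' t\<bar>
      \<le> (\<bar>v t0 - v' t0\<bar> + \<bar>w t0 - w' t0\<bar> + B * \<bar>D t - D t0\<bar>) * exp \<bar>K t - K t0\<bar>"
proof -
  define \<kappa> where "\<kappa> t = (1 + L) * (1 + \<bar>m t\<bar>)" for t
  define z where "z t = \<bar>v t - v' t\<bar> + \<bar>w t - w' t\<bar>" for t
  have \<kappa>0: "0 \<le> \<kappa> t" and z0: "0 \<le> z t" for t using L_nonneg by (auto simp: \<kappa>_def z_def)
  have dv: "primitive_of (\<lambda>t. v t - v' t) (\<lambda>t. w t - w' t)"
    and dw: "primitive_of (\<lambda>t. w t - w' t) (\<lambda>t. (f0 (v t) + m t * f1 (v t)) - (f0 (v' t) + m' t * f1 (v' t)))"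
    using s s' unfolding solution_def by (auto intro: primitive_of_diff)
  have cz: "continuous_on UNIV z"
    unfolding z_def by (intro continuous_intros primitive_of_continuous[OF dv] primitive_of_continuous[OF dw])
  have K: "primitive_of K \<kappa>" using K by (simp add: \<kappa>_def[abs_def])
  obtain W where W: "primitive_of W (\<lambda>t. \<kappa> t * z t)"
    using primitive_of_exists loc_integrable_mult_continuous'[OF primitive_of_loc[OF K] cz] by blast
  obtain W1 where W1: "primitive_of W1 (\<lambda>t. \<bar>w t - w' t\<bar>)"
    using primitive_of_exists loc_integrable_continuous
      continuous_on_rabs[OF primitive_of_continuous[OF dw]] by blast
  have "loc_integrable (\<lambda>t. L * (1 + \<bar>m t\<bar>) * \<bar>v t - v' t\<bar>)"
  proof (rule loc_integrable_mult_continuous')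
    have "loc_integrable (\<lambda>t. L / (1 + L) * \<kappa> t)"
      by (intro loc_integrable_mult_continuous primitive_of_loc[OF K]) auto
    moreover have "L / (1 + L) * \<kappa> t = L * (1 + \<bar>m t\<bar>)" for t
      using L_nonneg by (simp add: \<kappa>_def)
    ultimately show "loc_integrable (\<lambda>t. L * (1 + \<bar>m t\<bar>))" by simp
    show "continuous_on UNIV (\<lambda>x. \<bar>v x - v' x\<bar>)"
      by (intro continuous_intros primitive_of_continuous[OF dv])
  qed
  then obtain W2 where W2: "primitive_of W2 (\<lambda>t. L * (1 + \<bar>m t\<bar>) * \<bar>v t - v' t\<bar>)"
    using primitive_of_exists by blast
  have main: "\<bar>z r - z s\<bar> \<le> W r - W s + B * (D r - D s)" if "s \<le> r" for s r
  proof -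
    have 1: "\<bar>(v r - v' r) - (v s - v' s)\<bar> \<le> W1 r - W1 s"
      by (rule primitive_of_abs_le[OF dv W1 that]) simp
    have 2: "\<bar>(w r - w' r) - (w s - w' s)\<bar> \<le> (W2 r + B * D r) - (W2 s + B * D s)"
      by (rule primitive_of_abs_le[OF dw primitive_of_add[OF W2 primitive_of_cmult[OF D]] that])
        (rule rhs_lip)
    have 3: "(W1 r + W2 r) - (W1 s + W2 s) \<le> W r - W s"
    proof (rule primitive_of_mono[OF primitive_of_add[OF W1 W2] W that])
      fix t
      have "1 \<le> \<kappa> t" "L * (1 + \<bar>m t\<bar>) \<le> \<kappa> t"
        unfolding \<kappa>_def using L_nonneg mult_mono[of 1 "1 + L" 1 "1 + \<bar>m t\<bar>"] by (auto simp: algebra_simps)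
      then have "1 * \<bar>w t - w' t\<bar> + L * (1 + \<bar>m t\<bar>) * \<bar>v t - v' t\<bar> \<le> \<kappa> t * \<bar>w t - w' t\<bar> + \<kappa> t * \<bar>v t - v' t\<bar>"
        by (intro add_mono mult_right_mono) auto
      then show "\<bar>w t - w' t\<bar> + L * (1 + \<bar>m t\<bar>) * \<bar>v t - v' t\<bar> \<le> \<kappa> t * z t"
        by (simp add: z_def algebra_simps)
    qed
    have "B * (D r - D s) = B * D r - B * D s" by (rule right_diff_distrib)
    then show ?thesis using 1 2 3 unfolding z_def by linarith
  qed
  have Dmono: "D s \<le> D r" if "s \<le> r" for s r
    by (rule primitive_of_nonneg_mono[OF D _ that]) simp
  have Wmono: "W s \<le> W r" if "s \<le> r" for s r
    by (rule primitive_of_nonneg_mono[OF W _ that]) (use \<kappa>0 z0 in simp)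
  have "z t \<le> (z t0 + B * \<bar>D t - D t0\<bar>) * exp \<bar>K t - K t0\<bar>"
  proof (rule gronwall[OF W K \<kappa>0 z0])
    fix r assume r: "min t0 t \<le> r" "r \<le> max t0 t"
    \<comment> \<open>\<open>D\<close> is monotone, so the forcing up to \<open>r\<close> is
      replaced by that up to \<open>t\<close>, the constant which Gronwall asks for.\<close>
    have "\<bar>D r - D t0\<bar> \<le> \<bar>D t - D t0\<bar>"
    proof (cases "t0 \<le> t")
      case True
      then show ?thesis using Dmono[of t0 r] Dmono[of r t] r by auto
    next
      case False
      then show ?thesis using Dmono[of t r] Dmono[of r t0] r by auto
    qed
    then have B: "B * \<bar>D r - D t0\<bar> \<le> B * \<bar>D t - D t0\<bar>" using B_nonneg by (rule mult_left_mono)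
    have "z r \<le> z t0 + (\<bar>W r - W t0\<bar> + B * \<bar>D r - D t0\<bar>)"
    proof (cases "t0 \<le> r")
      case True
      then show ?thesis using main[OF True] Wmono[OF True] Dmono[OF True] by (simp add: abs_of_nonneg)
    next
      case False
      then have le: "r \<le> t0" by simp
      show ?thesis using main[OF le] Wmono[OF le] Dmono[OF le]
        by (simp add: abs_of_nonpos abs_minus_commute[of "W r"] abs_minus_commute[of "D r"])
    qed
    with B show "z r \<le> z t0 + B * \<bar>D t - D t0\<bar> + \<bar>W r - W t0\<bar>" by linarith
  qed
  then show ?thesis by (simp add: z_def)
qed

lemma solution_loc_kappa:
  "loc_integrable m \<Longrightarrow> loc_integrable (\<lambda>t. (1 + L) * (1 + \<bar>m t\<bar>))"
  by (intro loc_integrable_mult_continuous loc_integrable_add loc_integrable_abs) auto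

lemma solution_unique:
  assumes m: "loc_integrable m"
    and s: "solution f0 f1 m v w" and s': "solution f0 f1 m v' w'"
    and "v t0 = v' t0" "w t0 = w' t0"
  shows "v t = v' t \<and> w t = w' t"
proof -
  obtain K where "primitive_of K (\<lambda>t. (1 + L) * (1 + \<bar>m t\<bar>))"
    using primitive_of_exists[OF solution_loc_kappa[OF m]] by blast
  moreover have "primitive_of (\<lambda>t. 0) (\<lambda>t. \<bar>m t - m t\<bar>)"
    using primitive_of_cmult[OF primitive_of_ident, of 0] by simp
  ultimately have "\<bar>v t - v' t\<bar> + \<bar>w t - w' t\<bar> \<le> 0"
    using solution_compare[OF s s', of K "\<lambda>t. 0" t t0] assms(4,5) by simp
  then show ?thesis by linarith
qed

end

lemma solution_shift:
  "solution f0 f1 m v w \<Longrightarrow> solution f0 f1 (\<lambda>t. m (t + d)) (\<lambda>t. v (t + d)) (\<lambda>t. w (t + d))"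
  unfolding solution_def using primitive_of_shift[of v w d]
    primitive_of_shift[of w "\<lambda>t. f0 (v t) + m t * f1 (v t)" d] by simp

section \<open>The period of the autonomous equation\<close>

definition trajectory :: "(real \<Rightarrow> real) \<Rightarrow> (real \<Rightarrow> real) \<Rightarrow> (real \<Rightarrow> real) \<Rightarrow> bool" where
  "trajectory f x y \<longleftrightarrow> (\<forall>t. (x has_real_derivative y t) (at t) \<and> (y has_real_derivative f (x t)) (at t))"

lemma trajectoryD:
  assumes "trajectory f x y"
  shows "(x has_real_derivative y t) (at t)" "(y has_real_derivative f (x t)) (at t)"
  using assms by (auto simp: trajectory_def)

lemma trajectory_continuous:
  assumes "trajectory f x y"
  shows "continuous_on S x" "continuous_on S y"
  using trajectoryD[OF assms] by (meson DERIV_isCont continuous_at_imp_continuous_on)+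

text \<open>Reversibility of \<open>x'' = f x\<close>. With \<open>d\<close> twice an instant of
  zero velocity it makes orbits symmetric about their turning instants.\<close>

lemma trajectory_reflect_time:
  assumes "trajectory f x y"
  shows "trajectory f (\<lambda>t. x (d - t)) (\<lambda>t. - y (d - t))"
  unfolding trajectory_def
proof (intro allI conjI)
  fix t
  have d: "((\<lambda>t. d - t) has_real_derivative -1) (at t)" by (auto intro!: derivative_eq_intros)
  show "((\<lambda>t. x (d - t)) has_real_derivative - y (d - t)) (at t)"
    using DERIV_chain2[OF trajectoryD(1)[OF assms] d] by simp
  show "((\<lambda>t. - y (d - t)) has_real_derivative f (x (d - t))) (at t)"
    using DERIV_minus[OF DERIV_chain2[OF trajectoryD(2)[OF assms] d]] by simp
qed

text \<open>Reflecting space and time together keeps the sign of the velocity. With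
  \<open>c = 2 * a\<close> this exchanges the two sides of the section, so that the left half of a
  well can be treated as a right half.\<close>

lemma trajectory_reflect:
  assumes "trajectory f x y"
  shows "trajectory (\<lambda>s. - f (c - s)) (\<lambda>t. c - x (- t)) (\<lambda>t. y (- t))"
  unfolding trajectory_def
proof (intro allI conjI)
  fix t
  have d: "((\<lambda>t. - t) has_real_derivative -1) (at t)" by (auto intro!: derivative_eq_intros)
  show "((\<lambda>t. c - x (- t)) has_real_derivative y (- t)) (at t)"
    using DERIV_diff[OF DERIV_const DERIV_chain2[OF trajectoryD(1)[OF assms] d], of c] by simp
  show "((\<lambda>t. y (- t)) has_real_derivative - f (c - (c - x (- t)))) (at t)"
    using DERIV_chain2[OF trajectoryD(2)[OF assms] d] by simp
qed

lemma first_zero: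
  fixes y :: "real \<Rightarrow> real"
  assumes "continuous_on {0..t} y" "0 < y 0" "0 \<le> t" "y t \<le> 0"
  shows "\<exists>s. 0 < s \<and> s \<le> t \<and> y s = 0 \<and> (\<forall>r. 0 \<le> r \<and> r < s \<longrightarrow> 0 < y r)"
proof -
  define S where "S = {0..t} \<inter> y -` {..0}"
  have "closed S"
    unfolding S_def by (rule continuous_closed_preimage[OF assms(1)]) auto
  moreover have "bounded S"
    by (rule bounded_subset[of "{0..t}"]) (auto simp: S_def)
  ultimately have cS: "compact S" by (simp add: compact_eq_bounded_closed)
  have "t \<in> S" using assms(3,4) by (simp add: S_def)
  then have "S \<noteq> {}" by blast
  then obtain s where s: "s \<in> S" "\<And>r. r \<in> S \<Longrightarrow> s \<le> r"
    using compact_attains_inf[OF cS] by auto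
  have s1: "0 \<le> s" "s \<le> t" "y s \<le> 0" using s(1) by (auto simp: S_def)
  have pos: "0 < y r" if "0 \<le> r" "r < s" for r
    using s(2)[of r] that s1 by (force simp: S_def)
  have "continuous_on {0..s} y" by (rule continuous_on_subset[OF assms(1)]) (use s1 in auto)
  then obtain r where r: "0 \<le> r" "r \<le> s" "y r = 0"
    using IVT2'[of y s 0 0] s1 assms(2) by auto
  then have "r = s" using pos[of r] by force
  then have "y s = 0" using r by simp
  moreover have "0 < s" using s1 assms(2) \<open>y s = 0\<close> by (cases "s = 0") auto
  ultimately show ?thesis using s1 pos by blast
qed

section \<open>Orbits of an autonomous force\<close>

locale autonomous =
  fixes f :: "real \<Rightarrow> real" and B L :: real
  assumes f_bound: "\<bar>f x\<bar> \<le> B" and f_lip: "\<bar>f x - f y\<bar> \<le> L * \<bar>x - y\<bar>" and L_nonneg: "0 \<le> L"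
begin

sublocale bounded_lipschitz f "\<lambda>_. 0" B L
  by unfold_locales (use f_bound f_lip L_nonneg order_trans[OF abs_ge_zero f_bound] in auto)

lemma trajectory_iff_solution: "trajectory f x y \<longleftrightarrow> solution f (\<lambda>_. 0) (\<lambda>_. 0) x y"
proof
  assume t: "trajectory f x y"
  have "continuous_on UNIV (\<lambda>t. f (x t))"
    by (rule continuous_on_compose2[OF f_continuous(1) trajectory_continuous(1)[OF t]]) auto
  then show "solution f (\<lambda>_. 0) (\<lambda>_. 0) x y"
    unfolding solution_def using trajectoryD[OF t] trajectory_continuous[OF t]
    by (auto intro: primitive_of_derivative)
next
  assume s: "solution f (\<lambda>_. 0) (\<lambda>_. 0) x y"
  then have x: "primitive_of x y" and y: "primitive_of y (\<lambda>t. f (x t))"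
    by (auto simp: solution_def)
  have "continuous_on UNIV (\<lambda>t. f (x t))"
    by (rule continuous_on_compose2[OF f_continuous(1) primitive_of_continuous[OF x]]) auto
  then show "trajectory f x y"
    unfolding trajectory_def
    using primitive_of_has_derivative[OF x primitive_of_continuous[OF y]] primitive_of_has_derivative[OF y] by blast
qed

lemma trajectory_exists: "\<exists>x y. trajectory f x y \<and> x 0 = x0 \<and> y 0 = p"
  unfolding trajectory_iff_solution by (rule solution_exists) simp

lemma trajectory_unique:
  assumes "trajectory f x y" "trajectory f x' y'" "x t0 = x' t0" "y t0 = y' t0"
  shows "x t = x' t" "y t = y' t"
  using solution_unique[of "\<lambda>_. 0" x y x' y' t0 t] assms by (auto simp: trajectory_iff_solution)

lemma trajectory_compare:
  assumes "trajectory f x y" "trajectory f x' y'"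
  shows "\<bar>x t - x' t\<bar> + \<bar>y t - y' t\<bar> \<le> (\<bar>x 0 - x' 0\<bar> + \<bar>y 0 - y' 0\<bar>) * exp ((1 + L) * \<bar>t\<bar>)"
proof -
  have K: "primitive_of (\<lambda>t. (1 + L) * t) (\<lambda>t. (1 + L) * (1 + \<bar>0\<bar>))"
    using primitive_of_cmult[OF primitive_of_ident, of "1 + L"] by simp
  have D: "primitive_of (\<lambda>t. 0) (\<lambda>t. \<bar>0 - 0\<bar>)"
    using primitive_of_cmult[OF primitive_of_ident, of 0] by simp
  show ?thesis
    using solution_compare[OF assms[unfolded trajectory_iff_solution] K D, of t 0] L_nonneg
    by (simp add: abs_mult)
qed

end

text \<open>The well to the right of the section point \<open>a\<close>, with potential
  \<open>U\<close> and its rim at the equilibrium \<open>b\<close>. Beyond \<open>vm\<close> the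
  potential increases, before it stays nonpositive. One locale thus serves both halves:
  \<open>vm\<close> is the centre on the right, and \<open>vm = a\<close> for the reflected left
  half.\<close>

locale half_well = autonomous +
  fixes U :: "real \<Rightarrow> real" and a vm b :: real
  assumes U_deriv: "(U has_real_derivative - f s) (at s)"
    and U_a: "U a = 0" and vm: "a \<le> vm" "vm < b"
    and U_nonpos: "a \<le> s \<Longrightarrow> s \<le> vm \<Longrightarrow> U s \<le> 0"
    and f_neg: "vm < s \<Longrightarrow> s < b \<Longrightarrow> f s < 0"
    and f_b: "f b = 0" and U_b: "0 < U b"
begin

lemma U_continuous: "continuous_on S U"
  using U_deriv by (meson DERIV_isCont continuous_at_imp_continuous_on)

lemma U_strict_mono: "vm \<le> s \<Longrightarrow> s < t \<Longrightarrow> t \<le> b \<Longrightarrow> U s < U t"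
  using U_deriv f_neg by (intro DERIV_pos_imp_increasing_open[of s t U] U_continuous) force+

lemma U_below:
  assumes "0 < U r" "vm < r" "r \<le> b" "a \<le> s" "s < r" shows "U s < U r"
  using assms U_nonpos[of s] U_strict_mono[of s r] by (cases "s \<le> vm") auto

lemma energy:
  assumes "trajectory f x y" "x 0 = a" "y 0 = p"
  shows "(y t)\<^sup>2 / 2 + U (x t) = p\<^sup>2 / 2"
proof -
  have "((\<lambda>t. (y t)\<^sup>2 / 2 + U (x t)) has_real_derivative 0) (at t)" for t
    using trajectoryD[OF assms(1), of t] DERIV_chain2[OF U_deriv trajectoryD(1)[OF assms(1), of t]]
    by (auto intro!: derivative_eq_intros)
  then have "(y t)\<^sup>2 / 2 + U (x t) = (y 0)\<^sup>2 / 2 + U (x 0)"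
    by (intro DERIV_isconst_all) auto
  then show ?thesis using assms U_a by simp
qed

text \<open>\<open>x\<close> increases while \<open>y > 0\<close>, and at \<open>x = r\<close> the
  conserved energy would leave \<open>y = 0\<close>.\<close>

lemma stays_below:
  assumes tr: "trajectory f x y" "x 0 = a" "y 0 = p"
    and r: "a < r" "U r = p\<^sup>2 / 2" and y: "\<And>s. 0 \<le> s \<Longrightarrow> s < t \<Longrightarrow> 0 < y s"
    and t: "0 \<le> t"
  shows "a \<le> x t \<and> x t \<le> r"
proof
  have "x 0 \<le> x t"
  proof (rule DERIV_nonneg_imp_increasing_open[OF t])
    fix s assume "0 < s" "s < t"
    then show "\<exists>l. (x has_real_derivative l) (at s) \<and> 0 \<le> l"
      using trajectoryD(1)[OF tr(1), of s] y[of s] by (intro exI[of _ "y s"]) auto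
  qed (rule trajectory_continuous[OF tr(1)])
  then show "a \<le> x t" using tr by simp
  show "x t \<le> r"
  proof (rule ccontr)
    assume "\<not> x t \<le> r"
    then obtain s where s: "0 \<le> s" "s \<le> t" "x s = r"
      using IVT'[of x 0 r t] t tr r trajectory_continuous(1)[OF tr(1)] by force
    then have "s < t" using \<open>\<not> x t \<le> r\<close> by (cases "s = t") auto
    then show False using energy[OF tr, of s] y[of s] s r by simp
  qed
qed

lemma turning_point_exists:
  assumes "0 < p" "p\<^sup>2 / 2 < U b"
  obtains r where "vm < r" "r < b" "U r = p\<^sup>2 / 2"
proof -
  have p2: "0 < p\<^sup>2 / 2" using assms by simp
  have "U vm \<le> p\<^sup>2 / 2" using U_nonpos[of vm] vm p2 by argo
  then obtain r where r: "vm \<le> r" "r \<le> b" "U r = p\<^sup>2 / 2"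
    using IVT'[of U vm "p\<^sup>2/2" b] vm assms(2) U_continuous by auto
  have "r \<noteq> vm" using U_nonpos[of vm] vm p2 r(3) by force
  moreover have "r \<noteq> b" using assms(2) r(3) by force
  ultimately have "vm < r" "r < b" using r by auto
  then show ?thesis using r that by blast
qed

text \<open>The turning point \<open>r\<close> is no equilibrium, as \<open>f r < 0\<close>. If the
  velocity stayed positive, the orbit would come near \<open>r\<close> in finite time and then be
  braked at a rate bounded away from 0, so its velocity would vanish after all.\<close>

lemma turning:
  assumes tr: "trajectory f x y" "x 0 = a" "y 0 = p" and p: "0 < p" "p\<^sup>2 / 2 < U b"
  shows "\<exists>t>0. y t = 0 \<and> (\<forall>s. 0 \<le> s \<and> s < t \<longrightarrow> 0 < y s) \<and> vm < x t \<and> x t < b \<and> U (x t) = p\<^sup>2 / 2"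
proof -
  have p2: "0 < p\<^sup>2 / 2" using p by simp
  obtain r where r: "vm < r" "r < b" "U r = p\<^sup>2 / 2" using turning_point_exists[OF p] .
  have ar: "a < r" using r vm by simp
  have below: "U s < p\<^sup>2 / 2" if "a \<le> s" "s < r" for s
    using U_below[of r s] r p2 that by auto
  have "\<exists>t\<ge>0. y t \<le> 0"
  proof (rule ccontr)
    assume "\<not> (\<exists>t\<ge>0. y t \<le> 0)"
    then have ypos: "0 < y t" if "0 \<le> t" for t using that by force
    have xr: "a \<le> x t" "x t \<le> r" if "0 \<le> t" for t
      using stays_below[OF tr ar r(3) _ that] ypos by auto
    have mono: "x s \<le> x t" if "0 \<le> s" "s \<le> t" for s t
      by (rule DERIV_nonneg_imp_nondecreasing[OF that(2)])
        (use trajectoryD(1)[OF tr(1)] ypos that in \<open>meson less_imp_le order_trans\<close>)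
    have fr: "f r < 0" using f_neg r by simp
    have "isCont f r" using f_continuous(1) by (simp add: continuous_on_eq_continuous_at)
    then obtain d where d: "d > 0" "\<And>s. \<bar>s - r\<bar> < d \<Longrightarrow> \<bar>f s - f r\<bar> < - f r / 2"
      using fr unfolding continuous_at_eps_delta dist_real_def
      by (metis half_gt_zero neg_0_less_iff_less minus_divide_left)
    define r' where "r' = max a (r - d / 2)"
    have r': "a \<le> r'" "r' < r" "r - d < r'" using d ar by (auto simp: r'_def max_def)
    have slow: "f s \<le> f r / 2" if "r' \<le> s" "s \<le> r" for s
    proof -
      have "\<bar>s - r\<bar> < d" using r' that by simp
      then show ?thesis using d(2)[of s] by linarith
    qed
    obtain s0 where s0: "s0 \<in> {a..r'}" "\<And>s. s \<in> {a..r'} \<Longrightarrow> U s \<le> U s0"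
      using continuous_attains_sup[of "{a..r'}" U] r'(1) U_continuous by force
    \<comment> \<open>By conservation of energy, a lower bound for the speed to the left of
      \<open>r'\<close>.\<close>
    define q where "q = sqrt (2 * (p\<^sup>2 / 2 - U s0))"
    have "U s0 < p\<^sup>2 / 2" using below[of s0] s0(1) r' by auto
    then have q: "q > 0" by (simp add: q_def)
    have fast: "q \<le> y t" if "0 \<le> t" "x t \<le> r'" for t
    proof -
      have "U (x t) \<le> U s0" using s0(2)[of "x t"] xr that by auto
      then have "2 * (p\<^sup>2 / 2 - U s0) \<le> (y t)\<^sup>2" using energy[OF tr, of t] by argo
      then have "q \<le> sqrt ((y t)\<^sup>2)" unfolding q_def by (rule real_sqrt_le_mono)
      then show ?thesis using ypos[OF that(1)] by simp
    qed
    \<comment> \<open>Time enough to cover the distance from \<open>a\<close> to \<open>r'\<close>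
      at speed \<open>q\<close>.\<close>
    define t1 where "t1 = (r' - a) / q"
    have t1: "0 \<le> t1" using r' q by (simp add: t1_def)
    have reach: "r' \<le> x t1"
    proof (rule ccontr)
      assume n: "\<not> r' \<le> x t1"
      have "x 0 - q * 0 \<le> x t1 - q * t1"
      proof (rule DERIV_nonneg_imp_nondecreasing[OF t1])
        fix s assume s: "0 \<le> s" "s \<le> t1"
        have "((\<lambda>t. x t - q * t) has_real_derivative y s - q) (at s)"
          using trajectoryD(1)[OF tr(1), of s] by (auto intro!: derivative_eq_intros)
        moreover have "q \<le> y s" using fast[of s] mono[of s t1] s n by auto
        ultimately show "\<exists>l. ((\<lambda>t. x t - q * t) has_real_derivative l) (at s) \<and> 0 \<le> l" by fastforce
      qed
      then show False using n tr q by (simp add: t1_def)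
    qed
    define k where "k = - f r / 2"
    have k: "k > 0" using fr by (simp add: k_def)
    \<comment> \<open>Braking at rate at least \<open>k\<close> uses up the velocity
      \<open>y t1\<close> by this time.\<close>
    define t2 where "t2 = t1 + y t1 / k"
    have t12: "t1 \<le> t2" using ypos[OF t1] k by (simp add: t2_def)
    have "y t2 + k * t2 \<le> y t1 + k * t1"
    proof (rule DERIV_nonpos_imp_nonincreasing[OF t12])
      fix s assume s: "t1 \<le> s" "s \<le> t2"
      have "((\<lambda>t. y t + k * t) has_real_derivative f (x s) + k) (at s)"
        using trajectoryD(2)[OF tr(1), of s] by (auto intro!: derivative_eq_intros)
      moreover have "f (x s) + k \<le> 0"
        using slow[of "x s"] mono[OF t1 s(1)] reach xr[of s] t1 s by (simp add: k_def)
      ultimately show "\<exists>l. ((\<lambda>t. y t + k * t) has_real_derivative l) (at s) \<and> l \<le> 0" by blast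
    qed
    then have "y t2 \<le> 0" using k by (simp add: t2_def algebra_simps)
    then show False using ypos[of t2] t1 t12 by simp
  qed
  then obtain t0 where t0: "0 \<le> t0" "y t0 \<le> 0" by blast
  obtain t where t: "0 < t" "y t = 0" "\<And>s. 0 \<le> s \<Longrightarrow> s < t \<Longrightarrow> 0 < y s"
    using first_zero[of t0 y] trajectory_continuous(2)[OF tr(1)] t0 tr p by auto
  have xt: "a \<le> x t" "x t \<le> r" using stays_below[OF tr ar r(3) t(3)] t(1) by auto
  have "U (x t) = p\<^sup>2 / 2" using energy[OF tr, of t] t by simp
  then have "x t = r" using below[of "x t"] xt by force
  then show ?thesis using t r by auto
qed

text \<open>At the rim energy the only possible turning point is the equilibrium \<open>b\<close>,
  and uniqueness forbids reaching it in finite time. This is the limiting orbit of the well.\<close>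

lemma no_turning:
  assumes tr: "trajectory f x y" "x 0 = a" "y 0 = p" and p: "0 < p" "p\<^sup>2 / 2 = U b" and t: "0 \<le> t"
  shows "0 < y t"
proof (rule ccontr)
  assume "\<not> 0 < y t"
  then obtain s where s: "0 < s" "y s = 0" "\<And>r. 0 \<le> r \<Longrightarrow> r < s \<Longrightarrow> 0 < y r"
    using first_zero[of t y] trajectory_continuous(2)[OF tr(1)] t tr p by auto
  have ab: "a < b" using vm by simp
  have "a \<le> x s" "x s \<le> b" using stays_below[OF tr ab _ s(3)] p s(1) by auto
  moreover have "U (x s) = U b" using energy[OF tr, of s] s p by simp
  ultimately have "x s = b" using U_below[of b "x s"] U_b vm by force
  moreover have "trajectory f (\<lambda>_. b) (\<lambda>_. 0)" by (simp add: trajectory_def f_b)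
  ultimately have "x 0 = b" using trajectory_unique(1)[OF tr(1), of "\<lambda>_. b" "\<lambda>_. 0" s 0] s by simp
  then show False using tr ab by simp
qed

definition orbit :: "real \<Rightarrow> (real \<Rightarrow> real) \<times> (real \<Rightarrow> real)" where
  "orbit p = (SOME xy. trajectory f (fst xy) (snd xy) \<and> fst xy 0 = a \<and> snd xy 0 = p)"

lemma orbit: "trajectory f (fst (orbit p)) (snd (orbit p))" "fst (orbit p) 0 = a" "snd (orbit p) 0 = p"
proof -
  have "\<exists>xy. trajectory f (fst xy) (snd xy) \<and> fst xy 0 = a \<and> snd xy 0 = p"
    using trajectory_exists[of a p] by auto
  from someI_ex[OF this, folded orbit_def]
  show "trajectory f (fst (orbit p)) (snd (orbit p))" "fst (orbit p) 0 = a" "snd (orbit p) 0 = p" by auto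
qed

lemma orbit_compare: "\<bar>snd (orbit p) t - snd (orbit q) t\<bar> \<le> \<bar>p - q\<bar> * exp ((1 + L) * \<bar>t\<bar>)"
  using trajectory_compare[OF orbit(1)[of p] orbit(1)[of q], of t] orbit(2,3) by simp

definition turn_time :: "real \<Rightarrow> real" where
  "turn_time p = (SOME t. 0 < t \<and> snd (orbit p) t = 0 \<and> (\<forall>s. 0 \<le> s \<and> s < t \<longrightarrow> 0 < snd (orbit p) s)
     \<and> vm < fst (orbit p) t \<and> fst (orbit p) t < b \<and> U (fst (orbit p) t) = p\<^sup>2 / 2)"

lemma turn_time:
  assumes "0 < p" "p\<^sup>2 / 2 < U b"
  shows "0 < turn_time p" "snd (orbit p) (turn_time p) = 0"
    "\<And>s. 0 \<le> s \<Longrightarrow> s < turn_time p \<Longrightarrow> 0 < snd (orbit p) s"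
    "vm < fst (orbit p) (turn_time p)" "fst (orbit p) (turn_time p) < b"
    "U (fst (orbit p) (turn_time p)) = p\<^sup>2 / 2"
  using someI_ex[OF turning[OF orbit[of p] assms], folded turn_time_def] by auto

lemma turn_time_gt:
  assumes p: "0 < p" "p\<^sup>2 / 2 < U b" and y: "\<And>s. 0 \<le> s \<Longrightarrow> s \<le> t \<Longrightarrow> 0 < snd (orbit p) s"
  shows "t < turn_time p"
  using turn_time(1,2)[OF p] y[of "turn_time p"] by force

text \<open>Continuous dependence on a compact time interval, measured against the minimum of the
  velocity there. It bounds turning times from below, near closed and near limiting orbits
  alike.\<close>

lemma positive_nearby:
  assumes t: "0 \<le> t" and y: "\<And>s. 0 \<le> s \<Longrightarrow> s \<le> t \<Longrightarrow> 0 < snd (orbit p) s"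
  shows "\<exists>\<delta>>0. \<forall>q. \<bar>q - p\<bar> < \<delta> \<longrightarrow> (\<forall>s. 0 \<le> s \<and> s \<le> t \<longrightarrow> 0 < snd (orbit q) s)"
proof -
  obtain s0 where s0: "s0 \<in> {0..t}" "\<And>s. s \<in> {0..t} \<Longrightarrow> snd (orbit p) s0 \<le> snd (orbit p) s"
    using continuous_attains_inf[of "{0..t}" "snd (orbit p)"] t trajectory_continuous(2)[OF orbit(1)] by force
  define m where "m = snd (orbit p) s0"
  have m: "m > 0" using y s0 by (auto simp: m_def)
  show ?thesis
  proof (intro exI[of _ "m / exp ((1 + L) * t)"] conjI allI impI)
    show "0 < m / exp ((1 + L) * t)" using m by simp
    fix q s assume q: "\<bar>q - p\<bar> < m / exp ((1 + L) * t)" and s: "0 \<le> s \<and> s \<le> t"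
    have "\<bar>snd (orbit q) s - snd (orbit p) s\<bar> \<le> \<bar>q - p\<bar> * exp ((1 + L) * \<bar>s\<bar>)"
      by (rule orbit_compare)
    also have "\<dots> \<le> \<bar>q - p\<bar> * exp ((1 + L) * t)"
      using s L_nonneg by (intro mult_left_mono) (auto intro!: mult_left_mono)
    also have "\<dots> < m" using q by (simp add: pos_less_divide_eq)
    finally show "0 < snd (orbit q) s" using s0(2)[of s] s by (simp add: m_def)
  qed
qed

text \<open>From below, the velocity stays positive up to \<open>t1\<close>. From above, the force
  does not vanish at the turning point, so the velocity is negative at some \<open>t2\<close> just
  after it, and this persists for nearby orbits.\<close>

lemma turn_time_continuous:
  assumes p: "0 < p" "p\<^sup>2 / 2 < U b" and e: "0 < e"
  shows "\<exists>\<delta>>0. \<forall>q. \<bar>q - p\<bar> < \<delta> \<and> 0 < q \<and> q\<^sup>2 / 2 < U b \<longrightarrow> \<bar>turn_time q - turn_time p\<bar> < e"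
proof -
  define T where "T = turn_time p"
  note T = turn_time[OF p, folded T_def]
  define t1 where "t1 = max 0 (T - e / 2)"
  have t1: "0 \<le> t1" "t1 < T" "T - e < t1" using T(1) e by (auto simp: t1_def)
  obtain d1 where d1: "d1 > 0" "\<And>q s. \<bar>q - p\<bar> < d1 \<Longrightarrow> 0 \<le> s \<Longrightarrow> s \<le> t1 \<Longrightarrow> 0 < snd (orbit q) s"
    using positive_nearby[OF t1(1), of p] T(3) t1(2) by (metis order_le_less_trans)
  have "f (fst (orbit p) T) < 0" using f_neg T(4,5) by blast
  then obtain d where d: "d > 0" "\<And>h. 0 < h \<Longrightarrow> h < d \<Longrightarrow> snd (orbit p) (T + h) < snd (orbit p) T"
    using DERIV_neg_dec_right[OF trajectoryD(2)[OF orbit(1)[of p], of T]] by blast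
  define t2 where "t2 = T + min d e / 2"
  have t2: "T < t2" "t2 < T + e" using d e by (auto simp: t2_def)
  have neg: "snd (orbit p) t2 < 0"
    using d(2)[of "min d e / 2"] d(1) e T(2) by (simp add: t2_def min_def split: if_splits)
  define m where "m = - snd (orbit p) t2"
  have m: "m > 0" using neg by (simp add: m_def)
  define d2 where "d2 = m / exp ((1 + L) * \<bar>t2\<bar>)"
  have d2: "d2 > 0" using m by (simp add: d2_def)
  show ?thesis
  proof (intro exI[of _ "min d1 d2"] conjI allI impI)
    show "0 < min d1 d2" using d1 d2 by simp
    fix q assume q: "\<bar>q - p\<bar> < min d1 d2 \<and> 0 < q \<and> q\<^sup>2 / 2 < U b"
    have lo: "t1 < turn_time q"
      by (rule turn_time_gt) (use q d1(2) in auto)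
    have "\<bar>snd (orbit q) t2 - snd (orbit p) t2\<bar> \<le> \<bar>q - p\<bar> * exp ((1 + L) * \<bar>t2\<bar>)"
      by (rule orbit_compare)
    also have "\<dots> < m" using q by (simp add: d2_def pos_less_divide_eq)
    finally have "snd (orbit q) t2 < 0" by (simp add: m_def)
    then have "\<not> t2 < turn_time q"
      using turn_time(3)[of q t2] q t2 T(1) by force
    then show "\<bar>turn_time q - turn_time p\<bar> < e" using lo t1 t2 by (simp add: T_def[symmetric] abs_if)
  qed
qed

text \<open>The limiting orbit never turns, so orbits close to it are still moving outwards at any
  prescribed time.\<close>

lemma turn_time_unbounded:
  assumes p: "0 < p" "p\<^sup>2 / 2 = U b" and t: "0 \<le> t"
  shows "\<exists>\<delta>>0. \<forall>q. \<bar>q - p\<bar> < \<delta> \<and> 0 < q \<and> q\<^sup>2 / 2 < U b \<longrightarrow> t < turn_time q"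
proof -
  obtain d where d: "d > 0" "\<And>q s. \<bar>q - p\<bar> < d \<Longrightarrow> 0 \<le> s \<Longrightarrow> s \<le> t \<Longrightarrow> 0 < snd (orbit q) s"
    using positive_nearby[OF t, of p] no_turning[OF orbit[of p] p] by metis
  show ?thesis
    by (intro exI[of _ d] conjI allI impI d(1) turn_time_gt) (use d(2) in auto)
qed

lemma orbit_below_turn:
  assumes p: "0 < p" "p\<^sup>2 / 2 < U b" and t: "0 \<le> t" "t \<le> turn_time p"
  shows "a \<le> fst (orbit p) t \<and> fst (orbit p) t \<le> fst (orbit p) (turn_time p)"
proof (rule stays_below[OF orbit _ turn_time(6)[OF p] _ t(1)])
  show "a < fst (orbit p) (turn_time p)" using turn_time(4)[OF p] vm by simp
qed (use turn_time(3)[OF p] t in auto)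

lemma turn_point_mono:
  assumes "0 < p" "p \<le> q" "q\<^sup>2 / 2 < U b"
  shows "fst (orbit p) (turn_time p) \<le> fst (orbit q) (turn_time q)"
proof (rule ccontr)
  assume n: "\<not> ?thesis"
  have pq: "p\<^sup>2 / 2 \<le> q\<^sup>2 / 2" using assms by (simp add: power_mono)
  have p: "0 < p" "p\<^sup>2 / 2 < U b" and q: "0 < q" "q\<^sup>2 / 2 < U b" using assms order_le_less_trans[OF pq assms(3)] by auto
  have "U (fst (orbit q) (turn_time q)) < U (fst (orbit p) (turn_time p))"
    using U_strict_mono turn_time(4)[OF q] turn_time(5)[OF p] n by auto
  then show False using turn_time(6)[OF p] turn_time(6)[OF q] pq by simp
qed

end

text \<open>Sturm comparison with the harmonic oscillator of frequency \<open>\<omega>\<close>.\<close>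

lemma quarter_turn:
  fixes x y \<phi> :: "real \<Rightarrow> real"
  assumes x: "\<And>t. (x has_real_derivative y t) (at t)" and y: "\<And>t. (y has_real_derivative \<phi> t) (at t)"
    and \<omega>: "0 < \<omega>" and "y s0 = 0"
    and below: "\<And>t. s0 \<le> t \<Longrightarrow> t < s1 \<Longrightarrow> x t < c"
    and force: "\<And>t. s0 \<le> t \<Longrightarrow> t < s1 \<Longrightarrow> \<omega>\<^sup>2 * (c - x t) \<le> \<phi> t"
  shows "s1 - s0 \<le> pi / (2 * \<omega>)"
proof (rule ccontr)
  assume n: "\<not> ?thesis"
  define s2 where "s2 = s0 + pi / (2 * \<omega>)"
  have s2: "s0 \<le> s2" "s2 < s1" using n \<omega> by (auto simp: s2_def)
  \<comment> \<open>The Wronskian of \<open>x - c\<close> and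
    \<open>cos (\<omega> * (t - s0))\<close>. It cannot decrease during a quarter period, at whose
    end it equals \<open>\<omega> * (x s2 - c)\<close>, which should be negative.\<close>
  define h where "h t = y t * cos (\<omega> * (t - s0)) + \<omega> * (x t - c) * sin (\<omega> * (t - s0))" for t
  have "h s0 \<le> h s2"
  proof (rule DERIV_nonneg_imp_nondecreasing[OF s2(1)])
    fix t assume t: "s0 \<le> t" "t \<le> s2"
    have "(h has_real_derivative (\<phi> t + \<omega>\<^sup>2 * (x t - c)) * cos (\<omega> * (t - s0))) (at t)"
      unfolding h_def
      by (rule derivative_eq_intros x y refl | simp add: algebra_simps power2_eq_square)+
    moreover have "0 \<le> (\<phi> t + \<omega>\<^sup>2 * (x t - c)) * cos (\<omega> * (t - s0))"
    proof (rule mult_nonneg_nonneg)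
      show "0 \<le> \<phi> t + \<omega>\<^sup>2 * (x t - c)"
        using force[of t] t s2 by (simp add: algebra_simps)
      have "\<omega> * (t - s0) \<le> \<omega> * (pi / (2 * \<omega>))"
        using t \<omega> by (intro mult_left_mono) (auto simp: s2_def)
      then have "\<omega> * (t - s0) \<le> pi / 2" using \<omega> by simp
      moreover have "0 \<le> \<omega> * (t - s0)" using t \<omega> by simp
      ultimately show "0 \<le> cos (\<omega> * (t - s0))"
        by (intro cos_ge_zero) (use pi_ge_zero in argo)+
    qed
    ultimately show "\<exists>l. (h has_real_derivative l) (at t) \<and> 0 \<le> l" by blast
  qed
  moreover have "h s0 = 0" using assms(4) by (simp add: h_def)
  moreover have "h s2 = \<omega> * (x s2 - c)"
  proof -
    have "\<omega> * (s2 - s0) = pi / 2" using \<omega> by (simp add: s2_def)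
    then show ?thesis unfolding h_def by (simp only: cos_pi_half sin_pi_half mult_zero_right mult_1_right add_0_left)
  qed
  ultimately have "0 \<le> x s2 - c" using \<omega> by (simp add: zero_le_mult_iff)
  then show False using below[of s2] s2 by simp
qed

section \<open>Closed orbits in a well and their period\<close>

locale well = autonomous +
  fixes U :: "real \<Rightarrow> real" and a vc b :: real
  assumes U_deriv: "(U has_real_derivative - f s) (at s)"
    and U_a: "U a = 0" and order: "0 < a" "a < vc" "vc < b"
    and f_pos: "0 < s \<Longrightarrow> s < vc \<Longrightarrow> 0 < f s" and f_neg: "vc < s \<Longrightarrow> s < b \<Longrightarrow> f s < 0"
    and f_0: "f 0 = 0" and f_b: "f b = 0" and U_b: "0 < U b"
begin

lemma U_antimono: "0 \<le> s \<Longrightarrow> s < t \<Longrightarrow> t \<le> vc \<Longrightarrow> U t < U s"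
proof (rule DERIV_neg_imp_decreasing_open[of s t U])
  show "continuous_on {s..t} U"
    using U_deriv by (meson DERIV_isCont continuous_at_imp_continuous_on)
qed (use U_deriv f_pos in \<open>force+\<close>)

sublocale R: half_well f B L U a vc b
proof
  show "U s \<le> 0" if "a \<le> s" "s \<le> vc" for s
    using U_antimono[of a s] that order U_a by (cases "s = a") auto
qed (use U_deriv U_a order f_neg f_b U_b in auto)

text \<open>Reflection at \<open>a\<close> maps the left half, with its rim at 0, to a half well
  with its rim at \<open>2 * a\<close>. Since \<open>a < vc\<close>, the force points inwards from
  \<open>a\<close> on, hence \<open>vm = a\<close>.\<close>

sublocale R': half_well "\<lambda>s. - f (2 * a - s)" B L "\<lambda>s. U (2 * a - s)" a a "2 * a"
proof
  show "\<bar>- f (2 * a - x)\<bar> \<le> B" for x using f_bound by simp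
  show "\<bar>- f (2 * a - x) - - f (2 * a - y)\<bar> \<le> L * \<bar>x - y\<bar>" for x y
    using f_lip[of "2 * a - y" "2 * a - x"] by simp
  show "((\<lambda>s. U (2 * a - s)) has_real_derivative - (- f (2 * a - s))) (at s)" for s
  proof -
    have "((\<lambda>s. 2 * a - s) has_real_derivative -1) (at s)" by (auto intro!: derivative_eq_intros)
    from DERIV_chain2[OF U_deriv this] show ?thesis by simp
  qed
  show "0 < U (2 * a - 2 * a)" using U_antimono[of 0 a] order U_a by simp
  show "- f (2 * a - s) < 0" if "a < s" "s < 2 * a" for s
    using f_pos[of "2 * a - s"] that order by simp
  show "U (2 * a - s) \<le> 0" if "a \<le> s" "s \<le> a" for s
    using that U_a by (simp add: antisym)
qed (use L_nonneg U_a order f_0 in auto)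

definition X :: "real \<Rightarrow> real \<Rightarrow> real" where "X p = fst (R.orbit p)"
definition Y :: "real \<Rightarrow> real \<Rightarrow> real" where "Y p = snd (R.orbit p)"
text \<open>The preceding turning instant, on the left, is \<open>- R'.turn_time p\<close>; a full
  turn takes twice the time between the two turning points.\<close>

definition period :: "real \<Rightarrow> real" where "period p = 2 * (R.turn_time p + R'.turn_time p)"

lemma XY: "trajectory f (X p) (Y p)" "X p 0 = a" "Y p 0 = p"
  using R.orbit by (auto simp: X_def Y_def)

lemma XY_left: "X p (- t) = 2 * a - fst (R'.orbit p) t" "Y p (- t) = snd (R'.orbit p) t"
proof -
  have "trajectory (\<lambda>s. - f (2 * a - s)) (\<lambda>t. 2 * a - X p (- t)) (\<lambda>t. Y p (- t))"
    by (rule trajectory_reflect[OF XY(1)])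
  from R'.trajectory_unique[OF this R'.orbit(1)[of p], of 0 t]
  show "X p (- t) = 2 * a - fst (R'.orbit p) t" "Y p (- t) = snd (R'.orbit p) t"
    using XY(2,3)[of p] R'.orbit(2,3)[of p] by auto
qed

lemma XY_symmetric:
  assumes "Y p d = 0" shows "X p (2 * d - t) = X p t" "Y p (2 * d - t) = - Y p t"
proof -
  have "trajectory f (\<lambda>t. X p (2 * d - t)) (\<lambda>t. - Y p (2 * d - t))"
    by (rule trajectory_reflect_time[OF XY(1)])
  from trajectory_unique[OF this XY(1)[of p], of d t]
  show "X p (2 * d - t) = X p t" "Y p (2 * d - t) = - Y p t" using assms by auto
qed

context
  fixes p :: real
  assumes p: "0 < p" "p\<^sup>2 / 2 < U b" "p\<^sup>2 / 2 < U 0"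
begin

lemma below_left: "p\<^sup>2 / 2 < U (2 * a - 2 * a)" using p by simp

lemma turn_zero: "Y p (R.turn_time p) = 0" "Y p (- R'.turn_time p) = 0"
  using R.turn_time(2)[OF p(1,2)] R'.turn_time(2)[OF p(1) below_left] by (auto simp: Y_def[symmetric] XY_left)

lemma period_pos: "0 < period p"
  using R.turn_time(1)[OF p(1,2)] R'.turn_time(1)[OF p(1) below_left] by (simp add: period_def)

text \<open>The time reflections about the two turning instants compose to a translation by twice
  their distance.\<close>

lemma XY_period: "X p (t + period p) = X p t" "Y p (t + period p) = Y p t"
proof -
  have *: "t + period p = 2 * R.turn_time p - (2 * (- R'.turn_time p) - t)"
    by (simp add: period_def)
  show "X p (t + period p) = X p t" "Y p (t + period p) = Y p t"
    unfolding * XY_symmetric[OF turn_zero(1)] XY_symmetric[OF turn_zero(2)] by auto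
qed

lemma XY_period_mult: "X p (t + real n * period p) = X p t" "Y p (t + real n * period p) = Y p t"
proof (induction n)
  case (Suc n)
  have *: "t + real (Suc n) * period p = (t + real n * period p) + period p" by (simp add: algebra_simps)
  show "X p (t + real (Suc n) * period p) = X p t" "Y p (t + real (Suc n) * period p) = Y p t"
    unfolding * XY_period by (rule Suc)+
qed auto

lemma Y_pos: "- R'.turn_time p < t \<Longrightarrow> t < R.turn_time p \<Longrightarrow> 0 < Y p t"
  using R.turn_time(3)[OF p(1,2), of t] R'.turn_time(3)[OF p(1) below_left, of "- t"] XY_left(2)[of p "- t"]
  by (cases "0 \<le> t") (auto simp: Y_def)

lemma X_half_range:
  assumes "- R'.turn_time p \<le> t" "t \<le> R.turn_time p"
  shows "X p (- R'.turn_time p) \<le> X p t \<and> X p t \<le> X p (R.turn_time p)"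
proof (cases "0 \<le> t")
  case True
  have "X p (- R'.turn_time p) \<le> a"
    using R'.turn_time(4)[OF p(1) below_left] by (simp add: XY_left)
  then show ?thesis using R.orbit_below_turn[OF p(1,2) True assms(2)] by (simp add: X_def)
next
  case False
  have "a \<le> X p (R.turn_time p)"
    using R.turn_time(4)[OF p(1,2)] order by (simp add: X_def)
  then show ?thesis
    using R'.orbit_below_turn[OF p(1) below_left, of "- t"] XY_left(1)[of p "- t"] XY_left(1)[of p "R'.turn_time p"]
      False assms(1) by simp
qed

text \<open>Translation by periods moves \<open>t\<close> into one period, and reflection about the
  right turning instant folds its second half onto the first, where \<open>X_half_range\<close>
  applies.\<close>

lemma X_range: "X p (- R'.turn_time p) \<le> X p t \<and> X p t \<le> X p (R.turn_time p)"
proof -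
  define T where "T = period p"
  define l where "l = R'.turn_time p"
  define r where "r = R.turn_time p"
  have T: "T = 2 * (r + l)" "0 < T" using period_pos by (auto simp: T_def l_def r_def period_def)
  obtain s where s: "s \<in> {- l..- l + T}" "X p s = X p t"
    using periodic_value_in_interval[of T "X p" "- l" t] T(2) XY_period(1) by (auto simp: T_def)
  have "X p (- l) \<le> X p s \<and> X p s \<le> X p r"
  proof (cases "s \<le> r")
    case True
    then show ?thesis using X_half_range[of s] s by (simp add: l_def r_def)
  next
    case False
    then have "- l \<le> 2 * r - s" "2 * r - s \<le> r" using s T by auto
    then have "X p (- l) \<le> X p (2 * r - s) \<and> X p (2 * r - s) \<le> X p r"
      using X_half_range[of "2 * r - s"] by (simp add: l_def r_def)
    then show ?thesis using XY_symmetric(1)[OF turn_zero(1), of s] by (simp add: r_def)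
  qed
  then show ?thesis using s(2) by (simp add: l_def r_def)
qed

lemma X_turn_bounds: "0 < X p (- R'.turn_time p)" "X p (- R'.turn_time p) < a"
    "vc < X p (R.turn_time p)" "X p (R.turn_time p) < b"
    "U (X p (- R'.turn_time p)) = p\<^sup>2 / 2" "U (X p (R.turn_time p)) = p\<^sup>2 / 2"
  using R.turn_time(4-6)[OF p(1,2)] R'.turn_time(4-6)[OF p(1) below_left]
  by (auto simp: X_def[symmetric] XY_left)

text \<open>The energy bounds keep the orbit between \<open>a - \<delta>\<close> and
  \<open>a + \<delta>\<close>, where the force pulls towards \<open>vc\<close> at least as strongly
  as that of an oscillator of frequency \<open>\<omega>\<close>. Each way between \<open>vc\<close>
  and a turning point then takes at most a quarter of \<open>2 * pi / \<omega>\<close>.\<close>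

lemma period_small:
  assumes \<omega>: "0 < \<omega>" and \<delta>: "0 < \<delta>" "\<delta> \<le> a" "p\<^sup>2 / 2 < U (a - \<delta>)" "a + \<delta> \<le> b" "p\<^sup>2 / 2 < U (a + \<delta>)" "vc \<le> a + \<delta>"
    and lo: "\<And>s. a - \<delta> \<le> s \<Longrightarrow> s \<le> vc \<Longrightarrow> \<omega>\<^sup>2 * (vc - s) \<le> f s"
    and hi: "\<And>s. vc \<le> s \<Longrightarrow> s \<le> a + \<delta> \<Longrightarrow> f s \<le> - \<omega>\<^sup>2 * (s - vc)"
  shows "period p \<le> 2 * pi / \<omega>"
proof -
  define l where "l = R'.turn_time p"
  define r where "r = R.turn_time p"
  have lr: "0 < l" "0 < r" using R.turn_time(1)[OF p(1,2)] R'.turn_time(1)[OF p(1) below_left] by (auto simp: l_def r_def)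
  have Xl: "a - \<delta> \<le> X p (- l)"
  proof (rule ccontr)
    assume "\<not> ?thesis"
    then have "U (a - \<delta>) < U (X p (- l))"
      using U_antimono[of "X p (- l)" "a - \<delta>"] X_turn_bounds(1) \<delta> order by (simp add: l_def)
    then show False using X_turn_bounds(5) \<delta> by (simp add: l_def)
  qed
  have Xr: "X p r \<le> a + \<delta>"
  proof (rule ccontr)
    assume "\<not> ?thesis"
    then have "U (a + \<delta>) < U (X p r)"
      using R.U_strict_mono[of "a + \<delta>" "X p r"] X_turn_bounds(4) \<delta> by (simp add: r_def)
    then show False using X_turn_bounds(6) \<delta> by (simp add: r_def)
  qed
  have cont: "continuous_on S (X p)" for S by (rule trajectory_continuous[OF XY(1)])
  obtain m where m: "- l \<le> m" "m \<le> r" "X p m = vc"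
    using IVT'[of "X p" "- l" vc r] X_turn_bounds(2,3) lr order cont by (auto simp: l_def r_def)
  have inc: "X p s < X p t" if "- l \<le> s" "s < t" "t \<le> r" for s t
  proof (rule DERIV_pos_imp_increasing_open[OF that(2) _ cont])
    fix u assume "s < u" "u < t"
    then show "\<exists>y. (X p has_real_derivative y) (at u) \<and> 0 < y"
      using trajectoryD(1)[OF XY(1)[of p], of u] Y_pos[of u] that by (intro exI[of _ "Y p u"]) (auto simp: l_def r_def)
  qed
  have "m - (- l) \<le> pi / (2 * \<omega>)"
  proof (rule quarter_turn[OF trajectoryD(1)[OF XY(1)[of p]] trajectoryD(2)[OF XY(1)[of p]] \<omega>, where c=vc])
    show "Y p (- l) = 0" using turn_zero by (simp add: l_def)
    fix t assume t: "- l \<le> t" "t < m"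
    then show "X p t < vc" using inc[of t m] m by simp
    moreover have "X p (- l) \<le> X p t" using inc[of "- l" t] t m by (cases "t = - l") auto
    ultimately show "\<omega>\<^sup>2 * (vc - X p t) \<le> f (X p t)" using lo[of "X p t"] Xl by simp
  qed
  \<comment> \<open>The arc from \<open>vc\<close> to the right turning point is read backwards and
    reflected at 0, so that it starts at rest below \<open>- vc\<close>.\<close>
  moreover have "- m - (- r) \<le> pi / (2 * \<omega>)"
  proof (rule quarter_turn[OF _ _ \<omega>, where c="- vc" and x="\<lambda>t. 0 - X p (- t)" and y="\<lambda>t. Y p (- t)"])
    show "((\<lambda>t. 0 - X p (- t)) has_real_derivative Y p (- t)) (at t)" for t
      by (rule trajectoryD(1)[OF trajectory_reflect[OF XY(1)[of p]]])
    show "((\<lambda>t. Y p (- t)) has_real_derivative - f (0 - (0 - X p (- t)))) (at t)" for t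
      by (rule trajectoryD(2)[OF trajectory_reflect[OF XY(1)[of p]]])
    show "Y p (- (- r)) = 0" using turn_zero by (simp add: r_def)
    fix t assume t: "- r \<le> t" "t < - m"
    then have 1: "vc < X p (- t)" using inc[of m "- t"] m by simp
    then show "0 - X p (- t) < - vc" by simp
    have "X p (- t) \<le> X p r" using inc[of "- t" r] t m by (cases "- t = r") auto
    then show "\<omega>\<^sup>2 * (- vc - (0 - X p (- t))) \<le> - f (0 - (0 - X p (- t)))"
      using hi[of "X p (- t)"] 1 Xr by (simp add: algebra_simps)
  qed
  ultimately have "r + l \<le> 2 * (pi / (2 * \<omega>))" by linarith
  then show ?thesis using \<omega> by (simp add: period_def l_def r_def)
qed

end

lemma period_continuous:
  assumes "0 < p1" "p2\<^sup>2 / 2 < U b" "p2\<^sup>2 / 2 < U 0"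
  shows "continuous_on {p1..p2} period"
  unfolding continuous_on_iff dist_real_def
proof (intro ballI allI impI)
  fix p e :: real assume p: "p \<in> {p1..p2}" and e: "0 < e"
  have adm: "0 < q" "q\<^sup>2 / 2 < U b" "q\<^sup>2 / 2 < U (2 * a - 2 * a)" if "q \<in> {p1..p2}" for q
  proof -
    have "q\<^sup>2 / 2 \<le> p2\<^sup>2 / 2" using that assms(1) by (simp add: power_mono)
    then have "q\<^sup>2 / 2 < U b" "q\<^sup>2 / 2 < U 0" using assms order_le_less_trans by blast+
    then show "0 < q" "q\<^sup>2 / 2 < U b" "q\<^sup>2 / 2 < U (2 * a - 2 * a)"
      using that assms(1) by auto
  qed
  have e4: "0 < e / 4" using e by simp
  obtain d1 where d1: "d1 > 0" "\<And>q. \<bar>q - p\<bar> < d1 \<Longrightarrow> 0 < q \<Longrightarrow> q\<^sup>2 / 2 < U b \<Longrightarrow>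
      \<bar>R.turn_time q - R.turn_time p\<bar> < e / 4"
    using R.turn_time_continuous[OF adm(1,2)[OF p] e4] by blast
  obtain d2 where d2: "d2 > 0" "\<And>q. \<bar>q - p\<bar> < d2 \<Longrightarrow> 0 < q \<Longrightarrow> q\<^sup>2 / 2 < U (2 * a - 2 * a) \<Longrightarrow>
      \<bar>R'.turn_time q - R'.turn_time p\<bar> < e / 4"
    using R'.turn_time_continuous[OF adm(1,3)[OF p] e4] by blast
  show "\<exists>d>0. \<forall>q\<in>{p1..p2}. \<bar>q - p\<bar> < d \<longrightarrow> \<bar>period q - period p\<bar> < e"
  proof (intro exI[of _ "min d1 d2"] conjI ballI impI)
    fix q assume q: "q \<in> {p1..p2}" "\<bar>q - p\<bar> < min d1 d2"
    have "\<bar>R.turn_time q - R.turn_time p\<bar> < e / 4" "\<bar>R'.turn_time q - R'.turn_time p\<bar> < e / 4"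
      using d1(2)[of q] d2(2)[of q] adm[OF q(1)] q(2) by auto
    then show "\<bar>period q - period p\<bar> < e" by (simp add: period_def abs_if field_simps split: if_splits)
  qed (use d1 d2 in auto)
qed

text \<open>\<open>ps\<close> is the velocity that belongs to the energy of the lower rim. On that
  side the orbit never turns, and the turning time on the other side only adds to the
  period.\<close>

lemma period_large:
  assumes p1: "0 < p1" "p1\<^sup>2 / 2 < U b" "p1\<^sup>2 / 2 < U 0" and t: "0 \<le> t"
  shows "\<exists>p2>p1. p2\<^sup>2 / 2 < U b \<and> p2\<^sup>2 / 2 < U 0 \<and> t < period p2"
proof -
  define e where "e = min (U b) (U 0)"
  define ps where "ps = sqrt (2 * e)"
  have e: "0 < e" using U_b R'.U_b by (simp add: e_def)
  have ps: "0 < ps" "ps\<^sup>2 / 2 = e" using e by (auto simp: ps_def)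
  have adm: "q\<^sup>2 / 2 < U b \<and> q\<^sup>2 / 2 < U 0" if "0 < q" "q < ps" for q
  proof -
    have "q\<^sup>2 / 2 < ps\<^sup>2 / 2" using that by (simp add: power_strict_mono)
    then show ?thesis using ps by (simp add: e_def)
  qed
  have "p1 < ps"
  proof (rule power_less_imp_less_base[of p1 2])
    have "p1\<^sup>2 / 2 < ps\<^sup>2 / 2" using ps p1 by (simp add: e_def)
    then show "p1\<^sup>2 < ps\<^sup>2" by simp
  qed (use ps in simp)
  obtain d where d: "d > 0" "\<And>q. \<bar>q - ps\<bar> < d \<Longrightarrow> 0 < q \<Longrightarrow> q < ps \<Longrightarrow> t < period q"
  proof (cases "U b \<le> U 0")
    case True
    then have "ps\<^sup>2 / 2 = U b" using ps by (simp add: e_def)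
    then obtain d where d: "d > 0" "\<And>q. \<bar>q - ps\<bar> < d \<Longrightarrow> 0 < q \<Longrightarrow> q\<^sup>2 / 2 < U b \<Longrightarrow> t < R.turn_time q"
      using R.turn_time_unbounded[OF ps(1) _ t] by blast
    show ?thesis
    proof (rule that[OF d(1)])
      fix q assume q: "\<bar>q - ps\<bar> < d" "0 < q" "q < ps"
      then have "t < R.turn_time q" "0 < R'.turn_time q"
        using d(2)[of q] adm[of q] R'.turn_time(1)[of q] by auto
      then show "t < period q" using t by (simp add: period_def)
    qed
  next
    case False
    then have "ps\<^sup>2 / 2 = U (2 * a - 2 * a)" using ps by (simp add: e_def)
    then obtain d where d: "d > 0" "\<And>q. \<bar>q - ps\<bar> < d \<Longrightarrow> 0 < q \<Longrightarrow> q\<^sup>2 / 2 < U (2 * a - 2 * a) \<Longrightarrow> t < R'.turn_time q"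
      using R'.turn_time_unbounded[OF ps(1) _ t] by blast
    show ?thesis
    proof (rule that[OF d(1)])
      fix q assume q: "\<bar>q - ps\<bar> < d" "0 < q" "q < ps"
      then have "t < R'.turn_time q" "0 < R.turn_time q"
        using d(2)[of q] adm[of q] R.turn_time(1)[of q] by auto
      then show "t < period q" using t by (simp add: period_def)
    qed
  qed
  define q where "q = max ((p1 + ps) / 2) (ps - d / 2)"
  have q: "p1 < q" "q < ps" "\<bar>q - ps\<bar> < d"
    using \<open>p1 < ps\<close> d(1) by (auto simp: q_def max_def abs_if field_simps)
  then show ?thesis using d(2)[of q] adm[of q] p1(1) by (intro exI[of _ q]) auto
qed

text \<open>Turning points move outwards as \<open>p\<close> grows, so the orbit of
  \<open>p2\<close> bounds all the others.\<close>

lemma X_uniform_range: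
  assumes "0 < p" "p \<le> p2" "p2\<^sup>2 / 2 < U b" "p2\<^sup>2 / 2 < U 0"
  shows "X p2 (- R'.turn_time p2) \<le> X p t \<and> X p t \<le> X p2 (R.turn_time p2)"
proof -
  have "p\<^sup>2 / 2 \<le> p2\<^sup>2 / 2" using assms by (simp add: power_mono)
  then have p: "0 < p" "p\<^sup>2 / 2 < U b" "p\<^sup>2 / 2 < U 0" using assms order_le_less_trans by blast+
  have "X p (R.turn_time p) \<le> X p2 (R.turn_time p2)"
    using R.turn_point_mono[OF assms(1-3)] by (simp add: X_def)
  moreover have "X p2 (- R'.turn_time p2) \<le> X p (- R'.turn_time p)"
    using R'.turn_point_mono[OF assms(1,2)] assms(4) by (simp add: XY_left)
  ultimately show ?thesis using X_range[OF p, of t] by linarith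
qed

end

section \<open>First variation of the action\<close>

text \<open>Replaces the derivative test at a minimum, where only an expansion with quadratic
  remainder is at hand.\<close>

lemma nonpos_if_quadratically_dominated:
  fixes A C d :: real
  assumes "0 < d" "\<And>h. 0 < h \<Longrightarrow> h < d \<Longrightarrow> A * h \<le> C * h\<^sup>2"
  shows "A \<le> 0"
proof (rule ccontr)
  assume "\<not> A \<le> 0"
  define h where "h = min (d / 2) (A / (2 * (\<bar>C\<bar> + 1)))"
  have A: "0 < A" using \<open>\<not> A \<le> 0\<close> by simp
  have q: "0 < A / (2 * (\<bar>C\<bar> + 1))" using A by (intro divide_pos_pos mult_pos_pos add_nonneg_pos) auto
  have h: "0 < h" "h < d" "h \<le> A / (2 * (\<bar>C\<bar> + 1))" using assms(1) q by (auto simp: h_def)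
  have "A * h \<le> (C * h) * h" using assms(2)[OF h(1,2)] by (simp add: power2_eq_square mult_ac)
  then have "A \<le> C * h" using h(1) by simp
  also have "\<dots> \<le> (\<bar>C\<bar> + 1) * h" using h(1) by (intro mult_right_mono) auto
  also have "\<dots> \<le> (\<bar>C\<bar> + 1) * (A / (2 * (\<bar>C\<bar> + 1)))" using h(3) by (intro mult_left_mono) auto
  also have "\<dots> = A / 2"
  proof -
    have "\<bar>C\<bar> + 1 \<noteq> 0" by linarith
    then show ?thesis by (simp add: divide_simps)
  qed
  finally show False using A by simp
qed

text \<open>The expansion says \<open>dG = X dE - Z dt\<close>. At a minimum of \<open>G\<close> the strict monotonicity of \<open>E\<close>
  in \<open>p\<close> forces \<open>X = 0\<close> and then \<open>Z = 0\<close>; the sign of \<open>X\<close> keeps the minimum off the boundary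
  of the strip.\<close>

lemma periodic_strip_minimum:
  fixes G X E Z :: "real \<Rightarrow> real \<Rightarrow> real"
  assumes "0 < \<beta>" "p1 < p2" "0 < k"
    and periodic: "\<And>t p. p \<in> {p1..p2} \<Longrightarrow> G (t + \<beta>) p = G t p"
    and expansion: "\<And>t p. p \<in> {p1..p2} \<Longrightarrow> \<exists>C d. 0 < d \<and> (\<forall>s q. \<bar>s - t\<bar> < d \<and> \<bar>q - p\<bar> < d \<and> q \<in> {p1..p2} \<longrightarrow>
        \<bar>G s q - G t p - (X t p * (E s q - E t p) - Z t p * (s - t))\<bar> \<le> C * (\<bar>s - t\<bar> + \<bar>q - p\<bar>)\<^sup>2 \<and>
        \<bar>E s q - E t p\<bar> \<le> C * (\<bar>s - t\<bar> + \<bar>q - p\<bar>) \<and>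
        k * (q - p)\<^sup>2 \<le> (E t q - E t p) * (q - p))"
    and X1: "\<And>t. X t p1 < 0" and X2: "\<And>t. 0 < X t p2"
  shows "\<exists>t p. p \<in> {p1..p2} \<and> X t p = 0 \<and> Z t p = 0"
proof -
  \<comment> \<open>Continuity of \<open>G\<close> comes out of the expansion: \<open>R\<close>
    dominates the increment and tends to 0.\<close>
  have "continuous_on (UNIV \<times> {p1..p2}) (\<lambda>x. G (fst x) (snd x))"
    unfolding continuous_on_def
  proof (clarify)
    fix t p assume p: "p \<in> {p1..p2}"
    obtain C d where "0 < d" and *: "\<And>s q. \<bar>s - t\<bar> < d \<Longrightarrow> \<bar>q - p\<bar> < d \<Longrightarrow> q \<in> {p1..p2} \<Longrightarrow>
        \<bar>G s q - G t p - (X t p * (E s q - E t p) - Z t p * (s - t))\<bar> \<le> C * (\<bar>s - t\<bar> + \<bar>q - p\<bar>)\<^sup>2 \<and>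
        \<bar>E s q - E t p\<bar> \<le> C * (\<bar>s - t\<bar> + \<bar>q - p\<bar>)"
      using expansion[OF p] by blast
    define R where "R x = C * (\<bar>fst x - t\<bar> + \<bar>snd x - p\<bar>)\<^sup>2 + \<bar>X t p\<bar> * (C * (\<bar>fst x - t\<bar> + \<bar>snd x - p\<bar>)) + \<bar>Z t p\<bar> * \<bar>fst x - t\<bar>" for x
    let ?F = "at (t, p) within UNIV \<times> {p1..p2}"
    have f: "((\<lambda>x. fst x) \<longlongrightarrow> t) ?F" "((\<lambda>x. snd x) \<longlongrightarrow> p) ?F"
      using tendsto_fst[OF tendsto_ident_at[of "(t, p)" "UNIV \<times> {p1..p2}"]]
        tendsto_snd[OF tendsto_ident_at[of "(t, p)" "UNIV \<times> {p1..p2}"]] by simp_all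
    have "(R \<longlongrightarrow> C * (\<bar>t - t\<bar> + \<bar>p - p\<bar>)\<^sup>2 + \<bar>X t p\<bar> * (C * (\<bar>t - t\<bar> + \<bar>p - p\<bar>)) + \<bar>Z t p\<bar> * \<bar>t - t\<bar>) ?F"
      unfolding R_def by (intro tendsto_intros f)
    then have R0: "(R \<longlongrightarrow> 0) ?F" by simp
    have ev: "\<forall>\<^sub>F x in ?F. \<bar>fst x - t\<bar> < d \<and> \<bar>snd x - p\<bar> < d \<and> snd x \<in> {p1..p2}"
    proof (intro eventually_conj)
      show "\<forall>\<^sub>F x in ?F. \<bar>fst x - t\<bar> < d" "\<forall>\<^sub>F x in ?F. \<bar>snd x - p\<bar> < d"
        using tendstoD[OF f(1) \<open>0 < d\<close>] tendstoD[OF f(2) \<open>0 < d\<close>] by (auto simp: dist_real_def)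
      show "\<forall>\<^sub>F x in ?F. snd x \<in> {p1..p2}"
        unfolding eventually_at_filter by (intro always_eventually) auto
    qed
    have "((\<lambda>x. G (fst x) (snd x) - G t p) \<longlongrightarrow> 0) ?F"
    proof (rule Lim_null_comparison[OF _ R0])
      show "\<forall>\<^sub>F x in ?F. norm (G (fst x) (snd x) - G t p) \<le> R x"
      proof (rule eventually_mono[OF ev])
        fix x assume x: "\<bar>fst x - t\<bar> < d \<and> \<bar>snd x - p\<bar> < d \<and> snd x \<in> {p1..p2}"
        let ?h = "\<bar>fst x - t\<bar> + \<bar>snd x - p\<bar>"
        have 1: "\<bar>G (fst x) (snd x) - G t p - (X t p * (E (fst x) (snd x) - E t p) - Z t p * (fst x - t))\<bar> \<le> C * ?h\<^sup>2"
          and 2: "\<bar>E (fst x) (snd x) - E t p\<bar> \<le> C * ?h"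
          using *[of "fst x" "snd x"] x by auto
        have 3: "\<bar>X t p * (E (fst x) (snd x) - E t p)\<bar> \<le> \<bar>X t p\<bar> * (C * ?h)"
          unfolding abs_mult by (rule mult_left_mono[OF 2]) simp
        have "\<bar>Z t p * (fst x - t)\<bar> = \<bar>Z t p\<bar> * \<bar>fst x - t\<bar>" by (rule abs_mult)
        then show "norm (G (fst x) (snd x) - G t p) \<le> R x"
          unfolding R_def real_norm_def using 1 3 by linarith
      qed
    qed
    then show "((\<lambda>x. G (fst x) (snd x)) \<longlongrightarrow> G (fst (t, p)) (snd (t, p))) ?F"
      by (simp add: LIM_zero_iff)
  qed
  then have cont: "continuous_on ({0..\<beta>} \<times> {p1..p2}) (\<lambda>x. G (fst x) (snd x))"
    by (rule continuous_on_subset) auto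
  have "compact ({0..\<beta>} \<times> {p1..p2})" by (intro compact_Times) auto
  moreover have "{0..\<beta>} \<times> {p1..p2} \<noteq> {}" using assms by auto
  ultimately obtain x where "x \<in> {0..\<beta>} \<times> {p1..p2}"
    and "\<forall>y\<in>{0..\<beta>} \<times> {p1..p2}. G (fst x) (snd x) \<le> G (fst y) (snd y)"
    using continuous_attains_inf[OF _ _ cont] by blast
  then obtain t p where tp: "t \<in> {0..\<beta>}" "p \<in> {p1..p2}"
    and min0: "\<And>s q. s \<in> {0..\<beta>} \<Longrightarrow> q \<in> {p1..p2} \<Longrightarrow> G t p \<le> G s q" by fastforce
  \<comment> \<open>By periodicity the minimum is one over all times, so both time directions are
    admissible variations even at \<open>t = 0\<close> and \<open>t = \<beta>\<close>.\<close>
  have min: "G t p \<le> G s q" if q: "q \<in> {p1..p2}" for s q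
  proof -
    obtain s' where "s' \<in> {0..0 + \<beta>}" "G s' q = G s q"
      using periodic_value_in_interval[of \<beta> "\<lambda>t. G t q" 0 s] assms(1) periodic[OF q] by blast
    then show ?thesis using min0[OF _ q, of s'] by simp
  qed
  obtain C d where d: "0 < d" and *: "\<And>s q. \<bar>s - t\<bar> < d \<Longrightarrow> \<bar>q - p\<bar> < d \<Longrightarrow> q \<in> {p1..p2} \<Longrightarrow>
        \<bar>G s q - G t p - (X t p * (E s q - E t p) - Z t p * (s - t))\<bar> \<le> C * (\<bar>s - t\<bar> + \<bar>q - p\<bar>)\<^sup>2 \<and>
        k * (q - p)\<^sup>2 \<le> (E t q - E t p) * (q - p)"
    using expansion[OF tp(2)] by blast
  have X: "X t p = 0"
  proof (rule ccontr)
    assume "X t p \<noteq> 0"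
    then consider "X t p < 0" | "0 < X t p" by linarith
    then show False
    proof cases
      case 1
      \<comment> \<open>Raising \<open>p\<close> by \<open>h\<close> raises \<open>E\<close> by at
        least \<open>k * h\<close>, so \<open>G\<close> would fall linearly in \<open>h\<close>,
        which a quadratic error cannot compensate. The sign of \<open>X\<close> at \<open>p2\<close>
        makes room for this move.\<close>
      then have "p < p2" using X2[of t] tp(2) by (cases "p = p2") auto
      have "(- X t p * k) * h \<le> C * h\<^sup>2" if h: "0 < h" "h < min d (p2 - p)" for h
      proof -
        have q: "p + h \<in> {p1..p2}" using h tp by auto
        have e: "\<bar>G t (p + h) - G t p - X t p * (E t (p + h) - E t p)\<bar> \<le> C * h\<^sup>2"
            "k * h\<^sup>2 \<le> (E t (p + h) - E t p) * h"
          using *[of t "p + h"] q h d by auto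
        have "k * h \<le> E t (p + h) - E t p" using e(2) h by (simp add: power2_eq_square)
        then have "X t p * (E t (p + h) - E t p) \<le> X t p * (k * h)"
          using 1 by (intro mult_left_mono_neg) auto
        then show ?thesis using e(1) min[OF q, of t] by (simp add: mult.assoc)
      qed
      then have "- X t p * k \<le> 0"
        by (intro nonpos_if_quadratically_dominated[of "min d (p2 - p)"]) (use d \<open>p < p2\<close> in auto)
      then show False using 1 \<open>0 < k\<close> by (simp add: zero_le_mult_iff)
    next
      case 2
      \<comment> \<open>The mirror image, lowering \<open>p\<close>.\<close>
      then have "p1 < p" using X1[of t] tp(2) by (cases "p = p1") auto
      have "(X t p * k) * h \<le> C * h\<^sup>2" if h: "0 < h" "h < min d (p - p1)" for h
      proof -
        have q: "p - h \<in> {p1..p2}" using h tp by auto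
        have e: "\<bar>G t (p - h) - G t p - X t p * (E t (p - h) - E t p)\<bar> \<le> C * h\<^sup>2"
            "k * (- h)\<^sup>2 \<le> (E t (p - h) - E t p) * - h"
          using *[of t "p - h"] q h d by auto
        have "k * h * h \<le> - (E t (p - h) - E t p) * h"
          using e(2) by (simp add: power2_eq_square algebra_simps)
        then have "k * h \<le> - (E t (p - h) - E t p)" using h(1) mult_le_cancel_right_pos by blast
        then have "X t p * (k * h) \<le> X t p * - (E t (p - h) - E t p)"
          using 2 by (intro mult_left_mono) auto
        then have "X t p * k * h \<le> - (X t p * (E t (p - h) - E t p))"
          by (simp only: mult_minus_right mult.assoc)
        then show ?thesis using e(1) min[OF q, of t] by linarith
      qed
      then have "X t p * k \<le> 0"
        by (intro nonpos_if_quadratically_dominated[of "min d (p - p1)"]) (use d \<open>p1 < p\<close> in auto)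
      then show False using 2 \<open>0 < k\<close> by (simp add: mult_le_0_iff)
    qed
  qed
  \<comment> \<open>As \<open>X t p = 0\<close>, the change of \<open>E\<close> drops out and pure
    time shifts of either sign can be tested.\<close>
  have e: "- Z t p * (s - t) + C * \<bar>s - t\<bar>\<^sup>2 \<ge> 0" if "\<bar>s - t\<bar> < d" for s
    using *[of s p] that d tp(2) X min[OF tp(2), of s] by auto
  have "Z t p \<le> 0"
  proof (rule nonpos_if_quadratically_dominated[OF d, of _ C])
    fix h assume "0 < h" "h < d"
    then show "Z t p * h \<le> C * h\<^sup>2" using e[of "t + h"] by simp
  qed
  moreover have "- Z t p \<le> 0"
  proof (rule nonpos_if_quadratically_dominated[OF d, of _ C])
    fix h assume "0 < h" "h < d"
    then show "- Z t p * h \<le> C * h\<^sup>2" using e[of "t - h"] by simp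
  qed
  ultimately show ?thesis using X tp(2) by (intro exI[of _ t] exI[of _ p]) auto
qed

text \<open>\<open>f1 a = 0\<close> reflects \<open>F a = 0\<close>. With both antiderivatives
  normalised on the section, \<open>P1\<close> vanishes there to second order and \<open>P0\<close>
  to first order.\<close>

locale oscillator = bounded_lipschitz +
  fixes P0 P1 :: "real \<Rightarrow> real" and a :: real
  assumes P0_deriv: "(P0 has_real_derivative f0 s) (at s)" and P1_deriv: "(P1 has_real_derivative f1 s) (at s)"
    and P0_a: "P0 a = 0" and P1_a: "P1 a = 0" and f1_a: "f1 a = 0"
begin

lemma potential_taylor:
  assumes P: "\<And>s. (P has_real_derivative f s) (at s)" and f: "\<And>x y. \<bar>f x - f y\<bar> \<le> L * \<bar>x - y\<bar>"
  shows "\<bar>P y - P x - f x * (y - x)\<bar> \<le> L * (y - x)\<^sup>2"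
proof -
  obtain \<xi> where \<xi>: "P y - P x = f \<xi> * (y - x)" "\<bar>\<xi> - x\<bar> \<le> \<bar>y - x\<bar>"
  proof -
    consider "x < y" | "y < x" | "x = y" by linarith
    then show ?thesis
    proof cases
      case 1
      then obtain z where "x < z" "z < y" "P y - P x = (y - x) * f z" using MVT2[OF 1 P] by blast
      then show ?thesis using that[of z] by (simp add: mult.commute)
    next
      case 2
      then obtain z where "y < z" "z < x" "P x - P y = (x - y) * f z" using MVT2[OF 2 P] by blast
      then show ?thesis using that[of z] by (simp add: algebra_simps)
    next
      case 3 then show ?thesis using that[of x] by simp
    qed
  qed
  have "\<bar>P y - P x - f x * (y - x)\<bar> = \<bar>f \<xi> - f x\<bar> * \<bar>y - x\<bar>"
    unfolding \<xi>(1) by (simp add: abs_mult[symmetric] algebra_simps)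
  also have "\<dots> \<le> L * \<bar>y - x\<bar> * \<bar>y - x\<bar>"
    using f[of \<xi> x] \<xi>(2) L_nonneg by (intro mult_right_mono) (auto intro: order_trans mult_left_mono)
  finally show ?thesis by (simp add: power2_eq_square mult.assoc)
qed

lemmas P0_taylor = potential_taylor[OF P0_deriv f0_lip] and P1_taylor = potential_taylor[OF P1_deriv f1_lip]

lemma P1_bound: "\<bar>P1 y\<bar> \<le> L * (y - a)\<^sup>2"
  using P1_taylor[of y a] by (simp add: P1_a f1_a)

lemma P0_bound: "\<bar>P0 y\<bar> \<le> B * \<bar>y - a\<bar>"
proof -
  have "norm (P0 y - P0 a) \<le> B * norm (y - a)"
    by (rule field_differentiable_bound[of UNIV P0 f0 B]) (use P0_deriv f0_bound in auto)
  then show ?thesis by (simp add: P0_a)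
qed

lemma f1_near_a: "\<bar>f1 x\<bar> \<le> L * \<bar>x - a\<bar>"
  using f1_lip[of x a] by (simp add: f1_a)

text \<open>Kinetic minus potential energy: the force is the derivative of
  \<open>P0 + n * P1\<close>, which is thus minus the potential.\<close>

definition lagrangian :: "(real \<Rightarrow> real) \<Rightarrow> (real \<Rightarrow> real) \<Rightarrow> (real \<Rightarrow> real) \<Rightarrow> real \<Rightarrow> real" where
  "lagrangian n v w t = (w t)\<^sup>2 / 2 + P0 (v t) + n t * P1 (v t)"

lemma P_continuous: "continuous_on S P0" "continuous_on S P1"
  using P0_deriv P1_deriv by (meson DERIV_isCont continuous_at_imp_continuous_on)+

lemma lagrangian_loc_integrable:
  assumes "loc_integrable n" "continuous_on UNIV v" "continuous_on UNIV w"
  shows "loc_integrable (lagrangian n v w)"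
proof -
  have "continuous_on UNIV (\<lambda>t. P0 (v t))" "continuous_on UNIV (\<lambda>t. P1 (v t))"
    by (rule continuous_on_compose2[OF P_continuous(1)[of UNIV] assms(2)] continuous_on_compose2[OF P_continuous(2)[of UNIV] assms(2)], simp)+
  then show ?thesis
    unfolding lagrangian_def[abs_def] using assms
    by (intro loc_integrable_add[OF loc_integrable_continuous loc_integrable_mult_continuous'] continuous_intros) auto
qed

end

text \<open>A time interval with a bound \<open>N1\<close> for the integral of
  \<open>1 + \<bar>n\<bar>\<close>; \<open>W\<close> stands for a velocity bound, assumed where
  orbits are given. The coefficient enters the constants below only through these numbers.\<close>

locale window = oscillator +
  fixes n Nn :: "real \<Rightarrow> real" and lo hi N1 W :: real
  assumes Nn: "primitive_of Nn (\<lambda>t. 1 + \<bar>n t\<bar>)" and N1: "Nn hi - Nn lo \<le> N1"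
    and W_nonneg: "0 \<le> W" and n_loc: "loc_integrable n"
begin

lemma N1_sub: assumes "lo \<le> s" "s \<le> t" "t \<le> hi" shows "Nn t - Nn s \<le> N1" "0 \<le> Nn t - Nn s"
proof -
  have m: "Nn x \<le> Nn y" if "x \<le> y" for x y by (rule primitive_of_nonneg_mono[OF Nn _ that]) simp
  show "Nn t - Nn s \<le> N1" using m[OF assms(1)] m[OF assms(3)] N1 by simp
  show "0 \<le> Nn t - Nn s" using m[OF assms(2)] by simp
qed

definition Q where "Q = B + L * W * N1"

text \<open>As \<open>n\<close> is only integrable, the part bounded by
  \<open>C2 * \<bar>n r\<bar>\<close> yields no factor \<open>\<bar>t - s\<bar>\<close>; in the
  applications \<open>C2\<close> itself has the right order.\<close>

lemma primitive_estimate: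
  assumes x: "primitive_of x \<phi>" and st: "s \<in> {lo..hi}" "t \<in> {lo..hi}" and C: "0 \<le> C2"
    and bd: "\<And>r. min s t \<le> r \<Longrightarrow> r \<le> max s t \<Longrightarrow> \<bar>\<phi> r\<bar> \<le> C1 + C2 * \<bar>n r\<bar>"
  shows "\<bar>x t - x s\<bar> \<le> C1 * \<bar>t - s\<bar> + C2 * N1"
proof -
  have P: "primitive_of (\<lambda>t. C1 * t + C2 * Nn t) (\<lambda>t. C1 * 1 + C2 * (1 + \<bar>n t\<bar>))"
    by (intro primitive_of_add primitive_of_cmult primitive_of_ident Nn)
  have bd': "\<bar>\<phi> r\<bar> \<le> C1 * 1 + C2 * (1 + \<bar>n r\<bar>)" if "min s t \<le> r" "r \<le> max s t" for r
    using bd[OF that] C by (simp add: distrib_left)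
  show ?thesis
  proof (cases "s \<le> t")
    case True
    have "\<bar>x t - x s\<bar> \<le> (C1 * t + C2 * Nn t) - (C1 * s + C2 * Nn s)"
      by (rule primitive_of_abs_le[OF x P True]) (use bd' True in auto)
    moreover have "C2 * (Nn t - Nn s) \<le> C2 * N1"
      using N1_sub[of s t] st True C by (intro mult_left_mono) auto
    ultimately show ?thesis using True by (simp add: algebra_simps)
  next
    case False
    then have ts: "t \<le> s" by simp
    have "\<bar>x s - x t\<bar> \<le> (C1 * s + C2 * Nn s) - (C1 * t + C2 * Nn t)"
      by (rule primitive_of_abs_le[OF x P ts]) (use bd' ts in auto)
    moreover have "C2 * (Nn s - Nn t) \<le> C2 * N1"
      using N1_sub[of t s] st ts C by (intro mult_left_mono) auto
    ultimately show ?thesis using ts by (simp add: algebra_simps abs_minus_commute[of "x t"])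
  qed
qed

text \<open>\<open>f1 (v r)\<close> is at most \<open>L * W\<close> times the time since the
  crossing, so the integral of \<open>n * f1 v\<close> is linear in
  \<open>\<bar>t - \<tau>\<bar>\<close>, although that of \<open>n\<close> need not be.\<close>

lemma near_crossing:
  assumes sol: "solution f0 f1 n v w" and w: "\<And>t. t \<in> {lo..hi} \<Longrightarrow> \<bar>w t\<bar> \<le> W"
    and \<tau>: "v \<tau> = a" "\<tau> \<in> {lo..hi}" and t: "t \<in> {lo..hi}"
  shows "\<bar>v t - a\<bar> \<le> W * \<bar>t - \<tau>\<bar>" "\<bar>w t - w \<tau>\<bar> \<le> Q * \<bar>t - \<tau>\<bar>"
proof -
  have v: "primitive_of v w" and wp: "primitive_of w (\<lambda>t. f0 (v t) + n t * f1 (v t))"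
    using sol by (auto simp: solution_def)
  have 1: "\<bar>v s - a\<bar> \<le> W * \<bar>s - \<tau>\<bar>" if "s \<in> {lo..hi}" for s
  proof -
    have "\<bar>v s - v \<tau>\<bar> \<le> W * \<bar>s - \<tau>\<bar>"
      by (rule primitive_of_abs_le_const[OF v], rule w)
        (use \<tau>(2) that in \<open>auto simp: min_def max_def split: if_splits\<close>)
    then show ?thesis using \<tau>(1) by simp
  qed
  show "\<bar>v t - a\<bar> \<le> W * \<bar>t - \<tau>\<bar>" by (rule 1[OF t])
  have "\<bar>w t - w \<tau>\<bar> \<le> B * \<bar>t - \<tau>\<bar> + (L * W * \<bar>t - \<tau>\<bar>) * N1"
  proof (rule primitive_estimate[OF wp \<tau>(2) t])
    fix r assume r: "min \<tau> t \<le> r" "r \<le> max \<tau> t"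
    have "\<bar>f1 (v r)\<bar> \<le> L * \<bar>v r - a\<bar>" by (rule f1_near_a)
    also have "\<dots> \<le> L * (W * \<bar>r - \<tau>\<bar>)"
    proof -
      have "r \<in> {lo..hi}" using r \<tau>(2) t by (auto simp: min_def max_def split: if_splits)
      then show ?thesis by (rule mult_left_mono[OF 1 L_nonneg])
    qed
    also have "\<dots> \<le> L * (W * \<bar>t - \<tau>\<bar>)"
      using r L_nonneg W_nonneg by (intro mult_left_mono) auto
    finally have f1: "\<bar>n r\<bar> * \<bar>f1 (v r)\<bar> \<le> \<bar>n r\<bar> * (L * (W * \<bar>t - \<tau>\<bar>))" by (rule mult_left_mono) simp
    have "\<bar>f0 (v r) + n r * f1 (v r)\<bar> \<le> \<bar>f0 (v r)\<bar> + \<bar>n r\<bar> * \<bar>f1 (v r)\<bar>"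
      unfolding abs_mult[symmetric] by (rule abs_triangle_ineq)
    then show "\<bar>f0 (v r) + n r * f1 (v r)\<bar> \<le> B + L * W * \<bar>t - \<tau>\<bar> * \<bar>n r\<bar>"
      using f1 f0_bound[of "v r"] by (simp add: mult_ac)
  qed (use L_nonneg W_nonneg in auto)
  then show "\<bar>w t - w \<tau>\<bar> \<le> Q * \<bar>t - \<tau>\<bar>" by (simp add: Q_def algebra_simps)
qed

text \<open>Near the crossing the Lagrangian is \<open>y\<^sup>2 / 2\<close> to leading order:
  \<open>P0\<close> is of order \<open>h\<close>, and \<open>P1\<close> even of order
  \<open>h\<^sup>2\<close>, which makes up for \<open>n\<close> having no pointwise bound. The
  second estimate linearises \<open>v\<close> at the crossing.\<close>

lemma endpoint_variation:
  assumes sol: "solution f0 f1 n v w" and w: "\<And>t. t \<in> {lo..hi} \<Longrightarrow> \<bar>w t\<bar> \<le> W"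
    and S: "primitive_of S (lagrangian n v w)"
    and \<sigma>: "v \<sigma> = a" "\<sigma> \<in> {lo..hi}" and \<tau>: "\<tau> \<in> {lo..hi}"
    and h: "\<bar>\<sigma> - \<tau>\<bar> \<le> h" "\<bar>w \<tau> - y\<bar> \<le> h" and y: "\<bar>y\<bar> \<le> W"
  shows "\<bar>S \<sigma> - S \<tau> - y\<^sup>2 / 2 * (\<sigma> - \<tau>)\<bar> \<le> (W * (2 * Q + 1) + B * W + L * W\<^sup>2 * N1) * h\<^sup>2"
    and "\<bar>y * (v \<tau> - a) + y\<^sup>2 * (\<sigma> - \<tau>)\<bar> \<le> W * (2 * Q + 1) * h\<^sup>2"
proof -
  have v: "primitive_of v w" using sol by (simp add: solution_def)
  have h0: "0 \<le> h" using h by linarith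
  have Q0: "0 \<le> Q"
  proof -
    have "0 \<le> N1" using N1_sub[of \<sigma> \<sigma>] \<sigma> by auto
    then show ?thesis unfolding Q_def using B_nonneg L_nonneg W_nonneg by simp
  qed
  have mem: "r \<in> {lo..hi}" "\<bar>r - \<sigma>\<bar> \<le> h" if "min \<tau> \<sigma> \<le> r" "r \<le> max \<tau> \<sigma>" for r
    using that \<sigma> \<tau> h by (auto simp: min_def max_def split: if_splits)
  have wy: "\<bar>w r - y\<bar> \<le> (2 * Q + 1) * h" if "min \<tau> \<sigma> \<le> r" "r \<le> max \<tau> \<sigma>" for r
  proof -
    have "\<bar>w r - w \<sigma>\<bar> \<le> Q * \<bar>r - \<sigma>\<bar>" "\<bar>w \<tau> - w \<sigma>\<bar> \<le> Q * \<bar>\<tau> - \<sigma>\<bar>"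
      using near_crossing(2)[OF sol w \<sigma>] mem[OF that] \<tau> by blast+
    moreover have "Q * \<bar>r - \<sigma>\<bar> \<le> Q * h" "Q * \<bar>\<tau> - \<sigma>\<bar> \<le> Q * h"
      using mem[OF that] h Q0 by (auto intro!: mult_left_mono)
    ultimately show ?thesis using h(2) by (simp add: algebra_simps)
  qed
  have va: "\<bar>v r - a\<bar> \<le> W * h" if "min \<tau> \<sigma> \<le> r" "r \<le> max \<tau> \<sigma>" for r
  proof -
    have "\<bar>v r - a\<bar> \<le> W * \<bar>r - \<sigma>\<bar>" using near_crossing(1)[OF sol w \<sigma>] mem[OF that] by blast
    also have "\<dots> \<le> W * h" using mem[OF that] W_nonneg by (intro mult_left_mono) auto
    finally show ?thesis .
  qed
  have P: "primitive_of (\<lambda>t. S t - y\<^sup>2 / 2 * t) (\<lambda>t. lagrangian n v w t - y\<^sup>2 / 2 * 1)"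
    by (intro primitive_of_diff S primitive_of_cmult primitive_of_ident)
  have "\<bar>(S \<sigma> - y\<^sup>2 / 2 * \<sigma>) - (S \<tau> - y\<^sup>2 / 2 * \<tau>)\<bar>
      \<le> ((W * (2 * Q + 1) + B * W) * h) * \<bar>\<sigma> - \<tau>\<bar> + (L * (W * h)\<^sup>2) * N1"
  proof (rule primitive_estimate[OF P \<tau> \<sigma>(2)])
    show "0 \<le> L * (W * h)\<^sup>2" using L_nonneg by simp
    fix r assume r: "min \<tau> \<sigma> \<le> r" "r \<le> max \<tau> \<sigma>"
    have "(w r)\<^sup>2 / 2 - y\<^sup>2 / 2 = (w r + y) / 2 * (w r - y)"
      by (simp add: power2_eq_square field_simps)
    then have "\<bar>(w r)\<^sup>2 / 2 - y\<^sup>2 / 2\<bar> = \<bar>w r + y\<bar> / 2 * \<bar>w r - y\<bar>"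
      by (simp only: abs_mult abs_divide abs_numeral)
    also have "\<dots> \<le> W * ((2 * Q + 1) * h)"
      using w[OF mem(1)[OF r]] y wy[OF r] W_nonneg by (intro mult_mono) auto
    finally have 1: "\<bar>(w r)\<^sup>2 / 2 - y\<^sup>2 / 2\<bar> \<le> W * ((2 * Q + 1) * h)" .
    have 2: "\<bar>P0 (v r)\<bar> \<le> B * (W * h)"
      using P0_bound[of "v r"] mult_left_mono[OF va[OF r] B_nonneg] by linarith
    have "(v r - a)\<^sup>2 \<le> (W * h)\<^sup>2" using va[OF r] by (metis abs_ge_zero power2_abs power_mono)
    then have "\<bar>P1 (v r)\<bar> \<le> L * (W * h)\<^sup>2"
      using P1_bound[of "v r"] mult_left_mono[OF _ L_nonneg] by (meson order_trans)
    then have 3: "\<bar>n r * P1 (v r)\<bar> \<le> \<bar>n r\<bar> * (L * (W * h)\<^sup>2)"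
      unfolding abs_mult by (rule mult_left_mono) simp
    have "lagrangian n v w r - y\<^sup>2 / 2 * 1 = ((w r)\<^sup>2 / 2 - y\<^sup>2 / 2) + P0 (v r) + n r * P1 (v r)"
      by (simp add: lagrangian_def)
    then have "\<bar>lagrangian n v w r - y\<^sup>2 / 2 * 1\<bar> \<le> W * ((2 * Q + 1) * h) + B * (W * h) + \<bar>n r\<bar> * (L * (W * h)\<^sup>2)"
      using 1 2 3 by linarith
    then show "\<bar>lagrangian n v w r - y\<^sup>2 / 2 * 1\<bar> \<le> (W * (2 * Q + 1) + B * W) * h + L * (W * h)\<^sup>2 * \<bar>n r\<bar>"
      by (simp add: algebra_simps)
  qed
  also have "\<dots> \<le> ((W * (2 * Q + 1) + B * W) * h) * h + (L * (W * h)\<^sup>2) * N1"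
    using h h0 Q0 W_nonneg B_nonneg by (intro add_right_mono mult_left_mono) auto
  also have "\<dots> = (W * (2 * Q + 1) + B * W + L * W\<^sup>2 * N1) * h\<^sup>2"
    by (simp add: power2_eq_square algebra_simps)
  finally show "\<bar>S \<sigma> - S \<tau> - y\<^sup>2 / 2 * (\<sigma> - \<tau>)\<bar> \<le> (W * (2 * Q + 1) + B * W + L * W\<^sup>2 * N1) * h\<^sup>2"
    by (simp only: right_diff_distrib diff_diff_eq2 diff_diff_eq add.commute diff_add_eq)
  have P2: "primitive_of (\<lambda>t. v t - y * t) (\<lambda>t. w t - y * 1)"
    by (intro primitive_of_diff v primitive_of_cmult primitive_of_ident)
  have "\<bar>(v \<sigma> - y * \<sigma>) - (v \<tau> - y * \<tau>)\<bar> \<le> ((2 * Q + 1) * h) * \<bar>\<sigma> - \<tau>\<bar>"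
    by (rule primitive_of_abs_le_const[OF P2]) (use wy in auto)
  also have "\<dots> \<le> ((2 * Q + 1) * h) * h" using h h0 Q0 by (intro mult_left_mono) auto
  finally have 4: "\<bar>(v \<tau> - a) + y * (\<sigma> - \<tau>)\<bar> \<le> (2 * Q + 1) * h\<^sup>2"
    using \<sigma> by (simp add: power2_eq_square algebra_simps abs_if split: if_splits)
  have "\<bar>y * (v \<tau> - a) + y\<^sup>2 * (\<sigma> - \<tau>)\<bar> = \<bar>y\<bar> * \<bar>(v \<tau> - a) + y * (\<sigma> - \<tau>)\<bar>"
    unfolding abs_mult[symmetric] by (simp add: power2_eq_square algebra_simps)
  also have "\<dots> \<le> W * ((2 * Q + 1) * h\<^sup>2)" using 4 y W_nonneg by (intro mult_mono) auto
  finally show "\<bar>y * (v \<tau> - a) + y\<^sup>2 * (\<sigma> - \<tau>)\<bar> \<le> W * (2 * Q + 1) * h\<^sup>2" by (simp add: mult.assoc)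
qed

text \<open>First variation with endpoints on the section. At the end \<open>t1\<close>, moving the
  endpoint contributes half of \<open>w\<^sup>2\<close> times the time shift, and the boundary term
  minus the whole of it, which leaves \<open>- w\<^sup>2 / 2\<close>; at \<open>t0\<close> the
  orientation is opposite.\<close>

lemma action_variation:
  assumes sol: "solution f0 f1 n v w" and w: "\<And>t. t \<in> {lo..hi} \<Longrightarrow> \<bar>w t\<bar> \<le> W"
    and sol': "solution f0 f1 n v' w'" and w': "\<And>t. t \<in> {lo..hi} \<Longrightarrow> \<bar>w' t\<bar> \<le> W"
    and S: "primitive_of S (lagrangian n v w)" and S': "primitive_of S' (lagrangian n v' w')"
    and t: "v t0 = a" "v t1 = a" "t0 \<in> {lo..hi}" "t1 \<in> {lo..hi}"
    and s: "v' s0 = a" "v' s1 = a" "s0 \<in> {lo..hi}" "s1 \<in> {lo..hi}"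
    and h: "\<bar>s0 - t0\<bar> \<le> h" "\<bar>s1 - t1\<bar> \<le> h"
    and dv: "\<And>t. t \<in> {lo..hi} \<Longrightarrow> \<bar>v' t - v t\<bar> \<le> h" and dw: "\<And>t. t \<in> {lo..hi} \<Longrightarrow> \<bar>w' t - w t\<bar> \<le> h"
    and le: "t1 - t0 \<le> N1" "t0 \<le> t1"
  shows "\<bar>(S' s1 - S' s0) - (S t1 - S t0) - ((w t0)\<^sup>2 / 2 * (s0 - t0) - (w t1)\<^sup>2 / 2 * (s1 - t1))\<bar>
    \<le> ((1 + 2 * L) * N1 + 2 * (W * (2 * Q + 1) + B * W + L * W\<^sup>2 * N1) + 2 * (W * (2 * Q + 1))) * h\<^sup>2"
proof -
  have v: "primitive_of v w" and wp: "primitive_of w (\<lambda>t. f0 (v t) + n t * f1 (v t))"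
    and v': "primitive_of v' w'" using sol sol' by (auto simp: solution_def)
  \<comment> \<open>Subtracting the boundary term integrates by parts: the equation of motion
    cancels everything linear in \<open>v' - v\<close> and \<open>w' - w\<close> from the
    density.\<close>
  define D where "D t = S' t - S t - w t * (v' t - v t)" for t
  define \<phi> where "\<phi> t = (w' t - w t)\<^sup>2 / 2 + (P0 (v' t) - P0 (v t) - f0 (v t) * (v' t - v t))
      + n t * (P1 (v' t) - P1 (v t) - f1 (v t) * (v' t - v t))" for t
  have "primitive_of D (\<lambda>t. lagrangian n v' w' t - lagrangian n v w t
      - ((f0 (v t) + n t * f1 (v t)) * (v' t - v t) + w t * (w' t - w t)))"
    unfolding D_def by (intro primitive_of_diff S S' primitive_of_mult wp v v')
  then have D: "primitive_of D \<phi>"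
    by (rule primitive_of_cong_density) (simp add: \<phi>_def lagrangian_def power2_eq_square field_simps)
  have h0: "0 \<le> h" using h by linarith
  have "\<bar>D t1 - D t0\<bar> \<le> ((1 / 2 + L) * h\<^sup>2) * \<bar>t1 - t0\<bar> + (L * h\<^sup>2) * N1"
  proof (rule primitive_estimate[OF D t(3,4)])
    show "0 \<le> L * h\<^sup>2" using L_nonneg by simp
    fix r assume "min t0 t1 \<le> r" "r \<le> max t0 t1"
    then have r: "r \<in> {lo..hi}" using t by auto
    have q: "(w' r - w r)\<^sup>2 \<le> h\<^sup>2" "(v' r - v r)\<^sup>2 \<le> h\<^sup>2"
      using dw[OF r] dv[OF r] by (metis abs_ge_zero power2_abs power_mono)+
    have 1: "\<bar>P0 (v' r) - P0 (v r) - f0 (v r) * (v' r - v r)\<bar> \<le> L * h\<^sup>2"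
      using P0_taylor[of "v' r" "v r"] mult_left_mono[OF q(2) L_nonneg] by linarith
    have "\<bar>P1 (v' r) - P1 (v r) - f1 (v r) * (v' r - v r)\<bar> \<le> L * h\<^sup>2"
      using P1_taylor[of "v' r" "v r"] mult_left_mono[OF q(2) L_nonneg] by linarith
    then have 2: "\<bar>n r * (P1 (v' r) - P1 (v r) - f1 (v r) * (v' r - v r))\<bar> \<le> \<bar>n r\<bar> * (L * h\<^sup>2)"
      unfolding abs_mult by (rule mult_left_mono) simp
    have 3: "\<bar>(w' r - w r)\<^sup>2 / 2\<bar> \<le> h\<^sup>2 / 2" using q(1) by simp
    have "\<bar>\<phi> r\<bar> \<le> h\<^sup>2 / 2 + L * h\<^sup>2 + \<bar>n r\<bar> * (L * h\<^sup>2)"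
      unfolding \<phi>_def using 1 2 3 by linarith
    then show "\<bar>\<phi> r\<bar> \<le> (1 / 2 + L) * h\<^sup>2 + L * h\<^sup>2 * \<bar>n r\<bar>" by (simp add: algebra_simps)
  qed
  also have "\<dots> \<le> ((1 / 2 + L) * h\<^sup>2) * N1 + (L * h\<^sup>2) * N1"
    using le L_nonneg by (intro add_right_mono mult_left_mono) auto
  also have "\<dots> \<le> (1 + 2 * L) * N1 * h\<^sup>2"
  proof -
    have "0 \<le> N1 * h\<^sup>2" using le by simp
    then show ?thesis by (simp add: algebra_simps)
  qed
  finally have mid: "\<bar>D t1 - D t0\<bar> \<le> (1 + 2 * L) * N1 * h\<^sup>2" .
  note e1 = endpoint_variation[OF sol' w' S' s(2,4) t(4) h(2) dw[OF t(4)] w[OF t(4)]]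
  note e0 = endpoint_variation[OF sol' w' S' s(1,3) t(3) h(1) dw[OF t(3)] w[OF t(3)]]
  let ?c = "W * (2 * Q + 1) + B * W + L * W\<^sup>2 * N1" let ?d = "W * (2 * Q + 1)"
  \<comment> \<open>An exact identity, as \<open>v t0 = v t1 = a\<close> turns the boundary terms of
    \<open>D\<close> into \<open>w * (v' - a)\<close>.\<close>
  have "(S' s1 - S' s0) - (S t1 - S t0) - ((w t0)\<^sup>2 / 2 * (s0 - t0) - (w t1)\<^sup>2 / 2 * (s1 - t1))
     = (D t1 - D t0) + (S' s1 - S' t1 - (w t1)\<^sup>2 / 2 * (s1 - t1)) - (S' s0 - S' t0 - (w t0)\<^sup>2 / 2 * (s0 - t0))
       + (w t1 * (v' t1 - a) + (w t1)\<^sup>2 * (s1 - t1)) - (w t0 * (v' t0 - a) + (w t0)\<^sup>2 * (s0 - t0))"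
    using t by (simp add: D_def field_simps)
  then have "\<bar>(S' s1 - S' s0) - (S t1 - S t0) - ((w t0)\<^sup>2 / 2 * (s0 - t0) - (w t1)\<^sup>2 / 2 * (s1 - t1))\<bar>
    \<le> (1 + 2 * L) * N1 * h\<^sup>2 + ?c * h\<^sup>2 + ?c * h\<^sup>2 + ?d * h\<^sup>2 + ?d * h\<^sup>2"
    using mid e1 e0 by linarith
  then show ?thesis by (simp add: algebra_simps)
qed

end

section \<open>The return map of the perturbed equation\<close>

lemma solution_derivative:
  assumes "solution f0 f1 m v w"
  shows "(v has_real_derivative w t) (at t)"
  using assms primitive_of_has_derivative primitive_of_continuous by (auto simp: solution_def)

text \<open>\<open>Zv p\<close> and \<open>Zw p\<close> describe the orbit of the equation with
  constant coefficient \<open>c\<close>, and \<open>T p\<close> is its period.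
  \<open>M * T p1 < \<beta> < T p2\<close> is the twist for all winding numbers at once: it implies
  \<open>j * T p1 < \<beta> < j * T p2\<close> for \<open>1 \<le> j \<le> M\<close>.\<close>

locale near_autonomous = oscillator +
  fixes c \<beta> p1 p2 l r :: real and M :: nat and T :: "real \<Rightarrow> real" and Zv Zw :: "real \<Rightarrow> real \<Rightarrow> real"
  assumes beta_pos: "0 < \<beta>" and c_nonneg: "0 \<le> c" and p1_pos: "0 < p1" and p1_less: "p1 < p2"
    and T_cont: "continuous_on {p1..p2} T" and T_pos: "p \<in> {p1..p2} \<Longrightarrow> 0 < T p"
    and T1: "real M * T p1 < \<beta>" and T2: "\<beta> < T p2"
    and Z_sol: "solution f0 f1 (\<lambda>_. c) (Zv p) (Zw p)" and Z_init: "Zv p 0 = a" "Zw p 0 = p"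
    and Z_period: "p \<in> {p1..p2} \<Longrightarrow> Zv p (t + real j * T p) = Zv p t"
      "p \<in> {p1..p2} \<Longrightarrow> Zw p (t + real j * T p) = Zw p t"
    and Z_range: "p \<in> {p1..p2} \<Longrightarrow> l \<le> Zv p t \<and> Zv p t \<le> r"
begin

definition Tmax :: real where "Tmax = (SOME m. \<forall>p\<in>{p1..p2}. T p \<le> m)"

lemma Tmax: "p \<in> {p1..p2} \<Longrightarrow> T p \<le> Tmax"
proof -
  obtain x where "x \<in> {p1..p2}" "\<forall>p\<in>{p1..p2}. T p \<le> T x"
    using continuous_attains_sup[OF _ _ T_cont] p1_less by auto
  then have "\<exists>m. \<forall>p\<in>{p1..p2}. T p \<le> m" by blast
  from someI_ex[OF this] have "\<forall>p\<in>{p1..p2}. T p \<le> Tmax" unfolding Tmax_def .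
  then show "p \<in> {p1..p2} \<Longrightarrow> T p \<le> Tmax" by blast
qed

lemma Tmax_pos: "0 < Tmax"
  using Tmax[of p1] T_pos[of p1] p1_less by simp

lemma jT_le: "p \<in> {p1..p2} \<Longrightarrow> j \<le> M \<Longrightarrow> real j * T p \<le> real M * Tmax"
  using Tmax[of p] T_pos[of p] by (intro mult_mono) auto

text \<open>\<open>D\<close> covers \<open>M\<close> returns, one period \<open>\<beta>\<close> and
  a margin for shifted start times. Over such a time \<open>N1\<close> bounds the integral of
  \<open>1 + \<bar>n\<bar>\<close>, \<open>W\<close> the velocity, \<open>Ex\<close> the Gronwall
  factor and \<open>Qc\<close> the change of velocity near a crossing. \<open>CL\<close>,
  \<open>Ct\<close>, \<open>Cw\<close> are Lipschitz constants of the flow, the return time and the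
  return velocity, and \<open>\<epsilon> * Cm\<close> will be that of the energy drift. None depends
  on \<open>n\<close>, so \<open>\<epsilon>\<close> can be chosen after them.\<close>

definition D where "D = real M * Tmax + 4 + \<beta>"
definition N1 where "N1 = (1 + c) * D + 1"
definition W where "W = p2 + B * N1"
definition Ex where "Ex = exp ((1 + L) * N1)"
definition Qc where "Qc = B + L * W * N1"
definition CL where "CL = Ex * (W + Qc + 1)"
definition Ct where "Ct = 2 / p1 * CL"
definition Cw where "Cw = Qc * Ct + CL"
definition Cm where "Cm = (L * W + B) * CL + L * W * W * Ct"

lemma D_pos: "4 \<le> D" using Tmax_pos beta_pos by (simp add: D_def)
lemma N1_pos: "0 < N1" "D \<le> N1"
proof -
  have "0 \<le> c * D" using c_nonneg D_pos by simp
  then show "0 < N1" "D \<le> N1" using D_pos by (auto simp: N1_def algebra_simps)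
qed
lemma W_pos: "0 < W" using p1_pos p1_less B_nonneg N1_pos by (simp add: W_def add_pos_nonneg)
lemma Ex_pos: "0 < Ex" by (simp add: Ex_def)
lemma Qc_nonneg: "0 \<le> Qc" using B_nonneg L_nonneg W_pos N1_pos by (simp add: Qc_def)
lemma CL_pos: "0 < CL" using Ex_pos W_pos Qc_nonneg by (simp add: CL_def)
lemma Ct_pos: "0 < Ct" using CL_pos p1_pos by (simp add: Ct_def)
lemma Cw_pos: "0 < Cw" using CL_pos Ct_pos Qc_nonneg by (simp add: Cw_def add_nonneg_pos)

end

text \<open>\<open>\<eta>\<close> is the half-width of the time windows around
  \<open>t0 + j * T p\<close> in which returns are located: small against the twist on both edges,
  and such that the unperturbed velocity is at least \<open>3 * p1 / 4\<close> there.
  \<open>\<epsilon>\<close> keeps perturbed orbits so close that each window contains exactly one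
  return and the return energy still increases with \<open>p\<close>.\<close>

locale perturbation = near_autonomous +
  fixes \<eta> \<epsilon> :: real and n Nn :: "real \<Rightarrow> real"
  assumes eta: "0 < \<eta>" "\<eta> \<le> 1" "\<eta> < \<beta> - real M * T p1" "\<eta> < T p2 - \<beta>" "B * (1 + c) * \<eta> \<le> p1 / 4"
    and eta_T: "p \<in> {p1..p2} \<Longrightarrow> \<eta> < T p"
    and eps: "0 < \<epsilon>" "\<epsilon> \<le> 1" "B * \<epsilon> * Ex < p1 * \<eta> / 4" "\<epsilon> * Cm \<le> p1 / 2"
    and n_loc: "loc_integrable n" and n_periodic: "n (t + \<beta>) = n t"
    and n_close: "s \<le> t \<Longrightarrow> t - s \<le> D \<Longrightarrow> integral {s..t} (\<lambda>x. \<bar>n x - c\<bar>) \<le> \<epsilon>"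
    and Nn: "primitive_of Nn (\<lambda>t. 1 + \<bar>n t\<bar>)"
begin

lemma n_diff_loc: "loc_integrable (\<lambda>t. \<bar>n t - c\<bar>)"
  by (intro loc_integrable_abs loc_integrable_diff n_loc) simp

lemma N1_bound:
  assumes "s \<le> t" "t - s \<le> D" shows "Nn t - Nn s \<le> N1"
proof -
  obtain Dn where Dn: "primitive_of Dn (\<lambda>t. \<bar>n t - c\<bar>)" using primitive_of_exists[OF n_diff_loc] by blast
  have "Nn t - Nn s \<le> ((1 + c) * t + Dn t) - ((1 + c) * s + Dn s)"
  proof (rule primitive_of_mono[OF Nn primitive_of_add[OF primitive_of_cmult[OF primitive_of_ident] Dn] assms(1)])
    show "1 + \<bar>n x\<bar> \<le> (1 + c) * 1 + \<bar>n x - c\<bar>" for x using c_nonneg by simp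
  qed
  moreover have "Dn t - Dn s \<le> \<epsilon>" using primitive_ofD[OF Dn assms(1)] n_close[OF assms] by simp
  moreover have "(1 + c) * (t - s) \<le> (1 + c) * D" using assms c_nonneg by (intro mult_left_mono) auto
  ultimately show ?thesis using eps(2) by (simp add: N1_def algebra_simps)
qed

lemma Nn_mono: "s \<le> t \<Longrightarrow> Nn s \<le> Nn t"
  by (rule primitive_of_nonneg_mono[OF Nn]) auto

lemma Nn_diff: "\<bar>t - s\<bar> \<le> D \<Longrightarrow> \<bar>Nn t - Nn s\<bar> \<le> N1"
  using N1_bound[of s t] N1_bound[of t s] Nn_mono[of s t] Nn_mono[of t s] by linarith

lemma window: "hi - lo \<le> D \<Longrightarrow> lo \<le> hi \<Longrightarrow> window f0 f1 B L P0 P1 a n Nn lo hi N1 W"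
  using Nn N1_bound[of lo hi] W_pos n_loc
  by (intro window.intro window_axioms.intro oscillator_axioms) auto

definition flow :: "real \<Rightarrow> real \<Rightarrow> (real \<Rightarrow> real) \<times> (real \<Rightarrow> real)" where
  "flow t0 p = (SOME u. solution f0 f1 n (fst u) (snd u) \<and> fst u t0 = a \<and> snd u t0 = p)"
definition uv :: "real \<Rightarrow> real \<Rightarrow> real \<Rightarrow> real" where "uv t0 p = fst (flow t0 p)"
definition uw :: "real \<Rightarrow> real \<Rightarrow> real \<Rightarrow> real" where "uw t0 p = snd (flow t0 p)"

lemma u_sol: "solution f0 f1 n (uv t0 p) (uw t0 p)" and u_init: "uv t0 p t0 = a" "uw t0 p t0 = p"
proof -
  have "\<exists>u. solution f0 f1 n (fst u) (snd u) \<and> fst u t0 = a \<and> snd u t0 = p"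
    using solution_exists[OF n_loc, of t0 a p] by auto
  from someI_ex[OF this, folded flow_def]
  show "solution f0 f1 n (uv t0 p) (uw t0 p)" "uv t0 p t0 = a" "uw t0 p t0 = p" by (auto simp: uv_def uw_def)
qed

lemma u_prim: "primitive_of (uv t0 p) (uw t0 p)"
    "primitive_of (uw t0 p) (\<lambda>t. f0 (uv t0 p t) + n t * f1 (uv t0 p t))"
  using u_sol by (auto simp: solution_def)

lemma u_shift: "uv (t0 + \<beta>) p (t + \<beta>) = uv t0 p t" "uw (t0 + \<beta>) p (t + \<beta>) = uw t0 p t"
proof -
  have "solution f0 f1 n (\<lambda>t. uv (t0 + \<beta>) p (t + \<beta>)) (\<lambda>t. uw (t0 + \<beta>) p (t + \<beta>))"
    using solution_shift[OF u_sol[of "t0 + \<beta>" p], of \<beta>] by (simp add: n_periodic)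
  from solution_unique[OF n_loc this u_sol[of t0 p], of t0 t]
  show "uv (t0 + \<beta>) p (t + \<beta>) = uv t0 p t" "uw (t0 + \<beta>) p (t + \<beta>) = uw t0 p t"
    by (auto simp: u_init)
qed

lemma w_bound:
  assumes "p \<in> {p1..p2}" "\<bar>t - t0\<bar> \<le> D" shows "\<bar>uw t0 p t\<bar> \<le> W"
proof -
  have P: "primitive_of (\<lambda>t. B * Nn t) (\<lambda>t. B * (1 + \<bar>n t\<bar>))" by (rule primitive_of_cmult[OF Nn])
  have *: "\<bar>uw t0 p x - uw t0 p y\<bar> \<le> B * \<bar>Nn x - Nn y\<bar>" if "y \<le> x" for x y
    using primitive_of_abs_le[OF u_prim(2) P that rhs_bound] Nn_mono[OF that]
    by (simp add: right_diff_distrib)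
  have "\<bar>uw t0 p t - uw t0 p t0\<bar> \<le> B * \<bar>Nn t - Nn t0\<bar>"
    using *[of t0 t] *[of t t0] by (cases "t0 \<le> t") (auto simp: abs_minus_commute)
  also have "\<dots> \<le> B * N1" using Nn_diff[OF assms(2)] B_nonneg by (rule mult_left_mono)
  finally have "\<bar>uw t0 p t - p\<bar> \<le> B * N1" by (simp add: u_init)
  moreover have "\<bar>p\<bar> \<le> p2" using assms(1) p1_pos by simp
  ultimately show ?thesis unfolding W_def by linarith
qed

text \<open>The constant-coefficient orbit is listed first in \<open>solution_compare\<close>, so
  that the Gronwall factor involves \<open>c\<close> and not \<open>n\<close>.\<close>

lemma close:
  assumes "\<bar>t - t0\<bar> \<le> D"
  shows "\<bar>uv t0 p t - Zv p (t - t0)\<bar> + \<bar>uw t0 p t - Zw p (t - t0)\<bar> \<le> B * \<epsilon> * Ex"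
proof -
  have Z: "solution f0 f1 (\<lambda>_. c) (\<lambda>t. Zv p (t - t0)) (\<lambda>t. Zw p (t - t0))"
    using solution_shift[OF Z_sol[of p], of "- t0"] by simp
  obtain Dn where Dn: "primitive_of Dn (\<lambda>t. \<bar>c - n t\<bar>)"
    using primitive_of_exists[OF n_diff_loc] by (auto simp: abs_minus_commute)
  have K: "primitive_of (\<lambda>t. (1 + L) * (1 + \<bar>c\<bar>) * t) (\<lambda>t. (1 + L) * (1 + \<bar>c\<bar>))"
    using primitive_of_cmult[OF primitive_of_ident, of "(1 + L) * (1 + \<bar>c\<bar>)"] by simp
  have "Dn x - Dn y \<le> \<epsilon> \<and> 0 \<le> Dn x - Dn y" if "y \<le> x" "x - y \<le> D" for x y
    using primitive_ofD[OF Dn that(1)] n_close[OF that] primitive_of_nonneg_mono[OF Dn _ that(1)]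
    by (simp add: abs_minus_commute)
  from this[of t0 t] this[of t t0] have Dt: "\<bar>Dn t - Dn t0\<bar> \<le> \<epsilon>" using assms by (cases "t0 \<le> t") auto
  have "\<bar>Zv p (t - t0) - uv t0 p t\<bar> + \<bar>Zw p (t - t0) - uw t0 p t\<bar>
      \<le> (B * \<bar>Dn t - Dn t0\<bar>) * exp \<bar>(1 + L) * (1 + \<bar>c\<bar>) * t - (1 + L) * (1 + \<bar>c\<bar>) * t0\<bar>"
    using solution_compare[OF Z u_sol[of t0 p] K Dn, of t t0] by (simp add: Z_init u_init)
  also have "\<dots> \<le> (B * \<epsilon>) * Ex"
  proof (rule mult_mono)
    show "B * \<bar>Dn t - Dn t0\<bar> \<le> B * \<epsilon>" using Dt B_nonneg by (rule mult_left_mono)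
    have "(1 + L) * (1 + \<bar>c\<bar>) * t - (1 + L) * (1 + \<bar>c\<bar>) * t0 = (1 + L) * ((1 + c) * (t - t0))"
      using c_nonneg by (simp add: algebra_simps)
    then have "\<bar>(1 + L) * (1 + \<bar>c\<bar>) * t - (1 + L) * (1 + \<bar>c\<bar>) * t0\<bar> = (1 + L) * ((1 + c) * \<bar>t - t0\<bar>)"
      using L_nonneg c_nonneg by (simp add: abs_mult)
    also have "\<dots> \<le> (1 + L) * N1"
    proof (rule mult_left_mono)
      have "(1 + c) * \<bar>t - t0\<bar> \<le> (1 + c) * D" using assms c_nonneg by (intro mult_left_mono) auto
      then show "(1 + c) * \<bar>t - t0\<bar> \<le> N1" by (simp add: N1_def)
    qed (use L_nonneg in simp)
    finally show "exp \<bar>(1 + L) * (1 + \<bar>c\<bar>) * t - (1 + L) * (1 + \<bar>c\<bar>) * t0\<bar> \<le> Ex" by (simp add: Ex_def)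
  qed (use B_nonneg eps in auto)
  finally show ?thesis by (simp add: abs_minus_commute)
qed

lemma u_near_crossing:
  assumes q: "q \<in> {p1..p2}" and J: "hi - lo \<le> D" "s0 - D \<le> lo" "hi \<le> s0 + D"
    and \<tau>: "uv s0 q \<tau> = a" "\<tau> \<in> {lo..hi}" and t: "t \<in> {lo..hi}"
  shows "\<bar>uv s0 q t - a\<bar> \<le> W * \<bar>t - \<tau>\<bar>" "\<bar>uw s0 q t - uw s0 q \<tau>\<bar> \<le> Qc * \<bar>t - \<tau>\<bar>"
proof -
  interpret window f0 f1 B L P0 P1 a n Nn lo hi N1 W
    by (rule window) (use J \<tau> in auto)
  have wb: "\<bar>uw s0 q x\<bar> \<le> W" if "x \<in> {lo..hi}" for x
    by (rule w_bound[OF q]) (use that J in auto)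
  have Qeq: "Q = Qc" by (simp add: Q_def Qc_def)
  show "\<bar>uv s0 q t - a\<bar> \<le> W * \<bar>t - \<tau>\<bar>" "\<bar>uw s0 q t - uw s0 q \<tau>\<bar> \<le> Qc * \<bar>t - \<tau>\<bar>"
    using near_crossing[OF u_sol[of s0 q] wb \<tau> t] by (simp_all add: Qeq)
qed

text \<open>By \<open>u_near_crossing\<close>, the orbit started at \<open>s0\<close> is at time
  \<open>t0\<close> still within a multiple of \<open>\<bar>s0 - t0\<bar>\<close> of the section and
  of its initial velocity. From \<open>t0\<close> on, Gronwall compares two solutions of the same
  equation.\<close>

lemma flow_lipschitz:
  assumes p: "p \<in> {p1..p2}" "q \<in> {p1..p2}" and s: "\<bar>s0 - t0\<bar> \<le> 1"
    and t: "t0 - 2 \<le> t" "t \<le> t0 + real M * Tmax + 2"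
  shows "\<bar>uv s0 q t - uv t0 p t\<bar> + \<bar>uw s0 q t - uw t0 p t\<bar> \<le> CL * (\<bar>s0 - t0\<bar> + \<bar>q - p\<bar>)"
proof -
  have MT: "0 \<le> real M * Tmax" using Tmax_pos by simp
  have J: "(t0 + real M * Tmax + 2) - (t0 - 2) \<le> D" "s0 - D \<le> t0 - 2" "t0 + real M * Tmax + 2 \<le> s0 + D"
    using s beta_pos MT by (auto simp: D_def)
  have m: "s0 \<in> {t0 - 2..t0 + real M * Tmax + 2}" "t0 \<in> {t0 - 2..t0 + real M * Tmax + 2}"
    using s MT by auto
  have 1: "\<bar>uv s0 q t0 - a\<bar> \<le> W * \<bar>t0 - s0\<bar>" "\<bar>uw s0 q t0 - q\<bar> \<le> Qc * \<bar>t0 - s0\<bar>"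
    using u_near_crossing[OF p(2) J u_init(1) m] by (simp_all add: u_init)
  have K: "primitive_of (\<lambda>t. (1 + L) * Nn t) (\<lambda>t. (1 + L) * (1 + \<bar>n t\<bar>))" by (rule primitive_of_cmult[OF Nn])
  have D0: "primitive_of (\<lambda>t. 0) (\<lambda>t. \<bar>n t - n t\<bar>)"
    using primitive_of_cmult[OF primitive_of_ident, of 0] by simp
  have "\<bar>uv s0 q t - uv t0 p t\<bar> + \<bar>uw s0 q t - uw t0 p t\<bar>
      \<le> (\<bar>uv s0 q t0 - a\<bar> + \<bar>uw s0 q t0 - p\<bar>) * exp \<bar>(1 + L) * Nn t - (1 + L) * Nn t0\<bar>"
    using solution_compare[OF u_sol[of s0 q] u_sol[of t0 p] K D0, of t t0] by (simp add: u_init)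
  also have "\<dots> \<le> ((W + Qc + 1) * (\<bar>s0 - t0\<bar> + \<bar>q - p\<bar>)) * Ex"
  proof (rule mult_mono)
    have "\<bar>uv s0 q t0 - a\<bar> + \<bar>uw s0 q t0 - p\<bar> \<le> W * \<bar>s0 - t0\<bar> + Qc * \<bar>s0 - t0\<bar> + \<bar>q - p\<bar>"
      using 1 by (simp add: abs_minus_commute)
    also have "\<dots> \<le> (W + Qc + 1) * (\<bar>s0 - t0\<bar> + \<bar>q - p\<bar>)"
    proof -
      have "0 \<le> \<bar>s0 - t0\<bar> + (W + Qc) * \<bar>q - p\<bar>" using W_pos Qc_nonneg by simp
      then show ?thesis by (simp add: algebra_simps)
    qed
    finally show "\<bar>uv s0 q t0 - a\<bar> + \<bar>uw s0 q t0 - p\<bar> \<le> (W + Qc + 1) * (\<bar>s0 - t0\<bar> + \<bar>q - p\<bar>)" .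
    have "\<bar>(1 + L) * Nn t - (1 + L) * Nn t0\<bar> = (1 + L) * \<bar>Nn t - Nn t0\<bar>"
      using L_nonneg by (simp add: right_diff_distrib[symmetric] abs_mult)
    also have "\<dots> \<le> (1 + L) * N1"
      using Nn_diff[of t t0] t beta_pos MT L_nonneg by (intro mult_left_mono) (auto simp: D_def)
    finally show "exp \<bar>(1 + L) * Nn t - (1 + L) * Nn t0\<bar> \<le> Ex" by (simp add: Ex_def)
  qed (use W_pos Qc_nonneg in auto)
  finally show ?thesis by (simp add: CL_def mult_ac)
qed

lemma Zw_near:
  assumes p: "p \<in> {p1..p2}" and s: "\<bar>s - real j * T p\<bar> \<le> \<eta>"
  shows "3 * p1 / 4 \<le> Zw p s"
proof -
  have P: "primitive_of (Zw p) (\<lambda>t. f0 (Zv p t) + c * f1 (Zv p t))" using Z_sol by (simp add: solution_def)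
  have "\<bar>Zw p (s - real j * T p) - Zw p 0\<bar> \<le> B * (1 + c) * \<bar>(s - real j * T p) - 0\<bar>"
    by (rule primitive_of_abs_le_const[OF P]) (use rhs_bound[of _ c] c_nonneg in auto)
  also have "\<dots> \<le> B * (1 + c) * \<eta>" using s B_nonneg c_nonneg by (intro mult_left_mono) auto
  also have "\<dots> \<le> p1 / 4" by (rule eta(5))
  finally have "\<bar>Zw p (s - real j * T p) - p\<bar> \<le> p1 / 4" by (simp add: Z_init)
  moreover have "Zw p (s - real j * T p) = Zw p s" using Z_period(2)[OF p, of "s - real j * T p" j] by simp
  ultimately show ?thesis using p by (auto simp: abs_if split: if_splits)
qed

lemma window_range:
  assumes "p \<in> {p1..p2}" "j \<le> M" "\<bar>t - (t0 + real j * T p)\<bar> \<le> \<eta>"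
  shows "t0 - 1 \<le> t" "t \<le> t0 + real M * Tmax + 1" "\<bar>t - t0\<bar> \<le> D"
proof -
  have "0 \<le> real j * T p" using T_pos[OF assms(1)] by simp
  then show 1: "t0 - 1 \<le> t" "t \<le> t0 + real M * Tmax + 1" using jT_le[OF assms(1,2)] assms(3) eta(2) by auto
  then show "\<bar>t - t0\<bar> \<le> D" using beta_pos Tmax_pos by (simp add: D_def abs_if)
qed

lemma uw_window:
  assumes p: "p \<in> {p1..p2}" and j: "j \<le> M" and t: "\<bar>t - (t0 + real j * T p)\<bar> \<le> \<eta>"
  shows "p1 / 2 \<le> uw t0 p t"
proof -
  have "3 * p1 / 4 \<le> Zw p (t - t0)" by (rule Zw_near[OF p, of _ j]) (use t in \<open>simp add: algebra_simps\<close>)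
  moreover have "\<bar>uw t0 p t - Zw p (t - t0)\<bar> \<le> B * \<epsilon> * Ex"
    using close[OF window_range(3)[OF p j t], of p] by linarith
  moreover have "p1 * \<eta> / 4 \<le> p1 / 4" using eta p1_pos by simp
  ultimately show ?thesis using eps(3) by (simp add: abs_if split: if_splits)
qed

text \<open>Within time \<open>3 * \<eta> / 8\<close> the unperturbed orbit moves away from
  \<open>a\<close> by at least \<open>9 * p1 * \<eta> / 32\<close>, more than the perturbation
  error, which is below \<open>p1 * \<eta> / 4\<close>. Hence \<open>uv t0 p - a\<close> changes
  sign inside the window of half-width \<open>\<eta> / 2\<close>.\<close>

lemma crossing_exists:
  assumes p: "p \<in> {p1..p2}" and j: "j \<le> M"
  shows "\<exists>t. \<bar>t - (t0 + real j * T p)\<bar> < \<eta> / 2 \<and> uv t0 p t = a"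
proof -
  define \<tau> where "\<tau> = t0 + real j * T p"
  have Zd: "(Zv p has_real_derivative Zw p s) (at s)" for s by (rule solution_derivative[OF Z_sol])
  have Zj: "Zv p (real j * T p) = a" using Z_period(1)[OF p, of 0 j] by (simp add: Z_init)
  have up: "3 * p1 / 4 * (x - y) \<le> Zv p x - Zv p y"
    if "y \<le> x" "real j * T p - \<eta> \<le> y" "x \<le> real j * T p + \<eta>" for x y
  proof -
    have "Zv p y - 3 * p1 / 4 * y \<le> Zv p x - 3 * p1 / 4 * x"
    proof (rule DERIV_nonneg_imp_nondecreasing[OF that(1)])
      fix s assume s: "y \<le> s" "s \<le> x"
      have "((\<lambda>s. Zv p s - 3 * p1 / 4 * s) has_real_derivative Zw p s - 3 * p1 / 4) (at s)"
        using Zd[of s] by (auto intro!: derivative_eq_intros)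
      moreover have "3 * p1 / 4 \<le> Zw p s" by (rule Zw_near[OF p, of _ j]) (use s that in auto)
      ultimately show "\<exists>z. ((\<lambda>s. Zv p s - 3 * p1 / 4 * s) has_real_derivative z) (at s) \<and> 0 \<le> z"
        by (intro exI[of _ "Zw p s - 3 * p1 / 4"]) simp
    qed
    then show ?thesis unfolding right_diff_distrib by argo
  qed
  have e3: "\<bar>uv t0 p t - Zv p (t - t0)\<bar> < p1 * \<eta> / 4" if "\<bar>t - \<tau>\<bar> \<le> \<eta>" for t
    using close[OF window_range(3)[OF p j that[unfolded \<tau>_def]], of p] eps(3) by linarith
  have hi: "a < uv t0 p (\<tau> + 3 * \<eta> / 8)"
  proof -
    have "3 * p1 / 4 * (3 * \<eta> / 8) \<le> Zv p (\<tau> + 3 * \<eta> / 8 - t0) - a"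
      using up[of "real j * T p" "\<tau> + 3 * \<eta> / 8 - t0"] eta(1) Zj by (simp add: \<tau>_def)
    moreover have "p1 * \<eta> / 4 < 3 * p1 / 4 * (3 * \<eta> / 8)" using p1_pos eta(1) by simp
    ultimately show ?thesis using e3[of "\<tau> + 3 * \<eta> / 8"] eta(1) by (simp add: abs_if split: if_splits)
  qed
  have lo: "uv t0 p (\<tau> - 3 * \<eta> / 8) < a"
  proof -
    have "3 * p1 / 4 * (3 * \<eta> / 8) \<le> a - Zv p (\<tau> - 3 * \<eta> / 8 - t0)"
      using up[of "\<tau> - 3 * \<eta> / 8 - t0" "real j * T p"] eta(1) Zj by (simp add: \<tau>_def)
    moreover have "p1 * \<eta> / 4 < 3 * p1 / 4 * (3 * \<eta> / 8)" using p1_pos eta(1) by simp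
    ultimately show ?thesis using e3[of "\<tau> - 3 * \<eta> / 8"] eta(1) by (simp add: abs_if split: if_splits)
  qed
  have "continuous_on {\<tau> - 3 * \<eta> / 8..\<tau> + 3 * \<eta> / 8} (uv t0 p)"
    using primitive_of_continuous[OF u_prim(1)] continuous_on_subset by blast
  then obtain t where "\<tau> - 3 * \<eta> / 8 \<le> t" "t \<le> \<tau> + 3 * \<eta> / 8" "uv t0 p t = a"
    using IVT'[of "uv t0 p" "\<tau> - 3 * \<eta> / 8" a "\<tau> + 3 * \<eta> / 8"] lo hi eta(1) by auto
  then show ?thesis using eta(1) by (intro exI[of _ t]) (auto simp: \<tau>_def[symmetric] abs_if)
qed

lemma window_separation:
  assumes p: "p \<in> {p1..p2}" and j: "j \<le> M"
    and s: "\<bar>s - (t0 + real j * T p)\<bar> \<le> \<eta>" and t: "\<bar>t - (t0 + real j * T p)\<bar> \<le> \<eta>"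
  shows "p1 / 2 * \<bar>t - s\<bar> \<le> \<bar>uv t0 p t - uv t0 p s\<bar>"
proof -
  have *: "p1 / 2 * (y - x) \<le> uv t0 p y - uv t0 p x"
    if "x \<le> y" "\<bar>x - (t0 + real j * T p)\<bar> \<le> \<eta>" "\<bar>y - (t0 + real j * T p)\<bar> \<le> \<eta>" for x y
  proof -
    have P: "primitive_of (\<lambda>t. p1 / 2 * t) (\<lambda>t. p1 / 2 * 1)" by (intro primitive_of_cmult primitive_of_ident)
    have "p1 / 2 * y - p1 / 2 * x \<le> uv t0 p y - uv t0 p x"
    proof (rule primitive_of_mono[OF P u_prim(1) that(1)])
      fix u assume "x \<le> u" "u \<le> y"
      then show "p1 / 2 * 1 \<le> uw t0 p u" using uw_window[OF p j, of u t0] that by auto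
    qed
    then show ?thesis by (simp only: right_diff_distrib)
  qed
  show ?thesis
  proof (cases "s \<le> t")
    case True
    then have "p1 / 2 * \<bar>t - s\<bar> \<le> uv t0 p t - uv t0 p s" using *[OF True s t] by simp
    then show ?thesis by linarith
  next
    case False
    then have "p1 / 2 * \<bar>t - s\<bar> \<le> uv t0 p s - uv t0 p t" using *[OF _ t s] by simp
    then show ?thesis by linarith
  qed
qed

text \<open>Existence is within \<open>\<eta> / 2\<close>, whereas uniqueness will hold within
  \<open>\<eta>\<close>; the slack places a return of one orbit in the window of a neighbouring
  one.\<close>

definition crossing :: "nat \<Rightarrow> real \<Rightarrow> real \<Rightarrow> real" where
  "crossing j t0 p = (SOME t. \<bar>t - (t0 + real j * T p)\<bar> < \<eta> / 2 \<and> uv t0 p t = a)"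

lemma crossing:
  assumes "p \<in> {p1..p2}" "j \<le> M"
  shows "\<bar>crossing j t0 p - (t0 + real j * T p)\<bar> < \<eta> / 2" "uv t0 p (crossing j t0 p) = a"
  using someI_ex[OF crossing_exists[OF assms], folded crossing_def] by auto

lemma crossing_unique:
  assumes p: "p \<in> {p1..p2}" and j: "j \<le> M" and t: "\<bar>t - (t0 + real j * T p)\<bar> \<le> \<eta>" "uv t0 p t = a"
  shows "t = crossing j t0 p"
proof -
  have "p1 / 2 * \<bar>crossing j t0 p - t\<bar> \<le> \<bar>uv t0 p (crossing j t0 p) - uv t0 p t\<bar>"
    by (rule window_separation[OF p j t(1)]) (use crossing(1)[OF p j, of t0] eta(1) in argo)
  then have "p1 / 2 * \<bar>crossing j t0 p - t\<bar> \<le> 0" using crossing(2)[OF p j] t by simp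
  then show ?thesis using p1_pos by (simp add: mult_le_0_iff)
qed

lemma crossing_window: "p \<in> {p1..p2} \<Longrightarrow> j \<le> M \<Longrightarrow> \<bar>crossing j t0 p - (t0 + real j * T p)\<bar> \<le> \<eta>"
  using crossing(1)[of p j t0] eta(1) by argo

lemma crossing_shift:
  assumes p: "p \<in> {p1..p2}" and j: "j \<le> M"
  shows "crossing j (t0 + \<beta>) p = crossing j t0 p + \<beta>"
proof (rule crossing_unique[OF p j, symmetric])
  show "\<bar>crossing j t0 p + \<beta> - (t0 + \<beta> + real j * T p)\<bar> \<le> \<eta>"
    using crossing_window[OF p j, of t0] by (simp add: algebra_simps)
  show "uv (t0 + \<beta>) p (crossing j t0 p + \<beta>) = a" using crossing(2)[OF p j] by (simp add: u_shift)
qed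


section \<open>The \<open>j\<close>-th return to the section and its generating function\<close>

context
  fixes j :: nat
  assumes j: "1 \<le> j" "j \<le> M"
begin

definition tj :: "real \<Rightarrow> real \<Rightarrow> real" where "tj t0 p = crossing j t0 p"
definition wj :: "real \<Rightarrow> real \<Rightarrow> real" where "wj t0 p = uw t0 p (tj t0 p)"
definition ej :: "real \<Rightarrow> real \<Rightarrow> real" where "ej t0 p = (wj t0 p)\<^sup>2 / 2"

text \<open>The generating function of the \<open>j\<close>-th return map of the section \<open>v = a\<close>, which preserves
  \<open>de \<and> dt\<close> with \<open>e = w\<^sup>2 / 2\<close>.\<close>

definition G :: "real \<Rightarrow> real \<Rightarrow> real" where
  "G t0 p = integral {t0..tj t0 p} (lagrangian n (uv t0 p) (uw t0 p)) + ej t0 p * (tj t0 p - t0 - \<beta>)"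

lemma tj_bounds:
  assumes p: "p \<in> {p1..p2}"
  shows "t0 \<le> tj t0 p" "tj t0 p \<le> t0 + real M * Tmax + 1" "uv t0 p (tj t0 p) = a" "p1 / 2 \<le> wj t0 p" "\<bar>wj t0 p\<bar> \<le> W"
    "\<bar>tj t0 p - (t0 + real j * T p)\<bar> < \<eta> / 2"
proof -
  note w = crossing_window[OF p j(2), of t0]
  have "1 * T p \<le> real j * T p" using j(1) T_pos[OF p] by (intro mult_right_mono) auto
  then show "t0 \<le> tj t0 p" using w eta_T[OF p] by (simp add: tj_def)
  show "tj t0 p \<le> t0 + real M * Tmax + 1" using window_range(2)[OF p j(2) w] by (simp add: tj_def)
  show "uv t0 p (tj t0 p) = a" using crossing(2)[OF p j(2)] by (simp add: tj_def)
  show "p1 / 2 \<le> wj t0 p" using uw_window[OF p j(2) w] by (simp add: tj_def wj_def)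
  show "\<bar>wj t0 p\<bar> \<le> W" using w_bound[OF p window_range(3)[OF p j(2) w]] by (simp add: tj_def wj_def)
  show "\<bar>tj t0 p - (t0 + real j * T p)\<bar> < \<eta> / 2" using crossing(1)[OF p j(2)] by (simp add: tj_def)
qed

lemma tj_shift: "p \<in> {p1..p2} \<Longrightarrow> tj (t0 + \<beta>) p = tj t0 p + \<beta>"
  using crossing_shift[OF _ j(2)] by (simp add: tj_def)

lemma G_shift:
  assumes p: "p \<in> {p1..p2}" shows "G (t0 + \<beta>) p = G t0 p"
proof -
  have "lagrangian n (uv (t0 + \<beta>) p) (uw (t0 + \<beta>) p) (t + \<beta>) = lagrangian n (uv t0 p) (uw t0 p) t" for t
    by (simp add: lagrangian_def u_shift n_periodic)
  then have "integral {t0 + \<beta>..tj t0 p + \<beta>} (lagrangian n (uv (t0 + \<beta>) p) (uw (t0 + \<beta>) p))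
      = integral {t0..tj t0 p} (lagrangian n (uv t0 p) (uw t0 p))"
    by (simp add: integral_shift)
  then show ?thesis by (simp add: G_def tj_shift[OF p] ej_def wj_def u_shift)
qed

text \<open>At the return time of the first orbit the second is within \<open>CL * h\<close> of
  \<open>a\<close>. It runs through its window with speed at least \<open>p1 / 2\<close>, so its own
  return is at most \<open>2 / p1 * CL * h\<close> away; the velocities are then compared by
  \<open>u_near_crossing\<close>.\<close>

lemma
  assumes p: "p \<in> {p1..p2}" "q \<in> {p1..p2}" and s: "\<bar>s0 - t0\<bar> \<le> 1" "\<bar>s0 - t0\<bar> + real j * \<bar>T q - T p\<bar> \<le> \<eta> / 2"
  shows tj_lipschitz: "\<bar>tj s0 q - tj t0 p\<bar> \<le> Ct * (\<bar>s0 - t0\<bar> + \<bar>q - p\<bar>)"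
    and wj_lipschitz: "\<bar>wj s0 q - wj t0 p\<bar> \<le> Cw * (\<bar>s0 - t0\<bar> + \<bar>q - p\<bar>)"
proof -
  define h where "h = \<bar>s0 - t0\<bar> + \<bar>q - p\<bar>"
  have MT: "0 \<le> real M * Tmax" using Tmax_pos by simp
  have tjr: "t0 - 2 \<le> tj t0 p" "tj t0 p \<le> t0 + real M * Tmax + 2" using tj_bounds(1,2)[OF p(1), of t0] by auto
  have lip: "\<bar>uv s0 q t - uv t0 p t\<bar> + \<bar>uw s0 q t - uw t0 p t\<bar> \<le> CL * h"
    if "t0 - 2 \<le> t" "t \<le> t0 + real M * Tmax + 2" for t
    unfolding h_def by (rule flow_lipschitz[OF p s(1) that])
  have "\<bar>real j * T q - real j * T p\<bar> = real j * \<bar>T q - T p\<bar>"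
    by (simp add: right_diff_distrib[symmetric] abs_mult)
  moreover define e where "e = \<eta> / 2"
  moreover have "\<eta> = 2 * e" by (simp add: e_def)
  ultimately have win: "\<bar>tj t0 p - (s0 + real j * T q)\<bar> \<le> \<eta>"
    using tj_bounds(6)[OF p(1), of t0, folded e_def] s(2)[folded e_def] by linarith
  have "p1 / 2 * \<bar>tj s0 q - tj t0 p\<bar> \<le> \<bar>uv s0 q (tj s0 q) - uv s0 q (tj t0 p)\<bar>"
    by (rule window_separation[OF p(2) j(2) win])
      (use crossing_window[OF p(2) j(2)] in \<open>simp add: tj_def\<close>)
  also have "\<dots> = \<bar>uv s0 q (tj t0 p) - uv t0 p (tj t0 p)\<bar>"
    using tj_bounds(3)[OF p(1)] tj_bounds(3)[OF p(2)] by (simp add: abs_minus_commute)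
  also have "\<dots> \<le> CL * h" using lip[OF tjr] by linarith
  finally have t: "\<bar>tj s0 q - tj t0 p\<bar> \<le> Ct * h" using p1_pos by (simp add: Ct_def field_simps)
  then show "\<bar>tj s0 q - tj t0 p\<bar> \<le> Ct * (\<bar>s0 - t0\<bar> + \<bar>q - p\<bar>)" by (simp add: h_def)
  have J: "(t0 + real M * Tmax + 2) - (t0 - 2) \<le> D" "s0 - D \<le> t0 - 2" "t0 + real M * Tmax + 2 \<le> s0 + D"
    using s beta_pos MT by (auto simp: D_def)
  have m: "tj s0 q \<in> {t0 - 2..t0 + real M * Tmax + 2}" "tj t0 p \<in> {t0 - 2..t0 + real M * Tmax + 2}"
    using tj_bounds(1,2)[OF p(2), of s0] tjr s by auto
  have "\<bar>uw s0 q (tj t0 p) - wj s0 q\<bar> \<le> Qc * \<bar>tj t0 p - tj s0 q\<bar>"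
    using u_near_crossing(2)[OF p(2) J tj_bounds(3)[OF p(2), of s0] m] by (simp add: wj_def)
  also have "\<dots> \<le> Qc * (Ct * h)" using t Qc_nonneg by (intro mult_left_mono) (auto simp: abs_minus_commute)
  finally have 1: "\<bar>uw s0 q (tj t0 p) - wj s0 q\<bar> \<le> Qc * (Ct * h)" .
  have "\<bar>uw s0 q (tj t0 p) - wj t0 p\<bar> \<le> CL * h" using lip[OF tjr] by (simp add: wj_def)
  then have "\<bar>wj s0 q - wj t0 p\<bar> \<le> Qc * (Ct * h) + CL * h" using 1 by linarith
  then show "\<bar>wj s0 q - wj t0 p\<bar> \<le> Cw * (\<bar>s0 - t0\<bar> + \<bar>q - p\<bar>)"
    by (simp add: Cw_def h_def algebra_simps)
qed

lemma ej_lipschitz: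
  assumes p: "p \<in> {p1..p2}" "q \<in> {p1..p2}" and s: "\<bar>s0 - t0\<bar> \<le> 1" "\<bar>s0 - t0\<bar> + real j * \<bar>T q - T p\<bar> \<le> \<eta> / 2"
  shows "\<bar>ej s0 q - ej t0 p\<bar> \<le> W * Cw * (\<bar>s0 - t0\<bar> + \<bar>q - p\<bar>)"
proof -
  have "ej s0 q - ej t0 p = (wj s0 q + wj t0 p) / 2 * (wj s0 q - wj t0 p)"
    by (simp add: ej_def power2_eq_square field_simps)
  then have "\<bar>ej s0 q - ej t0 p\<bar> = \<bar>(wj s0 q + wj t0 p) / 2\<bar> * \<bar>wj s0 q - wj t0 p\<bar>" by (simp only: abs_mult)
  also have "\<dots> \<le> W * (Cw * (\<bar>s0 - t0\<bar> + \<bar>q - p\<bar>))"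
    using wj_lipschitz[OF p s] tj_bounds(5)[OF p(1), of t0] tj_bounds(5)[OF p(2), of s0] W_pos
    by (intro mult_mono) auto
  finally show ?thesis by (simp add: mult.assoc)
qed

end

text \<open>The conserved energy of the equation with constant coefficient \<open>c\<close>; along
  perturbed solutions only \<open>n - c\<close> makes it drift.\<close>

definition energy :: "real \<Rightarrow> real \<Rightarrow> real \<Rightarrow> real" where
  "energy t0 p t = (uw t0 p t)\<^sup>2 / 2 - P0 (uv t0 p t) - c * P1 (uv t0 p t)"

lemma energy_primitive:
  "primitive_of (energy t0 p) (\<lambda>t. (n t - c) * (f1 (uv t0 p t) * uw t0 p t))"
proof -
  have 1: "primitive_of (\<lambda>t. (uw t0 p t)\<^sup>2 / 2) (\<lambda>t. uw t0 p t * (f0 (uv t0 p t) + n t * f1 (uv t0 p t)))"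
    by (rule primitive_of_compose[OF u_prim(2), where h="\<lambda>x. x\<^sup>2 / 2" and h'="\<lambda>x. x"])
      (auto intro!: derivative_eq_intros)
  have 2: "primitive_of (\<lambda>t. P0 (uv t0 p t)) (\<lambda>t. f0 (uv t0 p t) * uw t0 p t)"
    by (rule primitive_of_compose[OF u_prim(1) P0_deriv f_continuous(1)])
  have 3: "primitive_of (\<lambda>t. P1 (uv t0 p t)) (\<lambda>t. f1 (uv t0 p t) * uw t0 p t)"
    by (rule primitive_of_compose[OF u_prim(1) P1_deriv f_continuous(2)])
  show ?thesis unfolding energy_def
    by (rule primitive_of_cong_density[OF primitive_of_diff[OF primitive_of_diff[OF 1 2] primitive_of_cmult[OF 3]]])
      (simp add: algebra_simps)
qed

lemma small_primitive:
  assumes x: "primitive_of x \<phi>" and st: "\<bar>t - s\<bar> \<le> D"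
    and bd: "\<And>r. min s t \<le> r \<Longrightarrow> r \<le> max s t \<Longrightarrow> \<bar>\<phi> r\<bar> \<le> C * \<bar>n r - c\<bar>" and C: "0 \<le> C"
  shows "\<bar>x t - x s\<bar> \<le> C * \<epsilon>"
proof -
  obtain Dn where Dn: "primitive_of Dn (\<lambda>t. \<bar>n t - c\<bar>)" using primitive_of_exists[OF n_diff_loc] by blast
  have *: "C * Dn v - C * Dn u \<le> C * \<epsilon>" if "u \<le> v" "v - u \<le> D" for u v
    using primitive_ofD[OF Dn that(1)] n_close[OF that] C
    by (simp add: right_diff_distrib[symmetric] mult_left_mono)
  show ?thesis
  proof (cases "s \<le> t")
    case True
    have "\<bar>x t - x s\<bar> \<le> C * Dn t - C * Dn s"
      by (rule primitive_of_abs_le[OF x primitive_of_cmult[OF Dn] True]) (use bd True in auto)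
    then show ?thesis using *[of s t] st True by auto
  next
    case False
    then have le: "t \<le> s" by simp
    have "\<bar>x s - x t\<bar> \<le> C * Dn s - C * Dn t"
      by (rule primitive_of_abs_le[OF x primitive_of_cmult[OF Dn] le]) (use bd le in auto)
    then show ?thesis using *[of t s] st le by (simp add: abs_minus_commute)
  qed
qed

lemma energy_init: "energy t0 p t0 = p\<^sup>2 / 2"
  by (simp add: energy_def u_init P0_a P1_a)

lemma energy_near:
  assumes p: "p \<in> {p1..p2}" and t: "\<bar>t - t0\<bar> \<le> D"
  shows "\<bar>energy t0 p t - p\<^sup>2 / 2\<bar> \<le> B * W * \<epsilon>"
proof -
  have "\<bar>energy t0 p t - energy t0 p t0\<bar> \<le> (B * W) * \<epsilon>"
  proof (rule small_primitive[OF energy_primitive t])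
    fix r assume r: "min t0 t \<le> r" "r \<le> max t0 t"
    have "\<bar>uw t0 p r\<bar> \<le> W" by (rule w_bound[OF p]) (use r t in \<open>auto simp: min_def max_def split: if_splits\<close>)
    then have "\<bar>f1 (uv t0 p r)\<bar> * \<bar>uw t0 p r\<bar> \<le> B * W" using f1_bound B_nonneg by (intro mult_mono) auto
    then have "\<bar>n r - c\<bar> * (\<bar>f1 (uv t0 p r)\<bar> * \<bar>uw t0 p r\<bar>) \<le> \<bar>n r - c\<bar> * (B * W)" by (rule mult_left_mono) simp
    then show "\<bar>(n r - c) * (f1 (uv t0 p r) * uw t0 p r)\<bar> \<le> B * W * \<bar>n r - c\<bar>"
      by (simp add: abs_mult mult_ac)
  qed (use B_nonneg W_pos in simp)
  then show ?thesis by (simp add: energy_init)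
qed

end

context perturbation
begin

context
  fixes j :: nat
  assumes j: "1 \<le> j" "j \<le> M"
begin

lemma ej_energy: "p \<in> {p1..p2} \<Longrightarrow> energy t0 p (tj j t0 p) = ej j t0 p"
  using tj_bounds(3)[OF j] by (simp add: energy_def ej_def[OF j] wj_def[OF j] P0_a P1_a)

text \<open>\<open>ej\<close> differs from \<open>p\<^sup>2 / 2\<close> by the energy drift, which
  is Lipschitz in \<open>p\<close> with constant \<open>\<epsilon> * Cm \<le> p1 / 2\<close>. As
  \<open>p\<^sup>2 / 2\<close> grows at rate at least \<open>p1\<close>, half of that rate is
  left.\<close>

lemma ej_monotone:
  assumes p: "p \<in> {p1..p2}" "q \<in> {p1..p2}" and T: "real j * \<bar>T q - T p\<bar> \<le> \<eta> / 2"
  shows "p1 / 2 * (q - p)\<^sup>2 \<le> (ej j t0 q - ej j t0 p) * (q - p)"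
proof -
  define h where "h = \<bar>q - p\<bar>"
  have MT: "0 \<le> real M * Tmax" using Tmax_pos by simp
  have s: "\<bar>t0 - t0\<bar> \<le> 1" "\<bar>t0 - t0\<bar> + real j * \<bar>T q - T p\<bar> \<le> \<eta> / 2" using T by auto
  have tq: "\<bar>tj j t0 q - tj j t0 p\<bar> \<le> Ct * h"
    using tj_lipschitz[OF j p s] by (simp add: h_def)
  have h0: "0 \<le> h" by (simp add: h_def)
  have dist: "\<bar>tj j t0 p - t0\<bar> \<le> D" "\<bar>tj j t0 q - t0\<bar> \<le> D"
    using tj_bounds(1,2)[OF j p(1), of t0] tj_bounds(1,2)[OF j p(2), of t0] beta_pos by (auto simp: D_def)
  have lip: "\<bar>uv t0 q r - uv t0 p r\<bar> + \<bar>uw t0 q r - uw t0 p r\<bar> \<le> CL * h"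
    if "t0 \<le> r" "r \<le> t0 + real M * Tmax + 1" for r
    using flow_lipschitz[OF p s(1), of r] that by (simp add: h_def)
  \<comment> \<open>Up to the return time of the orbit of \<open>p\<close>, the two drifts differ
    only by the Lipschitz dependence of orbits on \<open>p\<close>.\<close>
  have 1: "\<bar>(energy t0 q (tj j t0 p) - energy t0 p (tj j t0 p)) - (energy t0 q t0 - energy t0 p t0)\<bar>
      \<le> ((L * W + B) * CL * h) * \<epsilon>"
  proof (rule small_primitive[OF primitive_of_diff[OF energy_primitive[of t0 q] energy_primitive[of t0 p]] dist(1)])
    show "0 \<le> (L * W + B) * CL * h" using L_nonneg W_pos B_nonneg CL_pos h0 by simp
    fix r assume "min t0 (tj j t0 p) \<le> r" "r \<le> max t0 (tj j t0 p)"
    then have r: "t0 \<le> r" "r \<le> t0 + real M * Tmax + 1" using tj_bounds(1,2)[OF j p(1), of t0] by auto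
    have rD: "\<bar>r - t0\<bar> \<le> D" using r beta_pos by (auto simp: D_def)
    have l: "\<bar>uv t0 q r - uv t0 p r\<bar> \<le> CL * h" "\<bar>uw t0 q r - uw t0 p r\<bar> \<le> CL * h"
      using lip[OF r] by linarith+
    have f: "\<bar>f1 (uv t0 q r) - f1 (uv t0 p r)\<bar> \<le> L * (CL * h)"
      using f1_lip[of "uv t0 q r" "uv t0 p r"] mult_left_mono[OF l(1) L_nonneg] by linarith
    have CLh: "0 \<le> L * (CL * h)" using L_nonneg CL_pos h0 by simp
    have "\<bar>f1 (uv t0 q r) - f1 (uv t0 p r)\<bar> * \<bar>uw t0 q r\<bar> \<le> (L * (CL * h)) * W"
      by (rule mult_mono[OF f w_bound[OF p(2) rD] CLh abs_ge_zero])
    moreover have "\<bar>f1 (uv t0 p r)\<bar> * \<bar>uw t0 q r - uw t0 p r\<bar> \<le> B * (CL * h)"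
      by (rule mult_mono[OF f1_bound l(2) B_nonneg abs_ge_zero])
    ultimately have bd: "\<bar>f1 (uv t0 q r) - f1 (uv t0 p r)\<bar> * \<bar>uw t0 q r\<bar>
        + \<bar>f1 (uv t0 p r)\<bar> * \<bar>uw t0 q r - uw t0 p r\<bar> \<le> (L * (CL * h)) * W + B * (CL * h)"
      by (rule add_mono)
    have eq: "f1 (uv t0 q r) * uw t0 q r - f1 (uv t0 p r) * uw t0 p r
        = (f1 (uv t0 q r) - f1 (uv t0 p r)) * uw t0 q r + f1 (uv t0 p r) * (uw t0 q r - uw t0 p r)"
      by (simp add: algebra_simps)
    have "\<bar>f1 (uv t0 q r) * uw t0 q r - f1 (uv t0 p r) * uw t0 p r\<bar> \<le> (L * (CL * h)) * W + B * (CL * h)"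
      unfolding eq by (rule order_trans[OF abs_triangle_ineq]) (use bd in \<open>simp only: abs_mult\<close>)
    then have "\<bar>n r - c\<bar> * \<bar>f1 (uv t0 q r) * uw t0 q r - f1 (uv t0 p r) * uw t0 p r\<bar>
        \<le> \<bar>n r - c\<bar> * ((L * (CL * h)) * W + B * (CL * h))" by (rule mult_left_mono[OF _ abs_ge_zero])
    moreover have "\<bar>(n r - c) * (f1 (uv t0 q r) * uw t0 q r) - (n r - c) * (f1 (uv t0 p r) * uw t0 p r)\<bar>
        = \<bar>n r - c\<bar> * \<bar>f1 (uv t0 q r) * uw t0 q r - f1 (uv t0 p r) * uw t0 p r\<bar>"
      by (simp only: abs_mult[symmetric] right_diff_distrib)
    moreover have "\<bar>n r - c\<bar> * ((L * (CL * h)) * W + B * (CL * h)) = (L * W + B) * CL * h * \<bar>n r - c\<bar>"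
      by (simp add: algebra_simps)
    ultimately show "\<bar>(n r - c) * (f1 (uv t0 q r) * uw t0 q r) - (n r - c) * (f1 (uv t0 p r) * uw t0 p r)\<bar>
        \<le> (L * W + B) * CL * h * \<bar>n r - c\<bar>" by simp
  qed
  \<comment> \<open>Between the two return times the drift also carries a factor \<open>h\<close>:
    the orbit is then within \<open>W * Ct * h\<close> of \<open>a\<close>, where \<open>f1\<close>
    vanishes.\<close>
  have 2: "\<bar>energy t0 q (tj j t0 q) - energy t0 q (tj j t0 p)\<bar> \<le> (L * W * W * Ct * h) * \<epsilon>"
  proof (rule small_primitive[OF energy_primitive[of t0 q]])
    show "0 \<le> L * W * W * Ct * h" using L_nonneg W_pos Ct_pos h0 by simp
    show "\<bar>tj j t0 q - tj j t0 p\<bar> \<le> D"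
      using tj_bounds(1,2)[OF j p(1), of t0] tj_bounds(1,2)[OF j p(2), of t0] beta_pos by (auto simp: D_def)
    fix r assume r: "min (tj j t0 p) (tj j t0 q) \<le> r" "r \<le> max (tj j t0 p) (tj j t0 q)"
    have r': "r \<in> {t0..t0 + real M * Tmax + 1}" "tj j t0 q \<in> {t0..t0 + real M * Tmax + 1}"
      using r tj_bounds(1,2)[OF j p(1), of t0] tj_bounds(1,2)[OF j p(2), of t0] by auto
    have rD: "\<bar>r - t0\<bar> \<le> D" using r' beta_pos by (auto simp: D_def)
    have J: "t0 + real M * Tmax + 1 - t0 \<le> D" "t0 - D \<le> t0" "t0 + real M * Tmax + 1 \<le> t0 + D"
      using beta_pos MT by (auto simp: D_def)
    have "\<bar>f1 (uv t0 q r)\<bar> \<le> L * \<bar>uv t0 q r - a\<bar>" by (rule f1_near_a)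
    also have "\<dots> \<le> L * (W * \<bar>r - tj j t0 q\<bar>)"
      using u_near_crossing(1)[OF p(2) J tj_bounds(3)[OF j p(2)] r'(2,1)] L_nonneg by (rule mult_left_mono)
    also have "\<dots> \<le> L * (W * (Ct * h))"
    proof (intro mult_left_mono)
      show "\<bar>r - tj j t0 q\<bar> \<le> Ct * h" using r tq by linarith
    qed (use L_nonneg W_pos in auto)
    finally have "\<bar>f1 (uv t0 q r)\<bar> * \<bar>uw t0 q r\<bar> \<le> (L * (W * (Ct * h))) * W"
      using w_bound[OF p(2) rD] L_nonneg W_pos Ct_pos h0 by (intro mult_mono) auto
    then have "\<bar>n r - c\<bar> * (\<bar>f1 (uv t0 q r)\<bar> * \<bar>uw t0 q r\<bar>) \<le> \<bar>n r - c\<bar> * ((L * (W * (Ct * h))) * W)"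
      by (rule mult_left_mono) simp
    then show "\<bar>(n r - c) * (f1 (uv t0 q r) * uw t0 q r)\<bar> \<le> L * W * W * Ct * h * \<bar>n r - c\<bar>"
      by (simp add: abs_mult mult_ac)
  qed
  have "ej j t0 q - ej j t0 p - (q\<^sup>2 / 2 - p\<^sup>2 / 2) =
      ((energy t0 q (tj j t0 p) - energy t0 p (tj j t0 p)) - (energy t0 q t0 - energy t0 p t0))
      + (energy t0 q (tj j t0 q) - energy t0 q (tj j t0 p))"
    using ej_energy[OF p(1)] ej_energy[OF p(2)] by (simp add: energy_init)
  then have "\<bar>ej j t0 q - ej j t0 p - (q\<^sup>2 / 2 - p\<^sup>2 / 2)\<bar> \<le> ((L * W + B) * CL * h) * \<epsilon> + (L * W * W * Ct * h) * \<epsilon>"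
    using 1 2 by linarith
  also have "\<dots> = \<epsilon> * Cm * h" by (simp add: Cm_def algebra_simps)
  also have "\<dots> \<le> p1 / 2 * h" using eps(4) h0 by (rule mult_right_mono)
  finally have 3: "\<bar>ej j t0 q - ej j t0 p - (q\<^sup>2 / 2 - p\<^sup>2 / 2)\<bar> \<le> p1 / 2 * h" .
  have "\<bar>(ej j t0 q - ej j t0 p - (q\<^sup>2 / 2 - p\<^sup>2 / 2)) * (q - p)\<bar> \<le> (p1 / 2 * h) * h"
    unfolding abs_mult h_def[symmetric] using 3 h0 by (rule mult_right_mono)
  also have "\<dots> = p1 / 2 * (q - p)\<^sup>2" by (simp add: h_def power2_eq_square mult.assoc)
  finally have 4: "- ((ej j t0 q - ej j t0 p - (q\<^sup>2 / 2 - p\<^sup>2 / 2)) * (q - p)) \<le> p1 / 2 * (q - p)\<^sup>2" by linarith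
  have "p1 * (q - p)\<^sup>2 \<le> (q + p) / 2 * (q - p)\<^sup>2" using p by (intro mult_right_mono) auto
  also have "\<dots> = (q\<^sup>2 / 2 - p\<^sup>2 / 2) * (q - p)" by (simp add: power2_eq_square field_simps)
  finally have 5: "p1 * (q - p)\<^sup>2 \<le> (q\<^sup>2 / 2 - p\<^sup>2 / 2) * (q - p)" .
  have 6: "(ej j t0 q - ej j t0 p) * (q - p) = (q\<^sup>2 / 2 - p\<^sup>2 / 2) * (q - p)
      + (ej j t0 q - ej j t0 p - (q\<^sup>2 / 2 - p\<^sup>2 / 2)) * (q - p)"
    by (simp only: distrib_right[symmetric]) simp
  have "p1 * (q - p)\<^sup>2 = p1 / 2 * (q - p)\<^sup>2 + p1 / 2 * (q - p)\<^sup>2" by (simp add: field_simps)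
  then show ?thesis unfolding 6 using 4 5 by linarith
qed

text \<open>By \<open>action_variation\<close> the action contributes
  \<open>p\<^sup>2 / 2 * ds - ej * dtj\<close>. The term added in \<open>G\<close> cancels
  \<open>ej * dtj\<close> and brings in \<open>(tj - t - \<beta>) * dej - ej * ds\<close>
  instead.\<close>

lemma G_expansion:
  assumes p: "p \<in> {p1..p2}"
  shows "\<exists>C d. 0 < d \<and> (\<forall>s q. \<bar>s - t\<bar> < d \<and> \<bar>q - p\<bar> < d \<and> q \<in> {p1..p2} \<longrightarrow>
        \<bar>G j s q - G j t p - ((tj j t p - t - \<beta>) * (ej j s q - ej j t p) - (ej j t p - p\<^sup>2 / 2) * (s - t))\<bar> \<le> C * (\<bar>s - t\<bar> + \<bar>q - p\<bar>)\<^sup>2 \<and>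
        \<bar>ej j s q - ej j t p\<bar> \<le> C * (\<bar>s - t\<bar> + \<bar>q - p\<bar>) \<and>
        p1 / 2 * (q - p)\<^sup>2 \<le> (ej j t q - ej j t p) * (q - p))"
proof -
  have "\<eta> / (4 * (real j + 1)) > 0" using eta(1) by simp
  then obtain d1 where d1: "d1 > 0" "\<And>q. q \<in> {p1..p2} \<Longrightarrow> \<bar>q - p\<bar> < d1 \<Longrightarrow> \<bar>T q - T p\<bar> < \<eta> / (4 * (real j + 1))"
    using T_cont[unfolded continuous_on_iff dist_real_def] p by meson
  \<comment> \<open>A quarter of \<open>\<eta>\<close> for the time shift and a quarter for
    \<open>j\<close> times the change of \<open>T\<close> add up to the \<open>\<eta> / 2\<close> of
    the Lipschitz estimates.\<close>
  define d where "d = min d1 (\<eta> / 4)"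
  have d: "0 < d" "d \<le> d1" "d \<le> \<eta> / 4" using d1(1) eta(1) by (auto simp: d_def)
  \<comment> \<open>One constant for all first-order differences, so that \<open>CC * h\<close> can
    take the place of \<open>h\<close> in \<open>action_variation\<close>.\<close>
  define CC where "CC = Ct + CL + 1"
  define C0 where "C0 = ((1 + 2 * L) * N1 + 2 * (W * (2 * Qc + 1) + B * W + L * W\<^sup>2 * N1) + 2 * (W * (2 * Qc + 1)))"
  define C where "C = C0 * CC\<^sup>2 + W * Cw * (Ct + 1) + W * Cw"
  have CC: "Ct \<le> CC" "CL \<le> CC" "1 \<le> CC" using Ct_pos CL_pos by (auto simp: CC_def)
  have C0: "0 \<le> C0"
    unfolding C0_def using L_nonneg N1_pos W_pos Qc_nonneg B_nonneg by simp
  have WC: "0 \<le> W * Cw" using W_pos Cw_pos by simp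
  have MT: "0 \<le> real M * Tmax" using Tmax_pos by simp
  show ?thesis
  proof (intro exI[of _ C] exI[of _ d] conjI d(1) allI impI; elim conjE)
    fix s q assume sq: "\<bar>s - t\<bar> < d" "\<bar>q - p\<bar> < d" "q \<in> {p1..p2}"
    define h where "h = \<bar>s - t\<bar> + \<bar>q - p\<bar>"
    have h0: "0 \<le> h" by (simp add: h_def)
    have jT: "real j * \<bar>T q - T p\<bar> \<le> \<eta> / 4"
    proof -
      have "real j * \<bar>T q - T p\<bar> \<le> (real j + 1) * (\<eta> / (4 * (real j + 1)))"
        using d1(2)[OF sq(3)] sq(2) d by (intro mult_mono) auto
      also have "\<dots> = \<eta> / 4" by (simp add: divide_simps)
      finally show ?thesis .
    qed
    define e where "e = \<eta> / 4"
    have e: "\<eta> = 4 * e" "\<eta> / 2 = 2 * e" "0 < e" "e \<le> 1" using eta by (auto simp: e_def)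
    have s1: "\<bar>s - t\<bar> \<le> 1" using sq(1) d(3)[folded e_def] e by linarith
    have s2: "\<bar>s - t\<bar> + real j * \<bar>T q - T p\<bar> \<le> \<eta> / 2"
      unfolding e(2) using sq(1) d(3)[folded e_def] jT[folded e_def] by linarith
    note lt = tj_lipschitz[OF j p sq(3) s1 s2, folded h_def]
    note le = ej_lipschitz[OF j p sq(3) s1 s2, folded h_def]
    show "p1 / 2 * (q - p)\<^sup>2 \<le> (ej j t q - ej j t p) * (q - p)"
      by (rule ej_monotone[OF p sq(3)]) (use jT[folded e_def] e in linarith)
    have "W * Cw * h \<le> C * h"
    proof (rule mult_right_mono[OF _ h0])
      have "0 \<le> C0 * CC\<^sup>2 + W * Cw * (Ct + 1)" using C0 WC Ct_pos by simp
      then show "W * Cw \<le> C" by (simp add: C_def)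
    qed
    then show "\<bar>ej j s q - ej j t p\<bar> \<le> C * (\<bar>s - t\<bar> + \<bar>q - p\<bar>)"
      using le by (simp add: h_def)
    let ?lo = "t - 2" let ?hi = "t + real M * Tmax + 2"
    have win: "window f0 f1 B L P0 P1 a n Nn ?lo ?hi N1 W"
      by (rule window) (use beta_pos MT in \<open>auto simp: D_def\<close>)
    have Qeq: "window.Q B L N1 W = Qc" using window.Q_def[OF win] by (simp add: Qc_def)
    obtain S where S: "primitive_of S (lagrangian n (uv t p) (uw t p))"
      using primitive_of_exists[OF lagrangian_loc_integrable[OF n_loc primitive_of_continuous[OF u_prim(1)[of t p]]
            primitive_of_continuous[OF u_prim(2)[of t p]]]] by blast
    obtain S' where S': "primitive_of S' (lagrangian n (uv s q) (uw s q))"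
      using primitive_of_exists[OF lagrangian_loc_integrable[OF n_loc primitive_of_continuous[OF u_prim(1)[of s q]]
            primitive_of_continuous[OF u_prim(2)[of s q]]]] by blast
    have hC: "CL * h \<le> CC * h" "Ct * h \<le> CC * h" "h \<le> CC * h"
      using CC h0 mult_right_mono[of 1 CC h] by (auto intro: mult_right_mono)
    have lip: "\<bar>uv s q x - uv t p x\<bar> \<le> CC * h" "\<bar>uw s q x - uw t p x\<bar> \<le> CC * h" if "x \<in> {?lo..?hi}" for x
      using flow_lipschitz[OF p sq(3) s1, of x, folded h_def] that hC(1) by auto
    have wb: "\<bar>uw t p x\<bar> \<le> W" "\<bar>uw s q x\<bar> \<le> W" if "x \<in> {?lo..?hi}" for x
      using that s1 beta_pos MT by (auto intro!: w_bound[OF p] w_bound[OF sq(3)] simp: D_def)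
    have mem: "t \<in> {?lo..?hi}" "tj j t p \<in> {?lo..?hi}" "s \<in> {?lo..?hi}" "tj j s q \<in> {?lo..?hi}"
      using tj_bounds(1,2)[OF j p, of t] tj_bounds(1,2)[OF j sq(3), of s] s1 MT by auto
    have "\<bar>s - t\<bar> \<le> h" by (simp add: h_def)
    then have ts: "\<bar>s - t\<bar> \<le> CC * h" "\<bar>tj j s q - tj j t p\<bar> \<le> CC * h"
      using hC lt by linarith+
    have tN: "tj j t p - t \<le> N1" "t \<le> tj j t p"
      using tj_bounds(1,2)[OF j p, of t] N1_pos(2) beta_pos by (auto simp: D_def)
    have av: "\<bar>(S' (tj j s q) - S' s) - (S (tj j t p) - S t) -
        ((uw t p t)\<^sup>2 / 2 * (s - t) - (uw t p (tj j t p))\<^sup>2 / 2 * (tj j s q - tj j t p))\<bar> \<le> C0 * (CC * h)\<^sup>2"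
      using window.action_variation[OF win u_sol wb(1) u_sol wb(2) S S' u_init(1) tj_bounds(3)[OF j p] mem(1,2)
          u_init(1) tj_bounds(3)[OF j sq(3)] mem(3,4) ts lip tN]
      unfolding Qeq C0_def by blast
    define \<Delta> where "\<Delta> = (S' (tj j s q) - S' s) - (S (tj j t p) - S t) -
        (p\<^sup>2 / 2 * (s - t) - ej j t p * (tj j s q - tj j t p))"
    have \<Delta>: "\<bar>\<Delta>\<bar> \<le> C0 * (CC * h)\<^sup>2" using av by (simp add: \<Delta>_def u_init ej_def[OF j] wj_def[OF j])
    have GS: "G j t p = S (tj j t p) - S t + ej j t p * (tj j t p - t - \<beta>)"
        "G j s q = S' (tj j s q) - S' s + ej j s q * (tj j s q - s - \<beta>)"
      using primitive_ofD[OF S tj_bounds(1)[OF j p]] primitive_ofD[OF S' tj_bounds(1)[OF j sq(3)]]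
      by (auto simp: G_def[OF j])
    \<comment> \<open>A product of two increments, hence quadratic in \<open>h\<close>.\<close>
    define R where "R = (ej j s q - ej j t p) * ((tj j s q - tj j t p) - (s - t))"
    have "\<bar>R\<bar> \<le> (W * Cw * h) * ((Ct + 1) * h)"
      unfolding R_def abs_mult
    proof (rule mult_mono[OF le])
      have "\<bar>s - t\<bar> \<le> h" by (simp add: h_def)
      then have "\<bar>tj j s q - tj j t p - (s - t)\<bar> \<le> Ct * h + h" using lt by linarith
      then show "\<bar>tj j s q - tj j t p - (s - t)\<bar> \<le> (Ct + 1) * h" by (simp add: algebra_simps)
    qed (use WC h0 in auto)
    then have R: "\<bar>R\<bar> \<le> W * Cw * (Ct + 1) * h\<^sup>2" by (simp add: power2_eq_square mult_ac)
    have "G j s q - G j t p - ((tj j t p - t - \<beta>) * (ej j s q - ej j t p) - (ej j t p - p\<^sup>2 / 2) * (s - t)) = \<Delta> + R"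
      unfolding GS \<Delta>_def R_def by (simp add: algebra_simps)
    then have "\<bar>G j s q - G j t p - ((tj j t p - t - \<beta>) * (ej j s q - ej j t p) - (ej j t p - p\<^sup>2 / 2) * (s - t))\<bar>
        \<le> C0 * (CC * h)\<^sup>2 + W * Cw * (Ct + 1) * h\<^sup>2" using \<Delta> R by linarith
    also have "\<dots> \<le> C * h\<^sup>2"
    proof -
      have "0 \<le> W * Cw * h\<^sup>2" using WC by simp
      then show ?thesis by (simp add: C_def power_mult_distrib algebra_simps)
    qed
    finally show "\<bar>G j s q - G j t p - ((tj j t p - t - \<beta>) * (ej j s q - ej j t p) - (ej j t p - p\<^sup>2 / 2) * (s - t))\<bar>
        \<le> C * (\<bar>s - t\<bar> + \<bar>q - p\<bar>)\<^sup>2" by (simp add: h_def)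
  qed
qed

lemma periodic_solution:
  "\<exists>t0 p. p \<in> {p1..p2} \<and> \<bar>\<beta> - real j * T p\<bar> < \<eta> \<and>
     (\<forall>t. uv t0 p (t + \<beta>) = uv t0 p t) \<and> (\<forall>t. uw t0 p (t + \<beta>) = uw t0 p t)"
proof -
  have "\<exists>t p. p \<in> {p1..p2} \<and> tj j t p - t - \<beta> = 0 \<and> ej j t p - p\<^sup>2 / 2 = 0"
  proof (rule periodic_strip_minimum[where G="G j" and E="ej j" and k="p1 / 2", OF beta_pos p1_less])
    show "0 < p1 / 2" using p1_pos by simp
    show "G j (t + \<beta>) p = G j t p" if "p \<in> {p1..p2}" for t p by (rule G_shift[OF j that])
    have m: "p1 \<in> {p1..p2}" "p2 \<in> {p1..p2}" using p1_less by auto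
    have w: "\<bar>tj j t p - (t + real j * T p)\<bar> < \<eta>" if "p \<in> {p1..p2}" for t p
      using tj_bounds(6)[OF j that, of t] eta(1) by simp
    \<comment> \<open>On the edge \<open>p1\<close> even \<open>M\<close> turns take less than
      \<open>\<beta>\<close>, on the edge \<open>p2\<close> a single turn takes longer;
      \<open>\<eta>\<close> absorbs the perturbation.\<close>
    show "tj j t p1 - t - \<beta> < 0" for t
    proof -
      have "real j * T p1 \<le> real M * T p1" using j T_pos[OF m(1)] by (intro mult_right_mono) auto
      then show ?thesis using w[OF m(1), of t] eta(3) by linarith
    qed
    show "0 < tj j t p2 - t - \<beta>" for t
    proof -
      have "1 * T p2 \<le> real j * T p2" using j T_pos[OF m(2)] by (intro mult_right_mono) auto
      then show ?thesis using w[OF m(2), of t] eta(4) by linarith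
    qed
  qed (rule G_expansion)
  then obtain t0 p where p: "p \<in> {p1..p2}" and tj: "tj j t0 p = t0 + \<beta>" and ej: "ej j t0 p = p\<^sup>2 / 2"
    by (auto simp: algebra_simps)
  \<comment> \<open>Equal squares, and both velocities are positive.\<close>
  have "wj j t0 p = p"
    using ej tj_bounds(4)[OF j p, of t0] p p1_pos by (simp add: ej_def[OF j] power2_eq_iff_nonneg)
  then have "uv t0 p (t0 + \<beta>) = a" "uw t0 p (t0 + \<beta>) = p"
    using tj_bounds(3)[OF j p, of t0] tj by (auto simp: wj_def[OF j])
  moreover have "solution f0 f1 n (\<lambda>t. uv t0 p (t + \<beta>)) (\<lambda>t. uw t0 p (t + \<beta>))"
    using solution_shift[OF u_sol[of t0 p], of \<beta>] by (simp add: n_periodic)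
  ultimately have per: "uv t0 p (t + \<beta>) = uv t0 p t \<and> uw t0 p (t + \<beta>) = uw t0 p t" for t
    using solution_unique[OF n_loc _ u_sol[of t0 p], of "\<lambda>t. uv t0 p (t + \<beta>)" "\<lambda>t. uw t0 p (t + \<beta>)" t0 t]
    by (simp add: u_init)
  moreover have "\<bar>\<beta> - real j * T p\<bar> < \<eta>"
    using tj_bounds(6)[OF j p, of t0] tj eta(1) by (simp add: algebra_simps)
  ultimately show ?thesis using p by blast
qed

end

end

section \<open>Choice of \<open>\<eta>\<close> and \<open>\<epsilon>\<close>, and \<open>M\<close>
  distinct periodic solutions\<close>

context near_autonomous
begin

lemma Cm_nonneg: "0 \<le> Cm"
  unfolding Cm_def using L_nonneg W_pos B_nonneg CL_pos Ct_pos by simp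

lemma perturbed_solutions:
  assumes lr: "0 < l" "r < 1"
  shows "\<exists>\<epsilon>>0. \<forall>n. loc_integrable n \<and> (\<forall>t. n (t + \<beta>) = n t) \<and>
      (\<forall>s t. s \<le> t \<and> t - s \<le> D \<longrightarrow> integral {s..t} (\<lambda>x. \<bar>n x - c\<bar>) \<le> \<epsilon>) \<longrightarrow>
      (\<exists>S. finite S \<and> card S = M \<and> (\<forall>v\<in>S. (\<exists>w. solution f0 f1 n v w) \<and> (\<forall>t. v (t + \<beta>) = v t) \<and>
        (\<forall>t. 0 < v t \<and> v t < 1)))"
proof -
  obtain x0 where x0: "x0 \<in> {p1..p2}" "\<And>p. p \<in> {p1..p2} \<Longrightarrow> T x0 \<le> T p"
    using continuous_attains_inf[OF _ _ T_cont] p1_less by auto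
  define Tm where "Tm = T x0"
  have Tm: "0 < Tm" "\<And>p. p \<in> {p1..p2} \<Longrightarrow> Tm \<le> T p" using x0 T_pos by (auto simp: Tm_def)
  \<comment> \<open>The added 1, here and in \<open>e\<close>, \<open>k\<close>, \<open>m\<close>,
    keeps the divisor positive and the resulting inequality strict.\<close>
  define b where "b = B * (1 + c) + 1"
  have b: "0 < b" "B * (1 + c) < b" using B_nonneg c_nonneg by (auto simp: b_def add_nonneg_pos)
  define \<eta> where "\<eta> = Min {1, (\<beta> - real M * T p1) / 2, (T p2 - \<beta>) / 2, p1 / (4 * b), Tm / 4}"
  have "0 < (\<beta> - real M * T p1) / 2" "0 < (T p2 - \<beta>) / 2" using T1 T2 by simp_all
  then have "0 < \<eta>" unfolding \<eta>_def using p1_pos b Tm(1) by (subst Min_gr_iff) auto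
  moreover have "\<eta> \<le> x" if "x \<in> {1, (\<beta> - real M * T p1) / 2, (T p2 - \<beta>) / 2, p1 / (4 * b), Tm / 4}" for x
    unfolding \<eta>_def by (rule Min_le[OF _ that]) simp
  ultimately have \<eta>: "0 < \<eta>" "\<eta> \<le> 1" "\<eta> \<le> (\<beta> - real M * T p1) / 2" "\<eta> \<le> (T p2 - \<beta>) / 2" "\<eta> \<le> p1 / (4 * b)" "\<eta> \<le> Tm / 4"
    by blast+
  have \<eta>1: "\<eta> < \<beta> - real M * T p1" "\<eta> < T p2 - \<beta>" using \<eta>(1,3,4) by (simp_all add: field_simps)
  have \<eta>2: "B * (1 + c) * \<eta> \<le> p1 / 4"
  proof -
    have "B * (1 + c) * \<eta> \<le> b * (p1 / (4 * b))" using b \<eta>(1,5) p1_pos by (intro mult_mono) auto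
    also have "\<dots> = p1 / 4" using b by simp
    finally show ?thesis .
  qed
  have \<eta>3: "\<eta> < T p" if "p \<in> {p1..p2}" for p using Tm \<eta>(6) Tm(2)[OF that] by (simp add: field_simps)
  \<comment> \<open>Even \<open>M\<close> turns accumulate a discrepancy of at most
    \<open>Tm / 4\<close>.\<close>
  define \<gamma> where "\<gamma> = Tm / (4 * (real M + 1))"
  have \<gamma>: "0 < \<gamma>" using Tm(1) by (simp add: \<gamma>_def)
  have "uniformly_continuous_on {p1..p2} T" by (rule compact_uniformly_continuous[OF T_cont]) simp
  then obtain \<delta> where \<delta>: "0 < \<delta>" "\<And>p q. p \<in> {p1..p2} \<Longrightarrow> q \<in> {p1..p2} \<Longrightarrow> \<bar>q - p\<bar> < \<delta> \<Longrightarrow> \<bar>T q - T p\<bar> < \<gamma>"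
    unfolding uniformly_continuous_on_def dist_real_def using \<gamma> by meson
  define e where "e = B * Ex + 1"
  have e: "0 < e" "B * Ex < e" using B_nonneg Ex_pos by (auto simp: e_def add_nonneg_pos)
  define k where "k = B * W + 1"
  have k: "0 < k" "B * W < k" using B_nonneg W_pos by (auto simp: k_def add_nonneg_pos)
  define m where "m = Cm + 1"
  have m: "0 < m" "Cm < m" using Cm_nonneg by (auto simp: m_def)
  \<comment> \<open>After 1, the entries serve, in this order, the location of returns, the
    monotonicity of \<open>ej\<close>, the bounds 0 and 1 for the solutions, and the separation of
    solutions by energy.\<close>
  define \<epsilon> where "\<epsilon> = Min {1, p1 * \<eta> / (4 * e), p1 / (2 * m), l / e, (1 - r) / e, p1 * \<delta> / k}"
  have "0 < \<epsilon>" unfolding \<epsilon>_def using p1_pos e m \<eta>(1) lr k \<delta>(1) by (subst Min_gr_iff) auto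
  moreover have "\<epsilon> \<le> x" if "x \<in> {1, p1 * \<eta> / (4 * e), p1 / (2 * m), l / e, (1 - r) / e, p1 * \<delta> / k}" for x
    unfolding \<epsilon>_def by (rule Min_le[OF _ that]) simp
  ultimately have \<epsilon>: "0 < \<epsilon>" "\<epsilon> \<le> 1" "\<epsilon> \<le> p1 * \<eta> / (4 * e)" "\<epsilon> \<le> p1 / (2 * m)" "\<epsilon> \<le> l / e" "\<epsilon> \<le> (1 - r) / e" "\<epsilon> \<le> p1 * \<delta> / k"
    by blast+
  have below: "u * \<epsilon> < y" if "u < x" "0 < x" "\<epsilon> \<le> y / x" for u x y :: real
  proof -
    have "u * \<epsilon> < x * \<epsilon>" using that \<epsilon>(1) by simp
    also have "\<dots> \<le> y" using that by (simp add: pos_le_divide_eq mult.commute)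
    finally show ?thesis .
  qed
  have 1: "B * \<epsilon> * Ex < p1 * \<eta> / 4"
    using below[of "B * Ex" e "p1 * \<eta> / 4"] e \<epsilon>(3) by (simp add: mult_ac)
  have 2: "\<epsilon> * Cm \<le> p1 / 2" using below[of Cm m "p1 / 2"] m \<epsilon>(4) by (simp add: mult_ac)
  have 3: "B * \<epsilon> * Ex < l" "B * \<epsilon> * Ex < 1 - r"
    using below[of "B * Ex" e l] below[of "B * Ex" e "1 - r"] e \<epsilon>(5,6) by (simp_all add: mult_ac)
  have 4: "B * W * \<epsilon> < p1 * \<delta>" using below[of "B * W" k "p1 * \<delta>"] k \<epsilon>(7) by simp
  show ?thesis
  proof (intro exI[of _ \<epsilon>] conjI \<epsilon>(1) allI impI)
    fix n assume n: "loc_integrable n \<and> (\<forall>t. n (t + \<beta>) = n t) \<and>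
      (\<forall>s t. s \<le> t \<and> t - s \<le> D \<longrightarrow> integral {s..t} (\<lambda>x. \<bar>n x - c\<bar>) \<le> \<epsilon>)"
    obtain Nn where Nn: "primitive_of Nn (\<lambda>t. 1 + \<bar>n t\<bar>)"
      using primitive_of_exists[OF loc_integrable_add[OF loc_integrable_const loc_integrable_abs]] n by blast
    have pert: "perturbation f0 f1 B L P0 P1 a c \<beta> p1 p2 l r M T Zv Zw \<eta> \<epsilon> n Nn"
      by (intro perturbation.intro near_autonomous_axioms perturbation_axioms.intro)
        (use \<eta>(1,2) \<eta>1 \<eta>2 \<eta>3 \<epsilon>(1,2) 1 2 n Nn in auto)
    interpret perturbation f0 f1 B L P0 P1 a c \<beta> p1 p2 l r M T Zv Zw \<eta> \<epsilon> n Nn by (rule pert)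
    have "\<forall>j. \<exists>tp. j \<in> {1..M} \<longrightarrow> snd tp \<in> {p1..p2} \<and> \<bar>\<beta> - real j * T (snd tp)\<bar> < \<eta> \<and>
        (\<forall>t. uv (fst tp) (snd tp) (t + \<beta>) = uv (fst tp) (snd tp) t) \<and>
        (\<forall>t. uw (fst tp) (snd tp) (t + \<beta>) = uw (fst tp) (snd tp) t)"
    proof
      fix j
      show "\<exists>tp. j \<in> {1..M} \<longrightarrow> snd tp \<in> {p1..p2} \<and> \<bar>\<beta> - real j * T (snd tp)\<bar> < \<eta> \<and>
        (\<forall>t. uv (fst tp) (snd tp) (t + \<beta>) = uv (fst tp) (snd tp) t) \<and>
        (\<forall>t. uw (fst tp) (snd tp) (t + \<beta>) = uw (fst tp) (snd tp) t)"
      proof (cases "j \<in> {1..M}")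
        case True
        then obtain t0 p where "p \<in> {p1..p2} \<and> \<bar>\<beta> - real j * T p\<bar> < \<eta> \<and>
            (\<forall>t. uv t0 p (t + \<beta>) = uv t0 p t) \<and> (\<forall>t. uw t0 p (t + \<beta>) = uw t0 p t)"
          using periodic_solution[of j] by auto
        then show ?thesis by (intro exI[of _ "(t0, p)"]) simp
      next
        case False
        then show ?thesis by blast
      qed
    qed
    then obtain tp where "\<forall>j. j \<in> {1..M} \<longrightarrow> snd (tp j) \<in> {p1..p2} \<and> \<bar>\<beta> - real j * T (snd (tp j))\<bar> < \<eta> \<and>
        (\<forall>t. uv (fst (tp j)) (snd (tp j)) (t + \<beta>) = uv (fst (tp j)) (snd (tp j)) t) \<and>
        (\<forall>t. uw (fst (tp j)) (snd (tp j)) (t + \<beta>) = uw (fst (tp j)) (snd (tp j)) t)"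
      by (rule choice[THEN exE])
    then have tp: "\<And>j. j \<in> {1..M} \<Longrightarrow> snd (tp j) \<in> {p1..p2}"
        "\<And>j. j \<in> {1..M} \<Longrightarrow> \<bar>\<beta> - real j * T (snd (tp j))\<bar> < \<eta>"
        "\<And>j t. j \<in> {1..M} \<Longrightarrow> uv (fst (tp j)) (snd (tp j)) (t + \<beta>) = uv (fst (tp j)) (snd (tp j)) t"
        "\<And>j t. j \<in> {1..M} \<Longrightarrow> uw (fst (tp j)) (snd (tp j)) (t + \<beta>) = uw (fst (tp j)) (snd (tp j)) t"
      by blast+
    define v where "v j = uv (fst (tp j)) (snd (tp j))" for j
    have \<beta>D: "\<beta> \<le> D" using Tmax_pos by (simp add: D_def)
    have distinct: "v j \<noteq> v i" if ji: "j \<in> {1..M}" "i \<in> {1..M}" "j < i" for j i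
    proof
      assume eq: "v j = v i"
      define t0 p s0 q where "t0 = fst (tp j)" and "p = snd (tp j)" and "s0 = fst (tp i)" and "q = snd (tp i)"
      have pq: "p \<in> {p1..p2}" "q \<in> {p1..p2}" using tp(1) ji by (auto simp: p_def q_def)
      have uveq: "uv t0 p = uv s0 q" using eq by (simp add: v_def t0_def p_def s0_def q_def)
      have "uw t0 p t = uw s0 q t" for t
        using solution_derivative[OF u_sol[of t0 p], of t] solution_derivative[OF u_sol[of s0 q], of t]
        unfolding uveq by (rule DERIV_unique)
      then have "energy t0 p s0 = q\<^sup>2 / 2"
        using energy_init[of s0 q] by (simp add: energy_def uveq)
      moreover have "energy t0 p (t + \<beta>) = energy t0 p t" for t
        using tp(3,4)[OF ji(1)] by (simp add: energy_def t0_def p_def)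
      \<comment> \<open>Periodicity moves the crossing time \<open>s0\<close> of the second orbit
        into the first period of the first one, where \<open>energy_near\<close> applies.\<close>
      then obtain t' where t': "t' \<in> {t0..t0 + \<beta>}" "energy t0 p t' = energy t0 p s0"
        using periodic_value_in_interval[OF beta_pos, of "energy t0 p" t0 s0] by blast
      moreover have "\<bar>energy t0 p t' - p\<^sup>2 / 2\<bar> \<le> B * W * \<epsilon>"
        by (rule energy_near[OF pq(1)]) (use t' \<beta>D in auto)
      ultimately have E: "\<bar>q\<^sup>2 / 2 - p\<^sup>2 / 2\<bar> < p1 * \<delta>" using 4 by simp
      have "p1 * \<bar>q - p\<bar> \<le> (q + p) / 2 * \<bar>q - p\<bar>" using pq by (intro mult_right_mono) auto
      also have "\<dots> = \<bar>(q + p) / 2 * (q - p)\<bar>" using pq p1_pos by (simp add: abs_mult)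
      also have "(q + p) / 2 * (q - p) = q\<^sup>2 / 2 - p\<^sup>2 / 2" by (simp add: power2_eq_square field_simps)
      finally have "p1 * \<bar>q - p\<bar> < p1 * \<delta>" using E by simp
      then have "\<bar>q - p\<bar> < \<delta>" using p1_pos by simp
      then have dT: "T p < T q + \<gamma>" using \<delta>(2)[OF pq] by linarith
      \<comment> \<open>Both \<open>j * T p\<close> and \<open>i * T q\<close> are within
        \<open>\<eta>\<close> of \<open>\<beta>\<close>. Together with the estimate built here this
        gives \<open>T p < 2 * \<eta> + Tm / 4 \<le> 3 * Tm / 4\<close>, against
        \<open>Tm \<le> T p\<close>.\<close>
      have "(real j + 1) * T p \<le> real i * T p" using ji T_pos[OF pq(1)] by (intro mult_right_mono) auto
      also have "\<dots> \<le> real i * (T q + \<gamma>)" using dT by (intro mult_left_mono) auto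
      also have "\<dots> \<le> real i * T q + (real M + 1) * \<gamma>"
        using ji \<gamma> by (simp add: distrib_left mult_right_mono)
      also have "(real M + 1) * \<gamma> = Tm / 4" by (simp add: \<gamma>_def divide_simps)
      finally have 5: "real j * T p + T p \<le> real i * T q + Tm / 4" by (simp add: algebra_simps)
      have 6: "\<bar>\<beta> - real j * T p\<bar> < \<eta>" "\<bar>\<beta> - real i * T q\<bar> < \<eta>" using tp(2) ji by (auto simp: p_def q_def)
      define u where "u = Tm / 4"
      have "Tm = 4 * u" by (simp add: u_def)
      then show False using 5[folded u_def] 6 Tm(1) Tm(2)[OF pq(1)] \<eta>(6)[folded u_def] by linarith
    qed
    have inj: "inj_on v {1..M}"
    proof (rule inj_onI)
      fix x y assume "x \<in> {1..M}" "y \<in> {1..M}" "v x = v y"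
      then show "x = y" using distinct[of x y] distinct[of y x] by (metis linorder_neqE_nat)
    qed
    show "\<exists>S. finite S \<and> card S = M \<and> (\<forall>v\<in>S. (\<exists>w. solution f0 f1 n v w) \<and> (\<forall>t. v (t + \<beta>) = v t) \<and>
        (\<forall>t. 0 < v t \<and> v t < 1))"
    proof (intro exI[of _ "v ` {1..M}"] conjI ballI)
      show "finite (v ` {1..M})" by simp
      show "card (v ` {1..M}) = M" using card_image[OF inj] by simp
      fix y assume "y \<in> v ` {1..M}"
      then obtain j where j: "j \<in> {1..M}" "y = v j" by blast
      show "\<exists>w. solution f0 f1 n y w" unfolding j(2) v_def using u_sol by blast
      show per: "\<forall>t. y (t + \<beta>) = y t" unfolding j(2) v_def using tp(3)[OF j(1)] by blast
      show "\<forall>t. 0 < y t \<and> y t < 1"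
      proof
        fix t
        define t0 p where "t0 = fst (tp j)" and "p = snd (tp j)"
        have p: "p \<in> {p1..p2}" using tp(1)[OF j(1)] by (simp add: p_def)
        obtain t' where t': "t' \<in> {t0..t0 + \<beta>}" "y t' = y t"
          using periodic_value_in_interval[OF beta_pos, of y t0 t] per by blast
        have "\<bar>t' - t0\<bar> \<le> D" using t' \<beta>D by auto
        then have "\<bar>uv t0 p t' - Zv p (t' - t0)\<bar> \<le> B * \<epsilon> * Ex" using close[of t' t0 p] by linarith
        then have "0 < uv t0 p t' \<and> uv t0 p t' < 1" using Z_range[OF p, of "t' - t0"] 3 by linarith
        then show "0 < y t \<and> y t < 1" using t'(2) by (simp add: j(2) v_def t0_def p_def)
      qed
    qed
  qed
qed

end

section \<open>Caratheodory solutions\<close>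

text \<open>Induction on the number of intervals, removing one with the largest left endpoint: all
  the others end before it begins.\<close>

lemma sum_increments_nonoverlapping_le:
  fixes \<Psi> s t :: "_ \<Rightarrow> real"
  assumes "finite I" and mono: "\<And>x y. x \<le> y \<Longrightarrow> \<Psi> x \<le> \<Psi> y" and "a \<le> b"
    and "\<And>i. i \<in> I \<Longrightarrow> a \<le> s i \<and> s i \<le> t i \<and> t i \<le> b"
    and "\<And>i j. i \<in> I \<Longrightarrow> j \<in> I \<Longrightarrow> i \<noteq> j \<Longrightarrow> t i \<le> s j \<or> t j \<le> s i"
  shows "(\<Sum>i\<in>I. \<Psi> (t i) - \<Psi> (s i)) \<le> \<Psi> b - \<Psi> a"
proof -
  have nondeg: "(\<Sum>i\<in>I. \<Psi> (t i) - \<Psi> (s i)) \<le> \<Psi> b - \<Psi> a"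
    if "finite I" "a \<le> b" "\<And>i. i \<in> I \<Longrightarrow> a \<le> s i \<and> s i < t i \<and> t i \<le> b"
      "\<And>i j. i \<in> I \<Longrightarrow> j \<in> I \<Longrightarrow> i \<noteq> j \<Longrightarrow> t i \<le> s j \<or> t j \<le> s i" for I b
    using that
  proof (induction "card I" arbitrary: I b)
    case 0
    then show ?case using mono[OF \<open>a \<le> b\<close>] by simp
  next
    case (Suc k)
    then have "I \<noteq> {}" by auto
    then have ne: "s ` I \<noteq> {}" "finite (s ` I)" using Suc.prems(1) by auto
    obtain i where i: "i \<in> I" "s i = Max (s ` I)" using Max_in[OF ne(2,1)] by auto
    have max: "s j \<le> s i" if "j \<in> I" for j using i(2) ne(2) that by simp
    have "(\<Sum>j\<in>I - {i}. \<Psi> (t j) - \<Psi> (s j)) \<le> \<Psi> (s i) - \<Psi> a"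
    proof (rule Suc.hyps(1))
      show "k = card (I - {i})" using Suc.hyps(2) i(1) Suc.prems(1) by simp
      show "a \<le> s i" using Suc.prems(3)[OF i(1)] by simp
      fix j assume j: "j \<in> I - {i}"
      have "\<not> t i \<le> s j" using max[of j] j Suc.prems(3)[OF i(1)] by force
      then have "t j \<le> s i" using Suc.prems(4)[OF i(1), of j] j by auto
      then show "a \<le> s j \<and> s j < t j \<and> t j \<le> s i" using Suc.prems(3)[of j] j by auto
    qed (use Suc.prems(1,4) in auto)
    moreover have "(\<Sum>j\<in>I. \<Psi> (t j) - \<Psi> (s j)) = (\<Psi> (t i) - \<Psi> (s i)) + (\<Sum>j\<in>I - {i}. \<Psi> (t j) - \<Psi> (s j))"
      by (rule sum.remove[OF Suc.prems(1) i(1)])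
    moreover have "\<Psi> (t i) \<le> \<Psi> b" using mono Suc.prems(3)[OF i(1)] by simp
    ultimately show ?case by linarith
  qed
  \<comment> \<open>Degenerate intervals contribute 0 and are dropped first: if the removed interval
    were a single point, another one could start there and extend beyond it.\<close>
  define J where "J = {i \<in> I. s i < t i}"
  have "(\<Sum>i\<in>I. \<Psi> (t i) - \<Psi> (s i)) = (\<Sum>i\<in>J. \<Psi> (t i) - \<Psi> (s i))"
  proof (rule sum.mono_neutral_right[OF assms(1)])
    show "\<forall>i\<in>I - J. \<Psi> (t i) - \<Psi> (s i) = 0" using assms(4) by (force simp: J_def)
  qed (auto simp: J_def)
  also have "\<dots> \<le> \<Psi> b - \<Psi> a"
    by (rule nondeg) (use assms in \<open>auto simp: J_def\<close>)
  finally show ?thesis .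
qed

text \<open>Truncation: \<open>\<bar>\<phi>\<bar> \<le> k + \<psi> k\<close>, where the excess
  \<open>\<psi> k\<close> above level \<open>k\<close> has integral tending to 0, and the bounded
  part contributes at most \<open>k\<close> times the total length.\<close>

lemma primitive_loc_abs_cont:
  assumes x: "primitive_of x \<phi>" shows "loc_abs_cont x"
  unfolding loc_abs_cont_def abs_cont_on_def
proof (intro allI impI)
  fix a b e :: real assume ab: "a \<le> b" and e: "0 < e"
  have loc: "loc_integrable \<phi>" by (rule primitive_of_loc[OF x])
  define \<psi> where "\<psi> k r = max (\<bar>\<phi> r\<bar> - real k) 0" for k :: nat and r
  have \<psi>loc: "loc_integrable (\<psi> k)" for k
    unfolding loc_integrable_def \<psi>_def
  proof (intro allI)
    fix s t
    have "(\<lambda>r. \<bar>\<phi> r\<bar> - real k) absolutely_integrable_on {s..t}"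
      using loc_integrableD[OF loc_integrable_diff[OF loc_integrable_abs[OF loc] loc_integrable_const]] .
    then show "(\<lambda>r. max (\<bar>\<phi> r\<bar> - real k) 0) absolutely_integrable_on {s..t}"
      by (intro absolutely_integrable_max_1) auto
  qed
  have "(\<lambda>k. integral {a..b} (\<psi> k)) \<longlonglongrightarrow> integral {a..b} (\<lambda>r. 0)"
  proof (rule dominated_convergence(2)[where h="\<lambda>r. \<bar>\<phi> r\<bar>"])
    show "\<psi> k integrable_on {a..b}" for k by (rule loc_integrable_imp_integrable[OF \<psi>loc])
    show "(\<lambda>r. \<bar>\<phi> r\<bar>) integrable_on {a..b}" by (rule loc_integrable_imp_integrable[OF loc_integrable_abs[OF loc]])
    show "norm (\<psi> k r) \<le> \<bar>\<phi> r\<bar>" for k r by (simp add: \<psi>_def)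
    fix r
    obtain K :: nat where "\<bar>\<phi> r\<bar> \<le> real K" using real_arch_simple by blast
    then have "\<forall>\<^sub>F k in sequentially. \<psi> k r = 0"
      by (intro eventually_sequentiallyI[of K]) (simp add: \<psi>_def)
    then show "(\<lambda>k. \<psi> k r) \<longlonglongrightarrow> 0" by (rule tendsto_eventually)
  qed
  then have "\<forall>\<^sub>F k in sequentially. integral {a..b} (\<psi> k) < e / 2"
    using e by (intro order_tendstoD(2)[of _ 0]) auto
  then obtain k where k: "integral {a..b} (\<psi> k) < e / 2" by (meson eventually_happens sequentially_bot)
  obtain \<Psi> where \<Psi>: "primitive_of \<Psi> (\<psi> k)" using primitive_of_exists[OF \<psi>loc] by blast
  have mono: "\<Psi> u \<le> \<Psi> v" if "u \<le> v" for u v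
    by (rule primitive_of_nonneg_mono[OF \<Psi> _ that]) (simp add: \<psi>_def)
  show "\<exists>d>0. \<forall>(m::nat) s t. (\<forall>i<m. a \<le> s i \<and> s i \<le> t i \<and> t i \<le> b) \<and>
      (\<forall>i<m. \<forall>j<m. i \<noteq> j \<longrightarrow> t i \<le> s j \<or> t j \<le> s i) \<and> (\<Sum>i<m. t i - s i) < d \<longrightarrow>
      (\<Sum>i<m. \<bar>x (t i) - x (s i)\<bar>) < e"
  \<comment> \<open>Leaves \<open>e / 2\<close> for the bounded part; \<open>k + 1\<close> also
    covers \<open>k = 0\<close>.\<close>
  proof (intro exI[of _ "e / (2 * (real k + 1))"] conjI allI impI)
    show "0 < e / (2 * (real k + 1))" using e by simp
    fix m :: nat and s t :: "nat \<Rightarrow> real"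
    assume H: "(\<forall>i<m. a \<le> s i \<and> s i \<le> t i \<and> t i \<le> b) \<and>
      (\<forall>i<m. \<forall>j<m. i \<noteq> j \<longrightarrow> t i \<le> s j \<or> t j \<le> s i) \<and> (\<Sum>i<m. t i - s i) < e / (2 * (real k + 1))"
    have "(\<Sum>i<m. \<bar>x (t i) - x (s i)\<bar>) \<le> (\<Sum>i<m. real k * (t i - s i) + (\<Psi> (t i) - \<Psi> (s i)))"
    proof (rule sum_mono)
      fix i assume "i \<in> {..<m}"
      then have le: "s i \<le> t i" using H by auto
      have P: "primitive_of (\<lambda>r. real k * r + \<Psi> r) (\<lambda>r. real k * 1 + \<psi> k r)"
        by (intro primitive_of_add primitive_of_cmult primitive_of_ident \<Psi>)
      have "\<bar>x (t i) - x (s i)\<bar> \<le> (real k * t i + \<Psi> (t i)) - (real k * s i + \<Psi> (s i))"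
        by (rule primitive_of_abs_le[OF x P le]) (simp add: \<psi>_def)
      then show "\<bar>x (t i) - x (s i)\<bar> \<le> real k * (t i - s i) + (\<Psi> (t i) - \<Psi> (s i))"
        by (simp add: algebra_simps)
    qed
    also have "\<dots> = real k * (\<Sum>i<m. t i - s i) + (\<Sum>i<m. \<Psi> (t i) - \<Psi> (s i))"
      by (simp add: sum.distrib sum_distrib_left)
    also have "(\<Sum>i<m. \<Psi> (t i) - \<Psi> (s i)) \<le> \<Psi> b - \<Psi> a"
      by (rule sum_increments_nonoverlapping_le[OF _ mono ab]) (use H in auto)
    also have "\<Psi> b - \<Psi> a = integral {a..b} (\<psi> k)" by (rule primitive_ofD[OF \<Psi> ab])
    finally have 1: "(\<Sum>i<m. \<bar>x (t i) - x (s i)\<bar>) \<le> real k * (\<Sum>i<m. t i - s i) + integral {a..b} (\<psi> k)"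
      by simp
    have "real k * (\<Sum>i<m. t i - s i) \<le> (real k + 1) * (e / (2 * (real k + 1)))"
      using H by (intro mult_mono) (auto intro!: sum_nonneg)
    also have "\<dots> = e / 2" by (simp add: divide_simps)
    finally show "(\<Sum>i<m. \<bar>x (t i) - x (s i)\<bar>) < e" using 1 k by simp
  qed
qed

text \<open>Lebesgue differentiation in one-sided form gives the right derivative off
  \<open>N1\<close>. Applied to \<open>\<phi> (- t)\<close> it gives the left derivative off the
  reflection of \<open>N2\<close>.\<close>

lemma primitive_AE_derivative:
  assumes x: "primitive_of x \<phi>"
  shows "AE t in lborel. (x has_real_derivative \<phi> t) (at t)"
proof -
  have loc: "loc_integrable \<phi>" by (rule primitive_of_loc[OF x])
  have int: "\<phi> integrable_on cbox a b" "(\<lambda>t. \<phi> (- t)) integrable_on cbox a b" for a b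
    using loc_integrable_imp_integrable[OF loc] loc_integrable_imp_integrable[OF loc_integrable_reflect[OF loc]] by auto
  obtain N1 where N1: "negligible N1" and
    r: "\<And>t e. t \<notin> N1 \<Longrightarrow> 0 < e \<Longrightarrow> \<exists>d>0. \<forall>h. 0 < h \<and> h < d \<longrightarrow>
        norm (integral (cbox t (t + h *\<^sub>R One)) \<phi> /\<^sub>R h ^ DIM(real) - \<phi> t) < e"
    using integrable_ccontinuous_explicit[OF int(1)] by blast
  obtain N2 where N2: "negligible N2" and
    l: "\<And>t e. t \<notin> N2 \<Longrightarrow> 0 < e \<Longrightarrow> \<exists>d>0. \<forall>h. 0 < h \<and> h < d \<longrightarrow>
        norm (integral (cbox t (t + h *\<^sub>R One)) (\<lambda>t. \<phi> (- t)) /\<^sub>R h ^ DIM(real) - \<phi> (- t)) < e"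
    using integrable_ccontinuous_explicit[OF int(2)] by blast
  have xr: "primitive_of (\<lambda>t. - x (- t)) (\<lambda>t. \<phi> (- t))"
    using primitive_of_cmult[OF primitive_of_reflect[OF x], of "-1"] by simp
  have deriv: "(x has_real_derivative \<phi> t) (at t)" if t: "t \<notin> N1 \<union> uminus ` N2" for t
    unfolding DERIV_def LIM_def
  proof (intro allI impI)
    fix e :: real assume e: "0 < e"
    have t12: "t \<notin> N1" "- t \<notin> N2" using t by (auto simp: image_iff)
    obtain d1 where d1: "d1 > 0" "\<And>h. 0 < h \<Longrightarrow> h < d1 \<Longrightarrow> \<bar>integral {t..t + h} \<phi> / h - \<phi> t\<bar> < e"
      using r[OF t12(1) e] by (auto simp: divide_inverse_commute)
    obtain d2 where d2: "d2 > 0" "\<And>h. 0 < h \<Longrightarrow> h < d2 \<Longrightarrow> \<bar>integral {- t..- t + h} (\<lambda>t. \<phi> (- t)) / h - \<phi> t\<bar> < e"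
      using l[OF t12(2) e] by (auto simp: divide_inverse_commute)
    show "\<exists>s>0. \<forall>h::real. h \<noteq> 0 \<and> dist h 0 < s \<longrightarrow> dist ((x (t + h) - x t) / h) (\<phi> t) < e"
    proof (intro exI[of _ "min d1 d2"] conjI allI impI)
      fix h :: real assume h: "h \<noteq> 0 \<and> dist h 0 < min d1 d2"
      show "dist ((x (t + h) - x t) / h) (\<phi> t) < e"
      proof (cases "0 < h")
        case True
        then show ?thesis using d1(2)[of h] h primitive_ofD[OF x, of t "t + h"] by (simp add: dist_real_def)
      next
        case False
        have "integral {- t..- t + - h} (\<lambda>t. \<phi> (- t)) = x t - x (t + h)"
          using primitive_ofD[OF xr, of "- t" "- t + - h"] False by (simp add: add.commute)
        moreover have "\<bar>integral {- t..- t + - h} (\<lambda>t. \<phi> (- t)) / - h - \<phi> t\<bar> < e"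
          using d2(2)[of "- h"] False h by (simp add: dist_real_def)
        ultimately show ?thesis by (simp add: dist_real_def minus_divide_left[symmetric] diff_divide_distrib)
      qed
    qed (use d1 d2 in auto)
  qed
  have "negligible (N1 \<union> uminus ` N2)"
    by (intro negligible_Un N1 negligible_differentiable_image_negligible[OF _ N2]) (auto intro!: derivative_intros)
  then have "AE t in lebesgue. t \<notin> N1 \<union> uminus ` N2"
    unfolding negligible_iff_null_sets by (rule AE_not_in)
  then have "AE t in lebesgue. (x has_real_derivative \<phi> t) (at t)"
    by (rule AE_mp) (simp add: deriv)
  then show ?thesis by (simp add: AE_completion_iff)
qed

lemma carath_solutionI:
  assumes sol: "solution f0 f1 n v w"
    and f0: "\<And>t. f0 (v t) = g * v t" and f1: "\<And>t. f1 (v t) = - F (v t)"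
  shows "carath_solution g n F v"
proof -
  have v: "primitive_of v w" and w: "primitive_of w (\<lambda>t. g * v t - n t * F (v t))"
    using sol by (auto simp: solution_def f0 f1)
  have "AE t in lborel. \<exists>v''. (w has_real_derivative v'') (at t) \<and> v'' - g * v t + n t * F (v t) = 0"
    using primitive_AE_derivative[OF w] by (rule AE_mp) (auto intro!: AE_I2 exI)
  then show ?thesis
    unfolding carath_solution_def
    using primitive_loc_abs_cont[OF v] primitive_loc_abs_cont[OF w]
      primitive_of_has_derivative[OF v primitive_of_continuous[OF w]] by blast
qed

section \<open>Large constant coefficients\<close>

text \<open>Only solutions with values in \<open>]0,1[\<close> matter, so the right-hand side is frozen outside
  \<open>[0,1]\<close> to make it globally bounded and Lipschitz.\<close>

definition clamp01 :: "real \<Rightarrow> real" where "clamp01 x = max 0 (min 1 x)"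

lemma clamp01: "0 \<le> clamp01 x" "clamp01 x \<le> 1" "\<bar>clamp01 x - clamp01 y\<bar> \<le> \<bar>x - y\<bar>"
  by (auto simp: clamp01_def)

lemma clamp01_id: "0 \<le> x \<Longrightarrow> x \<le> 1 \<Longrightarrow> clamp01 x = x"
  by (simp add: clamp01_def)

lemma antiderivative_exists:
  fixes f :: "real \<Rightarrow> real"
  assumes "continuous_on UNIV f"
  obtains P where "\<And>s. (P has_real_derivative f s) (at s)" "P a = 0"
  using primitive_of_exists[OF loc_integrable_continuous[OF assms], of a 0] primitive_of_has_derivative[OF _ assms]
  by blast

text \<open>The increment of a primitive over one period does not depend on where the period
  starts.\<close>

lemma integral_periodic_le:
  fixes \<phi> :: "real \<Rightarrow> real"
  assumes "loc_integrable \<phi>" "\<And>t. \<phi> (t + \<beta>) = \<phi> t" "\<And>t. 0 \<le> \<phi> t" "s \<le> t" "t - s \<le> real k * \<beta>"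
    and "0 < \<beta>"
  shows "integral {s..t} \<phi> \<le> real k * integral {0..\<beta>} \<phi>"
proof -
  obtain \<Phi> where \<Phi>: "primitive_of \<Phi> \<phi>" using primitive_of_exists[OF assms(1)] by blast
  have "primitive_of (\<lambda>t. \<Phi> (t + \<beta>) - \<Phi> t) (\<lambda>t. \<phi> (t + \<beta>) - \<phi> t)"
    by (rule primitive_of_diff[OF primitive_of_shift[OF \<Phi>] \<Phi>])
  then have "primitive_of (\<lambda>t. \<Phi> (t + \<beta>) - \<Phi> t) (\<lambda>t. 0)" by (simp add: assms(2))
  then have const: "\<Phi> (u + \<beta>) - \<Phi> u = \<Phi> (v + \<beta>) - \<Phi> v" if "u \<le> v" for u v
    using primitive_ofD[OF _ that] by fastforce
  have one: "\<Phi> (u + \<beta>) - \<Phi> u = integral {0..\<beta>} \<phi>" for u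
    using const[of u 0] const[of 0 u] primitive_ofD[OF \<Phi>, of 0 \<beta>] \<open>0 < \<beta>\<close> by (cases "u \<le> 0") auto
  have "\<Phi> (s + real m * \<beta>) - \<Phi> s = real m * integral {0..\<beta>} \<phi>" for m
  proof (induction m)
    case (Suc m)
    have "s + real (Suc m) * \<beta> = (s + real m * \<beta>) + \<beta>" by (simp add: algebra_simps)
    then show ?case using Suc one[of "s + real m * \<beta>"] by (simp add: algebra_simps)
  qed simp
  moreover have "\<Phi> t \<le> \<Phi> (s + real k * \<beta>)"
    by (rule primitive_of_nonneg_mono[OF \<Phi> assms(3)]) (use assms(5) in simp)
  ultimately show ?thesis using primitive_ofD[OF \<Phi> assms(4)] by (metis diff_right_mono)
qed

text \<open>For each large \<open>c\<close> this builds the well, its orbits and the strip that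
  \<open>near_autonomous\<close> asks for; the threshold \<open>\<mu>\<close> depends on the number
  \<open>M\<close> of solutions, and \<open>\<epsilon>\<close> on \<open>c\<close> as well.\<close>

lemma constant_coefficient_neighbourhood:
  fixes g a \<beta> :: real and F :: "real \<Rightarrow> real" and M :: nat
  assumes g_pos: "g > 0"
    and F_C1: "F C1_differentiable_on UNIV"
    and a_in: "0 < a" "a < 1"
    and F_zeros: "F 0 = 0" "F a = 0" "F 1 = 0"
    and F_pos: "\<And>s. a < s \<Longrightarrow> s < 1 \<Longrightarrow> F s > 0"
    and F_neg: "\<And>s. 0 < s \<Longrightarrow> s < a \<Longrightarrow> F s < 0"
    and F'_a: "deriv F a > 0"
    and beta_pos: "\<beta> > 0"
  shows "\<exists>\<mu>>0. \<forall>c>\<mu>. \<exists>\<epsilon>>0. \<forall>n. loc_integrable n \<and> (\<forall>t. n (t + \<beta>) = n t) \<and>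
      integral {0..\<beta>} (\<lambda>x. \<bar>n x - c\<bar>) < \<epsilon> \<longrightarrow>
      (\<exists>S. finite S \<and> card S = M \<and> (\<forall>v\<in>S. carath_solution g n F v \<and> (\<forall>t. v (t + \<beta>) = v t) \<and>
        (\<forall>t. 0 < v t \<and> v t < 1)))"
proof -
  obtain F' where F': "\<And>x. (F has_real_derivative F' x) (at x)" and cF': "continuous_on UNIV F'"
    using F_C1 by (auto simp: C1_differentiable_on_def has_real_derivative_iff_has_vector_derivative)
  have F'a: "F' a > 0" using F'_a DERIV_imp_deriv[OF F'[of a]] by simp
  have cF: "continuous_on S F" for S using F' by (meson DERIV_isCont continuous_at_imp_continuous_on)
  have cF01: "continuous_on {0..1} F" "continuous_on {0..1} F'" using cF cF' continuous_on_subset by blast+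
  have bdd: "\<exists>K. \<forall>x\<in>{0..1}. \<bar>h x\<bar> \<le> K" if "continuous_on {0..1} h" for h :: "real \<Rightarrow> real"
    using compact_continuous_image[OF that compact_Icc, THEN compact_imp_bounded] by (auto simp: bounded_iff)
  obtain K where K: "\<And>x. x \<in> {0..1} \<Longrightarrow> \<bar>F' x\<bar> \<le> K" using bdd[OF cF01(2)] by blast
  obtain K0 where K0: "\<And>x. x \<in> {0..1} \<Longrightarrow> \<bar>F x\<bar> \<le> K0" using bdd[OF cF01(1)] by blast
  have Kpos: "0 \<le> K" using K[of 0] by (simp add: order_trans[OF abs_ge_zero])
  have Flip: "\<bar>F x - F y\<bar> \<le> K * \<bar>x - y\<bar>" if "x \<in> {0..1}" "y \<in> {0..1}" for x y
    using field_differentiable_bound[of "{0..1}" F F' K x y] has_field_derivative_at_within[OF F'] K that by auto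
  define f0 where "f0 x = g * clamp01 x" for x
  define f1 where "f1 x = - F (clamp01 x)" for x
  have f0_id: "f0 x = g * x" and f1_id: "f1 x = - F x" if "0 \<le> x" "x \<le> 1" for x
    using clamp01_id[OF that] by (auto simp: f0_def f1_def)
  define B where "B = g + \<bar>K0\<bar>"
  define L where "L = g + K"
  have osc0: "bounded_lipschitz f0 f1 B L"
  proof
    show "\<bar>f0 x\<bar> \<le> B" for x
    proof -
      have "g * clamp01 x \<le> g * 1" by (rule mult_left_mono[OF clamp01(2)]) (use g_pos in simp)
      moreover have "\<bar>f0 x\<bar> = g * clamp01 x" using clamp01(1)[of x] g_pos by (simp add: f0_def abs_mult)
      ultimately show ?thesis unfolding B_def by linarith
    qed
    show "\<bar>f1 x\<bar> \<le> B" for x using K0[of "clamp01 x"] clamp01[of x] g_pos by (simp add: f1_def B_def)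
    show "\<bar>f0 x - f0 y\<bar> \<le> L * \<bar>x - y\<bar>" for x y
    proof -
      have "\<bar>f0 x - f0 y\<bar> = g * \<bar>clamp01 x - clamp01 y\<bar>"
        using g_pos by (simp add: f0_def right_diff_distrib[symmetric] abs_mult)
      also have "\<dots> \<le> L * \<bar>x - y\<bar>" using clamp01(3)[of x y] g_pos Kpos by (intro mult_mono) (auto simp: L_def)
      finally show ?thesis .
    qed
    show "\<bar>f1 x - f1 y\<bar> \<le> L * \<bar>x - y\<bar>" for x y
    proof -
      have "\<bar>f1 x - f1 y\<bar> \<le> K * \<bar>clamp01 x - clamp01 y\<bar>"
        using Flip[of "clamp01 x" "clamp01 y"] clamp01 by (simp add: f1_def abs_minus_commute)
      also have "\<dots> \<le> L * \<bar>x - y\<bar>" using clamp01(3)[of x y] g_pos Kpos by (intro mult_mono) (auto simp: L_def)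
      finally show ?thesis .
    qed
    show "0 \<le> L" using g_pos Kpos by (simp add: L_def)
  qed
  interpret bounded_lipschitz f0 f1 B L by (rule osc0)
  obtain P0 where P0: "\<And>s. (P0 has_real_derivative f0 s) (at s)" "P0 a = 0"
    using antiderivative_exists[OF f_continuous(1)] by blast
  obtain P1 where P1: "\<And>s. (P1 has_real_derivative f1 s) (at s)" "P1 a = 0"
    using antiderivative_exists[OF f_continuous(2)] by blast
  have f1a: "f1 a = 0" using f1_id[of a] a_in F_zeros by simp
  define \<kappa> where "\<kappa> = F' a / 2"
  have \<kappa>: "0 < \<kappa>" using F'a by (simp add: \<kappa>_def)
  have "isCont F' a" using cF' by (simp add: continuous_on_eq_continuous_at)
  then obtain d where d: "d > 0" "\<And>s. \<bar>s - a\<bar> < d \<Longrightarrow> \<bar>F' s - F' a\<bar> < \<kappa>"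
    using \<kappa> unfolding continuous_at_eps_delta dist_real_def by blast
  define \<delta> where "\<delta> = min (d / 2) (min (a / 2) ((1 - a) / 2))"
  have \<delta>: "0 < \<delta>" "\<delta> < d" "\<delta> < a" "a + \<delta> < 1" using d(1) a_in by (auto simp: \<delta>_def min_def field_simps)
  have F'low: "\<kappa> \<le> F' s" if "\<bar>s - a\<bar> \<le> \<delta>" for s
  proof -
    have "\<bar>F' s - F' a\<bar> < \<kappa>" by (rule d(2)) (use that \<delta> in simp)
    moreover have "F' a = 2 * \<kappa>" by (simp add: \<kappa>_def)
    ultimately show ?thesis by linarith
  qed
  have Fd: "0 < F (a + \<delta>)" using F_pos \<delta> by simp
  have P1d: "P1 (a + \<delta>) < 0"
  proof -
    have "P1 (a + \<delta>) < P1 a"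
    proof (rule DERIV_neg_imp_decreasing_open[of a "a + \<delta>" P1])
      fix x assume x: "a < x" "x < a + \<delta>"
      have "f1 x < 0" using f1_id[of x] F_pos[of x] x \<delta> a_in by simp
      then show "\<exists>y. (P1 has_real_derivative y) (at x) \<and> y < 0" using P1(1) by blast
    qed (use \<delta> P1(1) in \<open>auto intro!: continuous_at_imp_continuous_on DERIV_isCont\<close>)
    then show ?thesis using P1(2) by simp
  qed
  \<comment> \<open>Makes \<open>M\<close> times the bound \<open>2 * pi / \<omega>\<close> for the
    period of small orbits less than \<open>\<beta>\<close>.\<close>
  define \<omega> where "\<omega> = 2 * pi * real M / \<beta> + 1"
  have \<omega>: "0 < \<omega>" using beta_pos by (simp add: \<omega>_def add_nonneg_pos)
  \<comment> \<open>One summand for each demand on \<open>c\<close>: near \<open>a\<close> the force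
    has slope at most \<open>- \<omega>\<^sup>2\<close>, at \<open>a + \<delta>\<close> it is
    negative, and the potential there is positive. The 1 makes \<open>\<mu>\<close>
    positive.\<close>
  define \<mu> where "\<mu> = 1 + (\<omega>\<^sup>2 + g) / \<kappa> + g / F (a + \<delta>) + \<bar>P0 (a + \<delta>)\<bar> / \<bar>P1 (a + \<delta>)\<bar>"
  have parts: "0 \<le> (\<omega>\<^sup>2 + g) / \<kappa>" "0 \<le> g / F (a + \<delta>)" "0 \<le> \<bar>P0 (a + \<delta>)\<bar> / \<bar>P1 (a + \<delta>)\<bar>"
    using g_pos \<kappa> Fd by auto
  have \<mu>: "0 < \<mu>" "(\<omega>\<^sup>2 + g) / \<kappa> \<le> \<mu>" "g / F (a + \<delta>) \<le> \<mu>" "\<bar>P0 (a + \<delta>)\<bar> / \<bar>P1 (a + \<delta>)\<bar> \<le> \<mu>"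
    using parts unfolding \<mu>_def by linarith+
  show ?thesis
  proof (rule exI[of _ \<mu>], rule conjI[OF \<mu>(1)], intro allI impI)
    fix c assume c: "\<mu> < c"
    have c0: "0 < c" using c \<mu>(1) by simp
    have c1: "\<omega>\<^sup>2 \<le> c * \<kappa> - g" using order_le_less_trans[OF \<mu>(2) c] \<kappa> by (simp add: pos_divide_less_eq)
    have c2: "g < c * F (a + \<delta>)" using order_le_less_trans[OF \<mu>(3) c] Fd by (simp add: pos_divide_less_eq)
    have c3: "\<bar>P0 (a + \<delta>)\<bar> < c * \<bar>P1 (a + \<delta>)\<bar>" 
    proof -
      have "0 < \<bar>P1 (a + \<delta>)\<bar>" using P1d by simp
      then show ?thesis using order_le_less_trans[OF \<mu>(4) c] pos_divide_less_eq by blast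
    qed
    define f where "f s = f0 s + c * f1 s" for s
    define U where "U s = - P0 s - c * P1 s" for s
    have f_id: "f s = g * s - c * F s" if "0 \<le> s" "s \<le> 1" for s
      using f0_id[OF that] f1_id[OF that] by (simp add: f_def)
    have U': "(U has_real_derivative - f s) (at s)" for s
      unfolding U_def f_def using P0(1)[of s] P1(1)[of s] by (auto intro!: derivative_eq_intros)
    have aut: "autonomous f (B * (1 + c)) (L * (1 + c))"
    proof
      show "\<bar>f x\<bar> \<le> B * (1 + c)" for x unfolding f_def using rhs_bound[of x c] c0 by simp
      show "\<bar>f x - f y\<bar> \<le> L * (1 + c) * \<bar>x - y\<bar>" for x y unfolding f_def using rhs_lip[of x c y c] c0 by simp
      show "0 \<le> L * (1 + c)" using L_nonneg c0 by simp
    qed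
    have cf: "continuous_on S f" for S
      unfolding f_def using f_continuous by (intro continuous_intros) (auto intro: continuous_on_subset)
    have slope: "f y - f x \<le> - \<omega>\<^sup>2 * (y - x)" if "a - \<delta> \<le> x" "x \<le> y" "y \<le> a + \<delta>" for x y
    proof (cases "x = y")
      case False
      then have xy: "x < y" using that by simp
      obtain z where z: "x < z" "z < y" "F y - F x = (y - x) * F' z" using MVT2[OF xy F'] by blast
      have "\<kappa> \<le> F' z" by (rule F'low) (use z that in auto)
      then have "\<omega>\<^sup>2 \<le> c * F' z - g" using c1 mult_left_mono[of \<kappa> "F' z" c] c0 by linarith
      then have "\<omega>\<^sup>2 * (y - x) \<le> (c * F' z - g) * (y - x)" using xy by (intro mult_right_mono) auto
      moreover have "f y - f x = g * (y - x) - c * (F y - F x)"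
        using f_id[of x] f_id[of y] that \<delta> xy a_in by (simp add: algebra_simps)
      ultimately show ?thesis unfolding z(3) by (simp add: algebra_simps)
    qed simp
    have fa: "0 < f a" using f_id[of a] a_in F_zeros g_pos by simp
    have fd: "f (a + \<delta>) < 0"
    proof -
      have "g * (a + \<delta>) \<le> g * 1" using g_pos \<delta> by (intro mult_left_mono) auto
      then show ?thesis using f_id[of "a + \<delta>"] \<delta> a_in c2 by simp
    qed
    \<comment> \<open>The centre; the term \<open>g * v\<close> shifts it from \<open>a\<close>
      slightly to the right.\<close>
    obtain vc where vc: "a < vc" "vc < a + \<delta>" "f vc = 0"
    proof -
      obtain x where x: "a \<le> x" "x \<le> a + \<delta>" "f x = 0"
        using IVT2'[of f "a + \<delta>" 0 a] fa fd \<delta> cf by auto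
      then have "x \<noteq> a" "x \<noteq> a + \<delta>" using fa fd by auto
      then show ?thesis using x that[of x] by simp
    qed
    have fpos: "0 < f s" if "0 < s" "s < vc" for s
    proof (cases "s \<le> a")
      case True
      have "F s \<le> 0" using F_neg[of s] F_zeros that True by (cases "s = a") auto
      then have "c * F s \<le> 0" using c0 by (simp add: mult_le_0_iff)
      moreover have "0 < g * s" using g_pos that by simp
      ultimately show ?thesis using f_id[of s] that True a_in by simp
    next
      case False
      have "0 < \<omega>\<^sup>2 * (vc - s)" using \<omega> that by simp
      then show ?thesis using slope[of s vc] False that vc \<delta> by simp
    qed
    have f1: "f 1 = g" using f_id[of 1] F_zeros by simp
    \<comment> \<open>The right rim \<open>b\<close> will be the first zero of \<open>f\<close>
      beyond \<open>a + \<delta>\<close>; it lies below 1 because \<open>f 1 = g > 0\<close>. The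
      left rim is 0.\<close>
    have "continuous_on {0..1 - (a + \<delta>)} (\<lambda>u. - f (a + \<delta> + u))"
      by (intro continuous_intros continuous_on_compose2[OF cf[of UNIV]]) auto
    then obtain s where s: "0 < s" "s \<le> 1 - (a + \<delta>)" "- f (a + \<delta> + s) = 0"
      and spos: "\<And>u. 0 \<le> u \<Longrightarrow> u < s \<Longrightarrow> 0 < - f (a + \<delta> + u)"
      using first_zero[of "1 - (a + \<delta>)" "\<lambda>u. - f (a + \<delta> + u)"] fd g_pos \<delta> f1 by auto
    define b where "b = a + \<delta> + s"
    have fb: "f b = 0" using s by (simp add: b_def)
    have b: "a + \<delta> < b" "b < 1"
    proof -
      show "a + \<delta> < b" using s by (simp add: b_def)
      have "b \<noteq> 1" using fb f1 g_pos by auto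
      then show "b < 1" using s by (simp add: b_def)
    qed
    have fneg: "f u < 0" if "vc < u" "u < b" for u
    proof (cases "u < a + \<delta>")
      case True
      have "0 < \<omega>\<^sup>2 * (u - vc)" using \<omega> that by simp
      then show ?thesis using slope[of vc u] True that vc \<delta> by simp
    next
      case False
      then show ?thesis using spos[of "u - (a + \<delta>)"] that by (simp add: b_def)
    qed
    have Ud: "0 < U (a + \<delta>)"
      using c3 P1d by (simp add: U_def)
    have Ub: "U (a + \<delta>) < U b"
    proof (rule DERIV_pos_imp_increasing_open[OF b(1)])
      fix x assume "a + \<delta> < x" "x < b"
      then have "f x < 0" using fneg vc by simp
      then show "\<exists>y. (U has_real_derivative y) (at x) \<and> 0 < y" using U'[of x] by (intro exI[of _ "- f x"]) simp
    qed (use U' in \<open>auto intro!: continuous_at_imp_continuous_on DERIV_isCont\<close>)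
    have "well f (B * (1 + c)) (L * (1 + c)) U a vc b"
    proof (intro well.intro aut well_axioms.intro)
      show "f 0 = 0" using f_id[of 0] F_zeros by simp
      show "U a = 0" by (simp add: U_def P0 P1)
    qed (use U' a_in vc b fpos fneg fb Ub Ud in auto)
    then interpret w: well f "B * (1 + c)" "L * (1 + c)" U a vc b .
    have "U a < U 0" "U a < U (a - \<delta>)" using w.U_antimono[of 0 a] w.U_antimono[of "a - \<delta>" a] a_in \<delta> vc by auto
    then have U0: "0 < U 0" "0 < U (a - \<delta>)" by (auto simp: w.U_a)
    define e0 where "e0 = min (min (U b) (U 0)) (min (U (a - \<delta>)) (U (a + \<delta>)))"
    have e0: "0 < e0" "e0 \<le> U b" "e0 \<le> U 0" "e0 \<le> U (a - \<delta>)" "e0 \<le> U (a + \<delta>)"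
      using U0 Ud Ub by (auto simp: e0_def)
    \<comment> \<open>This orbit has energy \<open>e0 / 2\<close>, below both rims and below the
      potential at \<open>a - \<delta>\<close> and \<open>a + \<delta>\<close>, as
      \<open>period_small\<close> requires.\<close>
    define p1 where "p1 = sqrt e0"
    have p1: "0 < p1" "p1\<^sup>2 / 2 < e0" using e0 by (auto simp: p1_def)
    have q1: "p1\<^sup>2 / 2 < U b" "p1\<^sup>2 / 2 < U 0" "p1\<^sup>2 / 2 < U (a - \<delta>)" "p1\<^sup>2 / 2 < U (a + \<delta>)"
      using order_less_le_trans[OF p1(2)] e0 by auto
    have "w.period p1 \<le> 2 * pi / \<omega>"
    proof (rule w.period_small[OF p1(1) q1(1,2) \<omega> \<delta>(1) _ q1(3) _ q1(4)])
      show "\<omega>\<^sup>2 * (vc - u) \<le> f u" if "a - \<delta> \<le> u" "u \<le> vc" for u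
        using slope[of u vc] that vc by simp
      show "f u \<le> - \<omega>\<^sup>2 * (u - vc)" if "vc \<le> u" "u \<le> a + \<delta>" for u
        using slope[of vc u] that vc \<delta> by simp
    qed (use \<delta> b vc in auto)
    then have "real M * w.period p1 \<le> real M * (2 * pi / \<omega>)" by (rule mult_left_mono) simp
    also have "\<dots> < \<beta>"
    proof -
      have "\<beta> * \<omega> = 2 * pi * real M + \<beta>" using beta_pos by (simp add: \<omega>_def field_simps)
      then have "2 * pi * real M < \<beta> * \<omega>" using beta_pos by simp
      then show ?thesis using \<omega> by (simp add: pos_divide_less_eq mult_ac)
    qed
    finally have T1: "real M * w.period p1 < \<beta>" .
    obtain p2 where p2: "p1 < p2" "p2\<^sup>2 / 2 < U b" "p2\<^sup>2 / 2 < U 0" "\<beta> < w.period p2"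
      using w.period_large[OF p1(1) q1(1,2), of \<beta>] beta_pos by auto
    have adm: "0 < p" "p\<^sup>2 / 2 < U b" "p\<^sup>2 / 2 < U 0" if "p \<in> {p1..p2}" for p
    proof -
      have "p\<^sup>2 / 2 \<le> p2\<^sup>2 / 2" using that p1(1) by (simp add: power_mono)
      then show "p\<^sup>2 / 2 < U b" "p\<^sup>2 / 2 < U 0" using p2(2,3) order_le_less_trans by blast+
      show "0 < p" using that p1(1) by simp
    qed
    define l where "l = w.X p2 (- w.R'.turn_time p2)"
    define r where "r = w.X p2 (w.R.turn_time p2)"
    have p2m: "p2 \<in> {p1..p2}" using p2(1) by simp
    have lr: "0 < l" "r < 1"
      using w.X_turn_bounds(1,4)[OF adm[OF p2m]] b by (auto simp: l_def r_def)
    have sol: "solution f0 f1 (\<lambda>_. c) (w.X p) (w.Y p)" for p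
    proof -
      note d = trajectoryD[OF w.XY(1)[of p]]
      have 1: "primitive_of (w.X p) (w.Y p)"
        by (rule primitive_of_derivative[OF d(1) trajectory_continuous(2)[OF w.XY(1)]])
      have "continuous_on UNIV (\<lambda>t. f (w.X p t))"
        by (rule continuous_on_compose2[OF cf[of UNIV] trajectory_continuous(1)[OF w.XY(1)]]) simp
      then have "primitive_of (w.Y p) (\<lambda>t. f (w.X p t))" by (rule primitive_of_derivative[OF d(2)])
      then show ?thesis using 1 by (simp add: solution_def f_def)
    qed
    have na: "near_autonomous f0 f1 B L P0 P1 a c \<beta> p1 p2 l r M w.period w.X w.Y"
    proof (intro near_autonomous.intro near_autonomous_axioms.intro oscillator.intro oscillator_axioms.intro osc0)
      show "l \<le> w.X p t \<and> w.X p t \<le> r" if "p \<in> {p1..p2}" for p t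
        unfolding l_def r_def by (rule w.X_uniform_range) (use that p1(1) p2 in auto)
      show "w.X p (t + real j * w.period p) = w.X p t" "w.Y p (t + real j * w.period p) = w.Y p t"
        if "p \<in> {p1..p2}" for p t j using w.XY_period_mult[OF adm[OF that]] by auto
      show "continuous_on {p1..p2} w.period" by (rule w.period_continuous[OF p1(1) p2(2,3)])
      show "0 < w.period p" if "p \<in> {p1..p2}" for p by (rule w.period_pos[OF adm[OF that]])
      show "solution f0 f1 (\<lambda>_. c) (w.X p) (w.Y p)" "w.X p 0 = a" "w.Y p 0 = p" for p
        by (rule sol w.XY(2,3))+
      show "0 \<le> c" using c0 by simp
    qed (rule P0 P1 f1a beta_pos p1(1) p2(1,4) T1)+
    define D where "D = near_autonomous.D \<beta> p1 p2 M w.period"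
    obtain \<epsilon> where \<epsilon>: "0 < \<epsilon>" and main: "\<forall>n. loc_integrable n \<and> (\<forall>t. n (t + \<beta>) = n t) \<and>
      (\<forall>s t. s \<le> t \<and> t - s \<le> D \<longrightarrow> integral {s..t} (\<lambda>x. \<bar>n x - c\<bar>) \<le> \<epsilon>) \<longrightarrow>
      (\<exists>S. finite S \<and> card S = M \<and> (\<forall>v\<in>S. (\<exists>w. solution f0 f1 n v w) \<and> (\<forall>t. v (t + \<beta>) = v t) \<and>
        (\<forall>t. 0 < v t \<and> v t < 1)))"
      using near_autonomous.perturbed_solutions[OF na lr, folded D_def] by (elim exE conjE)
    \<comment> \<open>So many periods cover an interval of length \<open>D\<close>. The bound over
      one period will be \<open>\<epsilon> / (k + 1)\<close>, where the added 1 keeps the divisor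
      visibly positive.\<close>
    obtain k :: nat where "D / \<beta> \<le> real k" using real_arch_simple by blast
    then have k: "D \<le> real k * \<beta>" using beta_pos by (simp add: pos_divide_le_eq)
    show "\<exists>\<epsilon>>0. \<forall>n. loc_integrable n \<and> (\<forall>t. n (t + \<beta>) = n t) \<and>
      integral {0..\<beta>} (\<lambda>x. \<bar>n x - c\<bar>) < \<epsilon> \<longrightarrow>
      (\<exists>S. finite S \<and> card S = M \<and> (\<forall>v\<in>S. carath_solution g n F v \<and> (\<forall>t. v (t + \<beta>) = v t) \<and>
        (\<forall>t. 0 < v t \<and> v t < 1)))"
    proof (intro exI[of _ "\<epsilon> / (real k + 1)"] conjI allI impI; (elim conjE)?)
      show "0 < \<epsilon> / (real k + 1)" using \<epsilon> by simp
      fix n assume n: "loc_integrable n" "\<forall>t. n (t + \<beta>) = n t" "integral {0..\<beta>} (\<lambda>x. \<bar>n x - c\<bar>) < \<epsilon> / (real k + 1)"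
      have "integral {s..t} (\<lambda>x. \<bar>n x - c\<bar>) \<le> \<epsilon>" if "s \<le> t" "t - s \<le> D" for s t
      proof -
        have loc: "loc_integrable (\<lambda>x. \<bar>n x - c\<bar>)" by (intro loc_integrable_abs loc_integrable_diff n(1)) simp
        have "integral {s..t} (\<lambda>x. \<bar>n x - c\<bar>) \<le> real k * integral {0..\<beta>} (\<lambda>x. \<bar>n x - c\<bar>)"
          by (rule integral_periodic_le[OF loc _ _ that(1)]) (use n(2) k that(2) beta_pos in auto)
        also have "\<dots> \<le> (real k + 1) * (\<epsilon> / (real k + 1))"
          using n(3) by (intro mult_mono integral_nonneg loc_integrable_imp_integrable[OF loc]) auto
        also have "\<dots> = \<epsilon>" by simp
        finally show ?thesis .
      qed
      then have "loc_integrable n \<and> (\<forall>t. n (t + \<beta>) = n t) \<and>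
          (\<forall>s t. s \<le> t \<and> t - s \<le> D \<longrightarrow> integral {s..t} (\<lambda>x. \<bar>n x - c\<bar>) \<le> \<epsilon>)"
        using n(1,2) by simp
      from main[rule_format, OF this]
      obtain S where S: "finite S" "card S = M" "\<And>v. v \<in> S \<Longrightarrow> (\<exists>w. solution f0 f1 n v w) \<and> (\<forall>t. v (t + \<beta>) = v t) \<and>
          (\<forall>t. 0 < v t \<and> v t < 1)" by blast
      have "carath_solution g n F v" if v: "v \<in> S" for v
      proof -
        obtain u where u: "solution f0 f1 n v u" using S(3)[OF v] by blast
        have range: "0 \<le> v t" "v t \<le> 1" for t using S(3)[OF v] less_imp_le by blast+
        show ?thesis by (rule carath_solutionI[OF u f0_id[OF range] f1_id[OF range]])
      qed
      then show "\<exists>S. finite S \<and> card S = M \<and> (\<forall>v\<in>S. carath_solution g n F v \<and> (\<forall>t. v (t + \<beta>) = v t) \<and>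
        (\<forall>t. 0 < v t \<and> v t < 1))" using S by blast
    qed
  qed
qed

section \<open>Uniformity over the interval of means\<close>

theorem theorem1:
  fixes g a \<beta> :: real and F :: "real \<Rightarrow> real"
  assumes g_pos: "g > 0"
    and F_C1: "F C1_differentiable_on UNIV"
    and a_in: "0 < a" "a < 1"
    and F_zeros: "F 0 = 0" "F a = 0" "F 1 = 0"
    and F_pos: "\<And>s. s < 0 \<or> (a < s \<and> s < 1) \<Longrightarrow> F s > 0"
    and F_neg: "\<And>s. (0 < s \<and> s < a) \<or> 1 < s \<Longrightarrow> F s < 0"
    and F'_a: "deriv F a > 0"
    and beta_pos: "\<beta> > 0"
  shows "\<forall>N::nat. N \<ge> 1 \<longrightarrow>
     (\<exists>\<mu>>0. \<forall>\<mu>1 \<mu>2. \<mu> < \<mu>1 \<and> \<mu>1 \<le> \<mu>2 \<longrightarrow>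
        (\<exists>\<epsilon>>0. \<forall>(n::real \<Rightarrow> real) (nbar::real) (ntil::real \<Rightarrow> real).
           (\<forall>x. n (x + \<beta>) = n x) \<and>
           (\<forall>x. n x \<ge> 0) \<and>
           (\<forall>c d. n absolutely_integrable_on {c..d}) \<and>
           (\<forall>x. ntil (x + \<beta>) = ntil x) \<and>
           (\<forall>x. n x = nbar + ntil x) \<and>
           \<mu>1 \<le> nbar \<and> nbar \<le> \<mu>2 \<and>
           integral {0..\<beta>} (\<lambda>x. \<bar>ntil x\<bar>) < \<epsilon>
           \<longrightarrow> (\<exists>S::(real \<Rightarrow> real) set. finite S \<and> card S \<ge> 2 * N \<and>
                  (\<forall>v\<in>S. carath_solution g n F v \<and>
                          (\<forall>x. v (x + \<beta>) = v x) \<and>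
                          (\<forall>x. 0 < v x \<and> v x < 1)))))"
proof (intro allI impI)
  fix N :: nat
  have Fp: "F s > 0" if "a < s" "s < 1" for s using F_pos that by blast
  have Fn: "F s < 0" if "0 < s" "s < a" for s using F_neg that by blast
  obtain \<mu> where \<mu>: "0 < \<mu>" and ex: "\<forall>c>\<mu>. \<exists>\<epsilon>>0. \<forall>n. loc_integrable n \<and> (\<forall>t. n (t + \<beta>) = n t) \<and>
      integral {0..\<beta>} (\<lambda>x. \<bar>n x - c\<bar>) < \<epsilon> \<longrightarrow>
      (\<exists>S. finite S \<and> card S = 2 * N \<and> (\<forall>v\<in>S. carath_solution g n F v \<and> (\<forall>t. v (t + \<beta>) = v t) \<and>
        (\<forall>t. 0 < v t \<and> v t < 1)))"
    using constant_coefficient_neighbourhood[OF g_pos F_C1 a_in F_zeros Fp Fn F'_a beta_pos, of "2 * N"] by blast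
  then have "\<forall>c. \<exists>\<epsilon>. \<mu> < c \<longrightarrow> 0 < \<epsilon> \<and> (\<forall>n. loc_integrable n \<and> (\<forall>t. n (t + \<beta>) = n t) \<and>
      integral {0..\<beta>} (\<lambda>x. \<bar>n x - c\<bar>) < \<epsilon> \<longrightarrow>
      (\<exists>S. finite S \<and> card S = 2 * N \<and> (\<forall>v\<in>S. carath_solution g n F v \<and> (\<forall>t. v (t + \<beta>) = v t) \<and>
        (\<forall>t. 0 < v t \<and> v t < 1))))" by blast
  from choice[OF this] obtain e where e: "\<And>c. \<mu> < c \<Longrightarrow> 0 < e c" and sols: "\<And>c n. \<mu> < c \<Longrightarrow> loc_integrable n \<Longrightarrow> \<forall>t. n (t + \<beta>) = n t \<Longrightarrow>
      integral {0..\<beta>} (\<lambda>x. \<bar>n x - c\<bar>) < e c \<Longrightarrow>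
      (\<exists>S. finite S \<and> card S = 2 * N \<and> (\<forall>v\<in>S. carath_solution g n F v \<and> (\<forall>t. v (t + \<beta>) = v t) \<and>
        (\<forall>t. 0 < v t \<and> v t < 1)))" by blast
  show "\<exists>\<mu>>0. \<forall>\<mu>1 \<mu>2. \<mu> < \<mu>1 \<and> \<mu>1 \<le> \<mu>2 \<longrightarrow>
        (\<exists>\<epsilon>>0. \<forall>(n::real \<Rightarrow> real) (nbar::real) (ntil::real \<Rightarrow> real).
           (\<forall>x. n (x + \<beta>) = n x) \<and>
           (\<forall>x. n x \<ge> 0) \<and>
           (\<forall>c d. n absolutely_integrable_on {c..d}) \<and>
           (\<forall>x. ntil (x + \<beta>) = ntil x) \<and>
           (\<forall>x. n x = nbar + ntil x) \<and>
           \<mu>1 \<le> nbar \<and> nbar \<le> \<mu>2 \<and>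
           integral {0..\<beta>} (\<lambda>x. \<bar>ntil x\<bar>) < \<epsilon>
           \<longrightarrow> (\<exists>S::(real \<Rightarrow> real) set. finite S \<and> card S \<ge> 2 * N \<and>
                  (\<forall>v\<in>S. carath_solution g n F v \<and>
                          (\<forall>x. v (x + \<beta>) = v x) \<and>
                          (\<forall>x. 0 < v x \<and> v x < 1))))"
  proof (rule exI[of _ \<mu>], rule conjI[OF \<mu>], intro allI impI)
    fix \<mu>1 \<mu>2 assume \<mu>12: "\<mu> < \<mu>1 \<and> \<mu>1 \<le> \<mu>2"
    \<comment> \<open>Replacing \<open>nbar\<close> by a centre \<open>c\<close> of the finite cover
      costs less than \<open>\<beta> * e c / (2 * \<beta>) = e c / 2\<close> in the L^1 norm over a
      period; the other half of \<open>e c\<close> is left for \<open>ntil\<close>.\<close>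
    obtain C where C: "C \<subseteq> {\<mu>1..\<mu>2}" "finite C" "{\<mu>1..\<mu>2} \<subseteq> (\<Union>c\<in>C. ball c (e c / (2 * \<beta>)))"
    proof (rule compactE_image[of "{\<mu>1..\<mu>2}" "{\<mu>1..\<mu>2}" "\<lambda>c. ball c (e c / (2 * \<beta>))"])
      show "{\<mu>1..\<mu>2} \<subseteq> (\<Union>c\<in>{\<mu>1..\<mu>2}. ball c (e c / (2 * \<beta>)))"
      proof
        fix c assume c: "c \<in> {\<mu>1..\<mu>2}"
        then have "0 < e c / (2 * \<beta>)" using e[of c] \<mu>12 beta_pos by simp
        then show "c \<in> (\<Union>c\<in>{\<mu>1..\<mu>2}. ball c (e c / (2 * \<beta>)))" using c by (metis UN_I centre_in_ball)
      qed
    qed auto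
    have Cne: "C \<noteq> {}" using C(3) \<mu>12 by auto
    define \<epsilon> where "\<epsilon> = Min ((\<lambda>c. e c / 2) ` C)"
    have Cpos: "0 < e c" if "c \<in> C" for c using e[of c] C(1) \<mu>12 that by auto
    have \<epsilon>: "0 < \<epsilon>" unfolding \<epsilon>_def using C(2) Cne Cpos by (subst Min_gr_iff) auto
    have \<epsilon>le: "\<epsilon> \<le> e c / 2" if "c \<in> C" for c unfolding \<epsilon>_def using C(2) that by (intro Min_le) auto
    show "\<exists>\<epsilon>>0. \<forall>(n::real \<Rightarrow> real) (nbar::real) (ntil::real \<Rightarrow> real).
           (\<forall>x. n (x + \<beta>) = n x) \<and>
           (\<forall>x. n x \<ge> 0) \<and>
           (\<forall>c d. n absolutely_integrable_on {c..d}) \<and>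
           (\<forall>x. ntil (x + \<beta>) = ntil x) \<and>
           (\<forall>x. n x = nbar + ntil x) \<and>
           \<mu>1 \<le> nbar \<and> nbar \<le> \<mu>2 \<and>
           integral {0..\<beta>} (\<lambda>x. \<bar>ntil x\<bar>) < \<epsilon>
           \<longrightarrow> (\<exists>S::(real \<Rightarrow> real) set. finite S \<and> card S \<ge> 2 * N \<and>
                  (\<forall>v\<in>S. carath_solution g n F v \<and>
                          (\<forall>x. v (x + \<beta>) = v x) \<and>
                          (\<forall>x. 0 < v x \<and> v x < 1)))"
    proof (rule exI[of _ \<epsilon>], rule conjI[OF \<epsilon>], intro allI impI, elim conjE)
      fix n ntil :: "real \<Rightarrow> real" and nbar :: real
      assume n: "\<forall>x. n (x + \<beta>) = n x" "\<forall>c d. n absolutely_integrable_on {c..d}" "\<forall>x. n x = nbar + ntil x"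
        "\<mu>1 \<le> nbar" "nbar \<le> \<mu>2" "integral {0..\<beta>} (\<lambda>x. \<bar>ntil x\<bar>) < \<epsilon>"
      have loc: "loc_integrable n" using n(2) by (simp add: loc_integrable_def)
      have ntil: "ntil = (\<lambda>x. n x - nbar)" using n(3) by auto
      obtain c where c: "c \<in> C" "\<bar>nbar - c\<bar> < e c / (2 * \<beta>)"
        using C(3) n(4,5) by (force simp: dist_real_def abs_minus_commute)
      have li: "loc_integrable (\<lambda>x. \<bar>n x - d\<bar>)" for d by (intro loc_integrable_abs loc_integrable_diff loc) simp
      have "integral {0..\<beta>} (\<lambda>x. \<bar>n x - c\<bar>) \<le> integral {0..\<beta>} (\<lambda>x. \<bar>n x - nbar\<bar> + \<bar>nbar - c\<bar>)"
        by (intro integral_le loc_integrable_imp_integrable loc_integrable_add li loc_integrable_const) simp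
      also have "\<dots> = integral {0..\<beta>} (\<lambda>x. \<bar>n x - nbar\<bar>) + \<beta> * \<bar>nbar - c\<bar>"
        using beta_pos by (subst integral_add) (auto intro: loc_integrable_imp_integrable[OF li])
      also have "\<dots> < e c"
      proof -
        have "\<beta> * \<bar>nbar - c\<bar> < e c / 2" using c(2) beta_pos by (simp add: field_simps)
        then show ?thesis using n(6) \<epsilon>le[OF c(1)] by (simp add: ntil)
      qed
      finally have "integral {0..\<beta>} (\<lambda>x. \<bar>n x - c\<bar>) < e c" .
      moreover have "\<mu> < c" using c(1) C(1) \<mu>12 by auto
      ultimately obtain S where "finite S" "card S = 2 * N" "\<forall>v\<in>S. carath_solution g n F v \<and> (\<forall>t. v (t + \<beta>) = v t) \<and>
        (\<forall>t. 0 < v t \<and> v t < 1)" using sols[OF _ loc n(1)] by blast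
      then show "\<exists>S::(real \<Rightarrow> real) set. finite S \<and> card S \<ge> 2 * N \<and>
                  (\<forall>v\<in>S. carath_solution g n F v \<and>
                          (\<forall>x. v (x + \<beta>) = v x) \<and>
                          (\<forall>x. 0 < v x \<and> v x < 1))" by (intro exI[of _ S]) simp
    qed
  qed
qed

end
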